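(* Let $(c,q)\in\mathfrak K$, $d=c-\sum_iq_i$ and $\eta_q=\sum_{i:q_i>0}\delta_{q_i}$. (i) The map $(c,q)\mapsto(d,\eta_q)$ is an isomorphism of commutative monoids from $\mathfrak K$ (with $(c,q)\star(c',r)=(c+c',q\sqcup r)$) onto $\mathbb R_{\ge0}\times\mathfrak N_1$ with componentwise addition. Writing $(a)=(a,0,0,\dots)$, one has the pointwise factorization $$\Psi_{c,q}=\lim_{L\to\infty}\big(\Psi_{d,0}\star\Psi_{q_1,(q_1)}\star\cdots\star\Psi_{q_L,(q_L)}\big).$$ (ii) For an integer $n\ge2$, an $n$-th convolution root of $\Psi_{c,q}$ exists if and only if every atom multiplicity of $\eta_q$ is divisible by $n$. The root is then unique and equals $\Psi_{c/n,r}$, where $\eta_r=\eta_q/n$. (iii) The infinitely divisible characters are precisely the pure-dust characters $\Psi_{c,0}$, $c\ge0$. Every convolution semigroup $(\Psi_t)_{t\ge0}$ is of the form $\Psi_t=\Psi_{at,0}$, $t\ge0$, for a unique $a\ge0$, and is consequently pointwise continuous.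
   Context: Rooted trees are finite, unlabelled and non-plane (considered up to root-preserving isomorphism); $\mathcal T$ is the set of all of them, $V(t)$ the vertex set of (a representative of) $t$; $\bullet$ is the one-vertex tree. The real Grossman--Larson Hopf algebra $\mathcal G$ has basis $(F_t)_{t\in\mathcal T}$ and product $F_sF_t=\sum_{f:\{1,\dots,k\}\to V(t)}F_{t\circ_f(s_1,\dots,s_k)}$, where $s_1,\dots,s_k$ are the root branches of $s$ (the trees left after deleting the root of $s$, rooted at the children of that root, treated as distinct occurrences) and $t\circ_f(s_1,\dots,s_k)$ is the tree, with the root of $t$ as root, obtained by joining the root of each $s_i$ by an edge to $f(i)$; the unit is $F_\bullet$. If $t$ has root branches $t_1,\dots,t_k$ and, for $I\subseteq\{1,\dots,k\}$, $t_{(I)}$ denotes the tree with root branches $t_i$, $i\in I$, then $\Delta(F_t)=\sum_{I\sqcup J=\{1,\dots,k\}}F_{t_{(I)}}\otimes F_{t_{(J)}}$ (ordered bipartitions) and $\varepsilon(F_t)=\mathbf 1_{\{t=\bullet\}}$. Hopf convolution of linear functionals is $(f\star g)(x)=(f\otimes g)(\Delta x)$, with identity $\varepsilon$. A unital basis-positive character is a linear multiplicative functional $\mathcal G\to\mathbb R$ sending $F_\bullet$ to $1$ and nonnegative on every $F_t$. These form a commutative monoid under $\star$. For an integer partition $\lambda$, $P_\lambda$ is the rooted tree whose root branches are chains with $\lambda_1,\lambda_2,\dots$ vertices (the path-forest trees: every non-root vertex has at most one child). $\Lambda=\mathbb R[\mathsf p_1,\mathsf p_2,\dots]$ is the algebra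 of symmetric functions ($\mathsf p_k$ the power sums), $\widetilde m_\lambda=\big(\prod_{j\ge1}r_j(\lambda)!\big)m_\lambda$ ($m_\lambda$ monomial symmetric function, $r_j(\lambda)$ multiplicity of the part $j$). $\mathsf Q:\mathcal G\to\Lambda$ is the linear map (a Hopf morphism) with $\mathsf Q(F_{P_\lambda})=\widetilde m_\lambda$ and $\mathsf Q(F_t)=0$ for $t$ not path-forest. $\mathfrak K=\{(c,q):c\ge0,\ q_1\ge q_2\ge\cdots\ge0,\ \sum_iq_i\le c\}$. For $(c,q)\in\mathfrak K$, $\Psi_{c,q}=\operatorname{ev}_{c,q}\circ\mathsf Q$ where $\operatorname{ev}_{c,q}:\Lambda\to\mathbb R$ is the unital algebra homomorphism with $\operatorname{ev}_{c,q}(\mathsf p_1)=c$, $\operatorname{ev}_{c,q}(\mathsf p_k)=\sum_iq_i^k$ ($k\ge2$). The map $(c,q)\mapsto\Psi_{c,q}$ is a bijection onto the unital basis-positive characters, and $\Psi_{c,q}\star\Psi_{c',r}=\Psi_{c+c',q\sqcup r}$, where $q\sqcup r$ is the decreasing enumeration of the multiset union of the positive entries, zero padded if finite. $\mathfrak N_1$ is the set of Radon point measures $\eta$ on $(0,\infty)$ with integer multiplicities and $\int x\,\eta(dx)<\infty$. For $n\ge2$, an $n$-th convolution root of $\Psi$ is a unital basis-positive character $\Xi$ with $\Xi^{\star n}=\Psi$; $\Psi$ (a unital basis-positive character) is infinitely divisible if such a root exists for every integer $n\ge2$. A convolution semigroup is a family $(\Psi_t)_{t\ge0}$ of unital basis-positive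 characters with $\Psi_0=\varepsilon$ and $\Psi_{s+t}=\Psi_s\star\Psi_t$ for all $s,t\ge0$. Limits and continuity of characters are pointwise on the tree basis. *)

theory Defs
  imports
    "HOL-Analysis.Analysis"
    "HOL-Library.Multiset"
    "HOL-Library.Poly_Mapping"
    "HOL-Algebra.Group"
begin

section \<open>Rooted trees\<close>

text \<open>Nesting the datatype through multisets identifies exactly the isomorphic non-plane trees.\<close>

datatype rtree = Node (branches: "rtree multiset")

abbreviation bullet :: rtree where "bullet \<equiv> Node {#}"

text \<open>
  Plane trees serve as concrete representatives of unlabelled trees. A vertex is addressed by the
  list of child indices on the path leading to it from the root, the root being \<open>[]\<close>. The
  product and coproduct below do not depend on which representative \<open>rep\<close> picks.
\<close>

datatype ptree = PNode (pbranches: "ptree list")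

primrec shape :: "ptree \<Rightarrow> rtree" where
  "shape (PNode ts) = Node (mset (map shape ts))"

function vertices :: "ptree \<Rightarrow> nat list set" where
  "vertices (PNode ts) = insert [] (\<Union>i\<in>{..<length ts}. Cons i ` vertices (ts ! i))"
  by pat_completeness auto
termination
  by (relation "Wellfounded.measure size")
     (auto simp: less_Suc_eq_le intro!: size_list_estimation'[OF nth_mem])

definition rep :: "rtree \<Rightarrow> ptree" where
  "rep t = (SOME p. shape p = t)"

lemma shape_rep: "shape (rep t) = t"
proof -
  have "\<exists>p. shape p = t"
  proof (induction t)
    case (Node B)
    then obtain r where r: "\<And>b. b \<in># B \<Longrightarrow> shape (r b) = b" by metis
    obtain bs where bs: "mset bs = B" using ex_mset by blast
    have "map shape (map r bs) = bs"
      using r bs by (auto intro!: map_idI)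
    then have "shape (PNode (map r bs)) = Node B" using bs by simp
    then show ?case by blast
  qed
  then show ?thesis unfolding rep_def by (rule someI_ex)
qed

text \<open>The root branches as distinct occurrences \<open>t\<^sub>0, \<dots>, t\<^sub>k\<^sub>-\<^sub>1\<close> (indexed from 0).\<close>

definition branch_list :: "rtree \<Rightarrow> rtree list" where
  "branch_list t = map shape (pbranches (rep t))"

lemma mset_branch_list: "mset (branch_list t) = branches t"
  using shape_rep[of t] unfolding branch_list_def by (cases "rep t") auto

text \<open>\<open>attach p g\<close> joins, for every vertex \<open>v\<close> of \<open>p\<close>, the roots of the trees in \<open>g v\<close> to \<open>v\<close>.\<close>

function attach :: "ptree \<Rightarrow> (nat list \<Rightarrow> rtree multiset) \<Rightarrow> rtree" where
  "attach (PNode ts) g =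
     Node (mset (map (\<lambda>i. attach (ts ! i) (\<lambda>v. g (i # v))) [0..<length ts]) + g [])"
  by pat_completeness auto
termination
  by (relation "Wellfounded.measure (size \<circ> fst)")
     (auto simp: less_Suc_eq_le intro!: size_list_estimation'[OF nth_mem])

definition graft :: "ptree \<Rightarrow> rtree list \<Rightarrow> (nat \<Rightarrow> nat list) \<Rightarrow> rtree" where
  "graft p ss f = attach p (\<lambda>v. {# ss ! i. i \<in># mset_set {i. i < length ss \<and> f i = v} #})"


section \<open>The Grossman--Larson Hopf algebra\<close>

instantiation poly_mapping :: (type, real_vector) real_vector
begin

lift_definition scaleR_poly_mapping :: "real \<Rightarrow> ('a \<Rightarrow>\<^sub>0 'b) \<Rightarrow> ('a \<Rightarrow>\<^sub>0 'b)"
  is "\<lambda>c f x. c *\<^sub>R f x"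
  by (rule finite_subset[rotated]) auto

instance
  by standard (transfer; simp add: algebra_simps)+

end

text \<open>
  The vector spaces \<open>\<G>\<close> and \<open>\<G> \<otimes> \<G>\<close> are the free ones on trees and on pairs of trees, so
  \<open>gl_basis t\<close> is \<open>F\<^sub>t\<close> and \<open>Poly_Mapping.single (s, t) 1\<close> is \<open>F\<^sub>s \<otimes> F\<^sub>t\<close>.
\<close>

type_synonym gl = "rtree \<Rightarrow>\<^sub>0 real"

definition gl_basis :: "rtree \<Rightarrow> gl" where
  "gl_basis t = Poly_Mapping.single t 1"

definition gl_mult_basis :: "rtree \<Rightarrow> rtree \<Rightarrow> gl" where
  "gl_mult_basis s t =
     (\<Sum>f\<in>{..<length (branch_list s)} \<rightarrow>\<^sub>E vertices (rep t).
        gl_basis (graft (rep t) (branch_list s) f))"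

definition gl_mult :: "gl \<Rightarrow> gl \<Rightarrow> gl" where
  "gl_mult x y =
     (\<Sum>s\<in>Poly_Mapping.keys x. \<Sum>t\<in>Poly_Mapping.keys y.
        (Poly_Mapping.lookup x s * Poly_Mapping.lookup y t) *\<^sub>R gl_mult_basis s t)"

definition gl_comult_basis :: "rtree \<Rightarrow> (rtree \<times> rtree) \<Rightarrow>\<^sub>0 real" where
  "gl_comult_basis t =
     (let ts = branch_list t in
      \<Sum>I\<in>Pow {..<length ts}.
        Poly_Mapping.single
          (Node (mset (nths ts I)), Node (mset (nths ts ({..<length ts} - I)))) 1)"

definition gl_comult :: "gl \<Rightarrow> (rtree \<times> rtree) \<Rightarrow>\<^sub>0 real" where
  "gl_comult x =
     (\<Sum>t\<in>Poly_Mapping.keys x. Poly_Mapping.lookup x t *\<^sub>R gl_comult_basis t)"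

definition gl_counit :: "gl \<Rightarrow> real" where
  "gl_counit x = Poly_Mapping.lookup x bullet"

definition tensor_fun :: "(gl \<Rightarrow> real) \<Rightarrow> (gl \<Rightarrow> real) \<Rightarrow> ((rtree \<times> rtree) \<Rightarrow>\<^sub>0 real) \<Rightarrow> real" where
  "tensor_fun f g z =
     (\<Sum>(s, t)\<in>Poly_Mapping.keys z.
        Poly_Mapping.lookup z (s, t) * (f (gl_basis s) * g (gl_basis t)))"

definition convolve :: "(gl \<Rightarrow> real) \<Rightarrow> (gl \<Rightarrow> real) \<Rightarrow> gl \<Rightarrow> real" (infixl \<open>\<star>\<close> 70) where
  "(f \<star> g) x = tensor_fun f g (gl_comult x)"

definition conv_power :: "(gl \<Rightarrow> real) \<Rightarrow> nat \<Rightarrow> gl \<Rightarrow> real" where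
  "conv_power f n = (((\<star>) f) ^^ n) gl_counit"

definition ubp_character :: "(gl \<Rightarrow> real) \<Rightarrow> bool" where
  "ubp_character \<phi> \<longleftrightarrow>
     linear \<phi> \<and> (\<forall>x y. \<phi> (gl_mult x y) = \<phi> x * \<phi> y) \<and>
     \<phi> (gl_basis bullet) = 1 \<and> (\<forall>t. 0 \<le> \<phi> (gl_basis t))"

definition conv_root :: "nat \<Rightarrow> (gl \<Rightarrow> real) \<Rightarrow> (gl \<Rightarrow> real) \<Rightarrow> bool" where
  "conv_root n \<Psi> \<Xi> \<longleftrightarrow> ubp_character \<Xi> \<and> conv_power \<Xi> n = \<Psi>"

definition infinitely_divisible :: "(gl \<Rightarrow> real) \<Rightarrow> bool" where
  "infinitely_divisible \<Psi> \<longleftrightarrow> ubp_character \<Psi> \<and> (\<forall>n\<ge>2. \<exists>\<Xi>. conv_root n \<Psi> \<Xi>)"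

text \<open>Only the values at times \<open>t \<ge> 0\<close> are meaningful.\<close>

definition conv_semigroup :: "(real \<Rightarrow> gl \<Rightarrow> real) \<Rightarrow> bool" where
  "conv_semigroup S \<longleftrightarrow>
     (\<forall>t\<ge>0. ubp_character (S t)) \<and> S 0 = gl_counit \<and>
     (\<forall>s\<ge>0. \<forall>t\<ge>0. S (s + t) = S s \<star> S t)"


section \<open>Symmetric functions\<close>

text \<open>
  A monomial in the variables \<open>x\<^sub>0, x\<^sub>1, \<dots>\<close> is the multiset of the indices of its variables. A
  symmetric function is a formal series (given by its coefficients) of bounded degree that is
  invariant under permutations of the variables.
\<close>

typedef symfun = "{f :: nat multiset \<Rightarrow> real.
    (\<forall>\<pi> m. bij \<pi> \<longrightarrow> f (image_mset \<pi> m) = f m) \<and> (\<exists>d. \<forall>m. d < size m \<longrightarrow> f m = 0)}"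
  morphisms sym_coeff Abs_symfun
  by (rule exI[of _ "\<lambda>_. 0"]) simp

setup_lifting type_definition_symfun

lemma finite_submultisets: "finite {a. a \<subseteq># (m :: 'a multiset)}"
proof -
  have "{a. a \<subseteq># m} \<subseteq> {a. set_mset a \<subseteq> set_mset m \<and> size a \<le> size m}"
    by (auto dest: mset_subset_eqD size_mset_mono)
  moreover have "finite {a. set_mset a \<subseteq> set_mset m \<and> size a \<le> size m}"
  proof (rule finite_surj)
    show "finite {xs. set xs \<subseteq> set_mset m \<and> length xs \<le> size m}"
      by (rule finite_lists_length_le) simp
    show "{a. set_mset a \<subseteq> set_mset m \<and> size a \<le> size m}
        \<subseteq> mset ` {xs. set xs \<subseteq> set_mset m \<and> length xs \<le> size m}"
    proof
      fix a assume a: "a \<in> {a. set_mset a \<subseteq> set_mset m \<and> size a \<le> size m}"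
      obtain xs where "mset xs = a" using ex_mset by blast
      with a show "a \<in> mset ` {xs. set xs \<subseteq> set_mset m \<and> length xs \<le> size m}"
        by (intro image_eqI[of _ _ xs]) auto
    qed
  qed
  ultimately show ?thesis by (rule finite_subset)
qed

lemma image_mset_submultisets:
  fixes \<pi> :: "'a \<Rightarrow> 'a"
  assumes "bij \<pi>"
  shows "bij_betw (image_mset \<pi>) {a. a \<subseteq># m} {a. a \<subseteq># image_mset \<pi> m}"
proof (rule bij_betw_byWitness[where f' = "image_mset (inv_into UNIV \<pi>)"])
  have inv: "inv_into UNIV \<pi> \<circ> \<pi> = id" "\<pi> \<circ> inv_into UNIV \<pi> = id"
    using assms by (auto simp: fun_eq_iff bij_is_inj bij_is_surj surj_f_inv_f)
  have inv': "image_mset (inv_into UNIV \<pi>) (image_mset \<pi> a) = a"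
      "image_mset \<pi> (image_mset (inv_into UNIV \<pi>) a) = a" for a
    unfolding multiset.map_comp inv by simp_all
  show "\<forall>a\<in>{a. a \<subseteq># m}. image_mset (inv_into UNIV \<pi>) (image_mset \<pi> a) = a"
    "\<forall>a'\<in>{a. a \<subseteq># image_mset \<pi> m}. image_mset \<pi> (image_mset (inv_into UNIV \<pi>) a') = a'"
    by (simp_all add: inv')
  show "image_mset \<pi> ` {a. a \<subseteq># m} \<subseteq> {a. a \<subseteq># image_mset \<pi> m}"
    by (auto intro: image_mset_subseteq_mono)
  show "image_mset (inv_into UNIV \<pi>) ` {a. a \<subseteq># image_mset \<pi> m} \<subseteq> {a. a \<subseteq># m}"
    using image_mset_subseteq_mono[of _ "image_mset \<pi> m" "inv_into UNIV \<pi>"] by (auto simp: inv')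
qed

instantiation symfun :: "{comm_ring_1, real_algebra_1}"
begin

lift_definition zero_symfun :: symfun is "\<lambda>_. 0" by simp

lift_definition one_symfun :: symfun is "\<lambda>m. if m = {#} then 1 else 0"
  by (auto intro!: exI[of _ 0])

lift_definition plus_symfun :: "symfun \<Rightarrow> symfun \<Rightarrow> symfun" is "\<lambda>f g m. f m + g m"
proof -
  fix f g :: "nat multiset \<Rightarrow> real"
  assume f: "(\<forall>\<pi> m. bij \<pi> \<longrightarrow> f (image_mset \<pi> m) = f m) \<and> (\<exists>d. \<forall>m. d < size m \<longrightarrow> f m = 0)"
    and g: "(\<forall>\<pi> m. bij \<pi> \<longrightarrow> g (image_mset \<pi> m) = g m) \<and> (\<exists>d. \<forall>m. d < size m \<longrightarrow> g m = 0)"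
  then obtain d e where "\<forall>m. d < size m \<longrightarrow> f m = 0" "\<forall>m. e < size m \<longrightarrow> g m = 0" by blast
  then have "\<exists>d. \<forall>m. d < size m \<longrightarrow> f m + g m = 0"
    by (intro exI[of _ "max d e"]) simp
  with f g show "(\<forall>\<pi> m. bij \<pi> \<longrightarrow> f (image_mset \<pi> m) + g (image_mset \<pi> m) = f m + g m) \<and>
      (\<exists>d. \<forall>m. d < size m \<longrightarrow> f m + g m = 0)"
    by auto
qed

lift_definition uminus_symfun :: "symfun \<Rightarrow> symfun" is "\<lambda>f m. - f m" by simp

lift_definition scaleR_symfun :: "real \<Rightarrow> symfun \<Rightarrow> symfun" is "\<lambda>c f m. c * f m"
  by auto

definition minus_symfun :: "symfun \<Rightarrow> symfun \<Rightarrow> symfun" where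
  "minus_symfun f g = f + - g"

lift_definition times_symfun :: "symfun \<Rightarrow> symfun \<Rightarrow> symfun"
  is "\<lambda>f g m. \<Sum>a | a \<subseteq># m. f a * g (m - a)"
proof (intro conjI allI impI)
  fix f g :: "nat multiset \<Rightarrow> real"
  assume f: "(\<forall>\<pi> m. bij \<pi> \<longrightarrow> f (image_mset \<pi> m) = f m) \<and> (\<exists>d. \<forall>m. d < size m \<longrightarrow> f m = 0)"
    and g: "(\<forall>\<pi> m. bij \<pi> \<longrightarrow> g (image_mset \<pi> m) = g m) \<and> (\<exists>d. \<forall>m. d < size m \<longrightarrow> g m = 0)"
  {
    fix \<pi> :: "nat \<Rightarrow> nat" and m assume \<pi>: "bij \<pi>"
    have "(\<Sum>a | a \<subseteq># image_mset \<pi> m. f a * g (image_mset \<pi> m - a))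
        = (\<Sum>a | a \<subseteq># m. f (image_mset \<pi> a) * g (image_mset \<pi> m - image_mset \<pi> a))"
      by (rule sum.reindex_bij_betw[OF image_mset_submultisets[OF \<pi>], symmetric])
    also have "\<dots> = (\<Sum>a | a \<subseteq># m. f a * g (m - a))"
    proof (intro sum.cong refl)
      fix a assume "a \<in> {a. a \<subseteq># m}"
      then have "image_mset \<pi> m - image_mset \<pi> a = image_mset \<pi> (m - a)"
        by (simp add: image_mset_Diff)
      with f g \<pi> show "f (image_mset \<pi> a) * g (image_mset \<pi> m - image_mset \<pi> a) = f a * g (m - a)"
        by simp
    qed
    finally show "(\<Sum>a | a \<subseteq># image_mset \<pi> m. f a * g (image_mset \<pi> m - a))
        = (\<Sum>a | a \<subseteq># m. f a * g (m - a))" .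
  }
  from f g obtain d e where de: "\<forall>m. d < size m \<longrightarrow> f m = 0" "\<forall>m. e < size m \<longrightarrow> g m = 0"
    by blast
  have "(\<Sum>a | a \<subseteq># m. f a * g (m - a)) = 0" if "d + e < size m" for m
  proof (intro sum.neutral ballI)
    fix a assume "a \<in> {a. a \<subseteq># m}"
    then have "size m = size a + size (m - a)"
      by (simp add: size_Diff_submset size_mset_mono)
    with that have "d < size a \<or> e < size (m - a)" by linarith
    with de show "f a * g (m - a) = 0" by auto
  qed
  then show "\<exists>d. \<forall>m. d < size m \<longrightarrow> (\<Sum>a | a \<subseteq># m. f a * g (m - a)) = 0" by blast
qed

instance
proof
  fix f g h :: symfun and r s :: real
  show "f + g + h = f + (g + h)" by transfer (simp add: algebra_simps)
  show "f + g = g + f" by transfer (simp add: algebra_simps)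
  show "0 + f = f" by transfer simp
  show "- f + f = 0" by transfer simp
  show "f - g = f + - g" by (rule minus_symfun_def)
  show "r *\<^sub>R (f + g) = r *\<^sub>R f + r *\<^sub>R g" by transfer (simp add: algebra_simps)
  show "(r + s) *\<^sub>R f = r *\<^sub>R f + s *\<^sub>R f" by transfer (simp add: algebra_simps)
  show "r *\<^sub>R s *\<^sub>R f = (r * s) *\<^sub>R f" by transfer (simp add: algebra_simps)
  show "1 *\<^sub>R f = f" by transfer simp
  show "(0::symfun) \<noteq> 1" by transfer (auto simp: fun_eq_iff)
  show "r *\<^sub>R f * g = r *\<^sub>R (f * g)"
    by transfer (simp add: sum_distrib_left algebra_simps)
  show "f * r *\<^sub>R g = r *\<^sub>R (f * g)"
    by transfer (simp add: sum_distrib_left algebra_simps)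
  show "(f + g) * h = f * h + g * h"
    by transfer (simp add: sum.distrib algebra_simps)
  show "f * (g + h) = f * g + f * h"
    by transfer (simp add: sum.distrib algebra_simps)
  show "f * 1 = f"
  proof transfer
    fix f :: "nat multiset \<Rightarrow> real"
    have "(\<Sum>a | a \<subseteq># m. f a * (if m - a = {#} then 1 else 0)) = f m" for m
    proof -
      have "(\<Sum>a | a \<subseteq># m. f a * (if m - a = {#} then 1 else 0))
          = (\<Sum>a | a \<subseteq># m. if a = m then f m else 0)"
        by (intro sum.cong) (auto simp: Diff_eq_empty_iff_mset)
      then show ?thesis by (simp add: finite_submultisets)
    qed
    then show "(\<lambda>m. \<Sum>a | a \<subseteq># m. f a * (if m - a = {#} then 1 else 0)) = f" by (rule ext)
  qed
  show "f * g = g * f"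
  proof transfer
    fix f g :: "nat multiset \<Rightarrow> real"
    have dd: "m - (m - a) = a" if "a \<subseteq># m" for a m :: "nat multiset"
      using that by (auto simp: multiset_eq_iff subseteq_mset_def)
    have "(\<Sum>a | a \<subseteq># m. f a * g (m - a)) = (\<Sum>a | a \<subseteq># m. g a * f (m - a))" for m
      by (rule sum.reindex_bij_witness[where i = "\<lambda>a. m - a" and j = "\<lambda>a. m - a"])
         (auto simp: dd intro: diff_subset_eq_self)
    then show "(\<lambda>m. \<Sum>a | a \<subseteq># m. f a * g (m - a)) = (\<lambda>m. \<Sum>a | a \<subseteq># m. g a * f (m - a))"
      by (rule ext)
  qed
  show "1 * f = f"
  proof transfer
    fix f :: "nat multiset \<Rightarrow> real"
    have "(\<Sum>a | a \<subseteq># m. (if a = {#} then 1 else 0) * f (m - a)) = f m" for m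
    proof -
      have "(\<Sum>a | a \<subseteq># m. (if a = {#} then 1 else 0) * f (m - a))
          = (\<Sum>a | a \<subseteq># m. if a = {#} then f m else 0)"
        by (intro sum.cong) auto
      then show ?thesis by (simp add: finite_submultisets)
    qed
    then show "(\<lambda>m. \<Sum>a | a \<subseteq># m. (if a = {#} then 1 else 0) * f (m - a)) = f" by (rule ext)
  qed
  show "f * g * h = f * (g * h)"
  proof transfer
    fix f g h :: "nat multiset \<Rightarrow> real"
    have w: "m - a - (b - a) = m - b" if "a \<subseteq># b" for a b m :: "nat multiset"
      using that by (auto simp: multiset_eq_iff subseteq_mset_def)
    have "(\<Sum>a | a \<subseteq># m. (\<Sum>b | b \<subseteq># a. f b * g (a - b)) * h (m - a))
        = (\<Sum>a | a \<subseteq># m. f a * (\<Sum>b | b \<subseteq># m - a. g b * h (m - a - b)))" for m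
    proof -
      have "(\<Sum>a | a \<subseteq># m. (\<Sum>b | b \<subseteq># a. f b * g (a - b)) * h (m - a))
          = (\<Sum>(a, b)\<in>(SIGMA a:{a. a \<subseteq># m}. {b. b \<subseteq># a}). f b * g (a - b) * h (m - a))"
        by (simp add: sum_distrib_right sum.Sigma finite_submultisets)
      also have "\<dots> = (\<Sum>(a, b)\<in>(SIGMA a:{a. a \<subseteq># m}. {b. b \<subseteq># m - a}).
            f a * (g b * h (m - a - b)))"
        by (rule sum.reindex_bij_witness[where i = "\<lambda>(a, b). (a + b, a)"
              and j = "\<lambda>(a, b). (b, a - b)"])
           (auto simp: multiset_eq_iff subseteq_mset_def le_diff_conv2 mult.assoc w diff_le_mono add.commute
              intro: order_trans)
      also have "\<dots> = (\<Sum>a | a \<subseteq># m. f a * (\<Sum>b | b \<subseteq># m - a. g b * h (m - a - b)))"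
        by (simp add: sum_distrib_left sum.Sigma finite_submultisets)
      finally show ?thesis .
    qed
    then show "(\<lambda>m. \<Sum>a | a \<subseteq># m. (\<Sum>b | b \<subseteq># a. f b * g (a - b)) * h (m - a))
        = (\<lambda>m. \<Sum>a | a \<subseteq># m. f a * (\<Sum>b | b \<subseteq># m - a. g b * h (m - a - b)))"
      by (rule ext)
  qed
qed

end

lift_definition power_sum :: "nat \<Rightarrow> symfun"
  is "\<lambda>k m. if \<exists>i. m = replicate_mset k i then 1 else 0"
proof (intro conjI allI impI)
  fix k :: nat and \<pi> :: "nat \<Rightarrow> nat" and m assume \<pi>: "bij \<pi>"
  have "(\<exists>i. image_mset \<pi> m = replicate_mset k i) \<longleftrightarrow> (\<exists>i. m = replicate_mset k i)"
  proof
    assume "\<exists>i. image_mset \<pi> m = replicate_mset k i"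
    then obtain i where "image_mset \<pi> m = replicate_mset k i" by blast
    moreover obtain j where "i = \<pi> j" using \<pi> by (metis bij_pointE)
    ultimately have "image_mset \<pi> m = image_mset \<pi> (replicate_mset k j)" by simp
    then have "m = replicate_mset k j"
      using multiset.inj_map[OF bij_is_inj[OF \<pi>]] by (simp only: inj_eq)
    then show "\<exists>i. m = replicate_mset k i" by blast
  qed auto
  then show "(if \<exists>i. image_mset \<pi> m = replicate_mset k i then 1 else 0 :: real)
      = (if \<exists>i. m = replicate_mset k i then 1 else 0)" by simp
next
  fix k :: nat
  show "\<exists>d. \<forall>m. d < size m \<longrightarrow> (if \<exists>i :: nat. m = replicate_mset k i then 1 else 0) = (0 :: real)"
    by (rule exI[of _ k]) auto
qed

text \<open>Integer partitions are multisets of positive integers.\<close>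

definition int_partition :: "nat multiset \<Rightarrow> bool" where
  "int_partition \<mu> \<longleftrightarrow> 0 \<notin># \<mu>"

definition exponents :: "nat multiset \<Rightarrow> nat multiset" where
  "exponents m = image_mset (count m) (mset_set (set_mset m))"

lift_definition monomial_sym :: "nat multiset \<Rightarrow> symfun"
  is "\<lambda>\<mu> m. if exponents m = \<mu> then 1 else 0"
proof (intro conjI allI impI)
  fix \<mu> :: "nat multiset" and \<pi> :: "nat \<Rightarrow> nat" and m assume \<pi>: "bij \<pi>"
  then have inj: "inj \<pi>" by (rule bij_is_inj)
  have "mset_set (set_mset (image_mset \<pi> m)) = image_mset \<pi> (mset_set (set_mset m))"
    using inj by (simp add: image_mset_mset_set inj_on_subset)
  moreover have "count (image_mset \<pi> m) (\<pi> i) = count m i" for i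
    by (induction m) (auto simp: inj_eq[OF inj])
  ultimately have "exponents (image_mset \<pi> m) = exponents m"
    unfolding exponents_def by (simp add: multiset.map_comp comp_def)
  then show "(if exponents (image_mset \<pi> m) = \<mu> then 1 else 0 :: real)
      = (if exponents m = \<mu> then 1 else 0)" by simp
next
  fix \<mu> :: "nat multiset"
  have "sum_mset (exponents m) = size m" for m
    unfolding exponents_def by (simp add: size_multiset_overloaded_eq sum_unfold_sum_mset)
  then show "\<exists>d. \<forall>m. d < size m \<longrightarrow> (if exponents m = \<mu> then 1 else 0) = (0 :: real)"
    by (intro exI[of _ "sum_mset \<mu>"]) auto
qed

definition aug_monomial_sym :: "nat multiset \<Rightarrow> symfun" where
  "aug_monomial_sym \<mu> = (\<Prod>j\<in>set_mset \<mu>. fact (count \<mu> j)) *\<^sub>R monomial_sym \<mu>"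


section \<open>The characters \<open>\<Psi>\<^sub>c\<^sub>,\<^sub>q\<close>\<close>

text \<open>\<open>chain n\<close> has \<open>n\<close> vertices for \<open>n \<ge> 1\<close>; it is only used for such \<open>n\<close>.\<close>

definition chain :: "nat \<Rightarrow> rtree" where
  "chain n = ((\<lambda>t. Node {#t#}) ^^ (n - 1)) bullet"

definition path_forest :: "nat multiset \<Rightarrow> rtree" where
  "path_forest \<mu> = Node (image_mset chain \<mu>)"

definition Q_basis :: "rtree \<Rightarrow> symfun" where
  "Q_basis t =
     (if \<exists>\<mu>. int_partition \<mu> \<and> t = path_forest \<mu>
      then aug_monomial_sym (THE \<mu>. int_partition \<mu> \<and> t = path_forest \<mu>)
      else 0)"

definition Q_map :: "gl \<Rightarrow> symfun" where
  "Q_map x = (\<Sum>t\<in>Poly_Mapping.keys x. Poly_Mapping.lookup x t *\<^sub>R Q_basis t)"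

text \<open>Sequences are indexed from 0 throughout: \<open>q i\<close> stands for \<open>q\<^sub>i\<^sub>+\<^sub>1\<close>.\<close>

definition KK :: "(real \<times> (nat \<Rightarrow> real)) set" where
  "KK = {(c, q). 0 \<le> c \<and> decseq q \<and> (\<forall>i. 0 \<le> q i) \<and> summable q \<and> suminf q \<le> c}"

text \<open>Well defined because the power sums are algebraically independent generators.\<close>

definition ev :: "real \<Rightarrow> (nat \<Rightarrow> real) \<Rightarrow> symfun \<Rightarrow> real" where
  "ev c q = (THE \<phi>. linear \<phi> \<and> \<phi> 1 = 1 \<and> (\<forall>f g. \<phi> (f * g) = \<phi> f * \<phi> g) \<and>
     \<phi> (power_sum 1) = c \<and> (\<forall>k\<ge>2. \<phi> (power_sum k) = suminf (\<lambda>i. q i ^ k)))"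

definition Psi :: "real \<Rightarrow> (nat \<Rightarrow> real) \<Rightarrow> gl \<Rightarrow> real" where
  "Psi c q = ev c q \<circ> Q_map"

definition single_seq :: "real \<Rightarrow> nat \<Rightarrow> real" where
  "single_seq a = (\<lambda>i. if i = 0 then a else 0)"

text \<open>
  Finiteness has to be demanded, since infinite sets have cardinality 0. For summable \<open>q\<close> and
  \<open>r\<close> the sequence is uniquely determined.
\<close>

definition seq_union :: "(nat \<Rightarrow> real) \<Rightarrow> (nat \<Rightarrow> real) \<Rightarrow> nat \<Rightarrow> real" (infixl \<open>\<squnion>\<^sub>q\<close> 65) where
  "q \<squnion>\<^sub>q r = (THE s. decseq s \<and> (\<forall>i. 0 \<le> s i) \<and>
     (\<forall>x>0. finite {i. s i = x} \<and> card {i. s i = x} = card {i. q i = x} + card {i. r i = x}))"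


section \<open>Point measures\<close>

definition pos_borel :: "real measure" where
  "pos_borel = restrict_space borel {0<..}"

text \<open>Here \<open>m x\<close> is the multiplicity of the atom \<open>x\<close>, that is, \<open>\<eta> = \<Sum>\<^sub>x m(x) \<delta>\<^sub>x\<close>.\<close>

definition point_measures :: "real measure set" where
  "point_measures = {\<eta>. sets \<eta> = sets pos_borel \<and>
     (\<exists>m :: real \<Rightarrow> nat. \<forall>A\<in>sets pos_borel.
        emeasure \<eta> A = (\<integral>\<^sup>+x. of_nat (m x) * indicator A x \<partial>count_space {0<..})) \<and>
     (\<forall>C. compact C \<and> C \<subseteq> {0<..} \<longrightarrow> emeasure \<eta> C < \<infinity>)}"

definition N1 :: "real measure set" where
  "N1 = {\<eta> \<in> point_measures. (\<integral>\<^sup>+x. ennreal x \<partial>\<eta>) < \<infinity>}"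

definition add_measure :: "'a measure \<Rightarrow> 'a measure \<Rightarrow> 'a measure" where
  "add_measure M N = measure_of (space M) (sets M) (\<lambda>A. emeasure M A + emeasure N A)"

lemma emeasure_add_measure:
  assumes "sets N = sets M" "A \<in> sets M"
  shows "emeasure (add_measure M N) A = emeasure M A + emeasure N A"
  unfolding add_measure_def
proof (rule emeasure_measure_of_sigma)
  show "sigma_algebra (space M) (sets M)" ..
  show "positive (sets M) (\<lambda>A. emeasure M A + emeasure N A)"
    by (simp add: positive_def)
  show "countably_additive (sets M) (\<lambda>A. emeasure M A + emeasure N A)"
  proof (rule countably_additiveI)
    fix B :: "nat \<Rightarrow> 'a set"
    assume "range B \<subseteq> sets M" "disjoint_family B" "(\<Union>i. B i) \<in> sets M"
    then show "suminf (\<lambda>i. emeasure M (B i) + emeasure N (B i))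
        = emeasure M (\<Union>i. B i) + emeasure N (\<Union>i. B i)"
      using assms by (simp add: suminf_add[symmetric] suminf_emeasure)
  qed
qed (fact assms)

definition eta :: "(nat \<Rightarrow> real) \<Rightarrow> real measure" where
  "eta q = measure_of (space pos_borel) (sets pos_borel)
     (\<lambda>A. suminf (\<lambda>i. if 0 < q i then indicator A (q i) else 0))"

lemma emeasure_eta:
  assumes "A \<in> sets pos_borel"
  shows "emeasure (eta q) A = suminf (\<lambda>i. if 0 < q i then indicator A (q i) else 0)"
  unfolding eta_def
proof (rule emeasure_measure_of_sigma)
  show "sigma_algebra (space pos_borel) (sets pos_borel)" ..
  show "positive (sets pos_borel) (\<lambda>A. suminf (\<lambda>i. if 0 < q i then indicator A (q i) else 0))"
    by (simp add: positive_def cong: if_cong)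
  show "countably_additive (sets pos_borel) (\<lambda>A. suminf (\<lambda>i. if 0 < q i then indicator A (q i) else 0))"
  proof (rule countably_additiveI)
    fix B :: "nat \<Rightarrow> real set" assume B: "disjoint_family B"
    have "suminf (\<lambda>j. suminf (\<lambda>i. if 0 < q i then indicator (B j) (q i) else 0 :: ennreal))
        = suminf (\<lambda>j. \<integral>\<^sup>+i. (if 0 < q i then indicator (B j) (q i) else 0) \<partial>count_space UNIV)"
      by (simp add: nn_integral_count_space_nat)
    also have "\<dots> = (\<integral>\<^sup>+i. suminf (\<lambda>j. if 0 < q i then indicator (B j) (q i) else 0)
        \<partial>count_space UNIV)"
      by (rule nn_integral_suminf[symmetric]) simp
    also have "\<dots> = suminf (\<lambda>i. suminf (\<lambda>j. if 0 < q i then indicator (B j) (q i) else 0))"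
      by (simp add: nn_integral_count_space_nat)
    also have "\<dots> = suminf (\<lambda>i. if 0 < q i then indicator (\<Union>j. B j) (q i) else 0)"
      using suminf_indicator[OF B] by (intro suminf_cong) auto
    finally show "suminf (\<lambda>j. suminf (\<lambda>i. if 0 < q i then indicator (B j) (q i) else 0 :: ennreal))
        = suminf (\<lambda>i. if 0 < q i then indicator (\<Union>j. B j) (q i) else 0)" .
  qed
qed (fact assms)

definition dust :: "real \<Rightarrow> (nat \<Rightarrow> real) \<Rightarrow> real" where
  "dust c q = c - suminf q"

definition multiplicities_divisible :: "nat \<Rightarrow> real measure \<Rightarrow> bool" where
  "multiplicities_divisible n \<eta> \<longleftrightarrow>
     (\<forall>x\<in>space \<eta>. emeasure \<eta> {x} \<noteq> 0 \<longrightarrow> (\<exists>k::nat. n dvd k \<and> emeasure \<eta> {x} = of_nat k))"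

definition KK_monoid :: "(real \<times> (nat \<Rightarrow> real)) monoid" where
  "KK_monoid = \<lparr>carrier = KK, mult = (\<lambda>(c, q) (c', r). (c + c', q \<squnion>\<^sub>q r)), one = (0, \<lambda>_. 0)\<rparr>"

definition Rnonneg_monoid :: "real monoid" where
  "Rnonneg_monoid = \<lparr>carrier = {0..}, mult = (+), one = 0\<rparr>"

definition N1_monoid :: "real measure monoid" where
  "N1_monoid = \<lparr>carrier = N1, mult = add_measure, one = null_measure pos_borel\<rparr>"

end

theory Submission
  imports Defs "HOL-Combinatorics.Permutations"
begin

text \<open>
  A unital basis-positive character \<open>\<phi>\<close> kills every tree that is not a path-forest: comparing the
  two products of the one-edge tree and the cherry gives a vanishing value with a fork one
  step below the root, and the zero set is stable under products. On path-forests the product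
  formula for a single chain of length \<open>k\<close> is a recursion in the number of branches, so that \<open>\<phi>\<close> is
  determined by the numbers \<open>p\<^sub>k\<close>, its values at the trees with one branch, a chain with \<open>k\<close> vertices.
  The \<open>p\<^sub>k\<close> are additive under convolution, and pointwise limits of characters are limits of the
  \<open>p\<^sub>k\<close>.

  The \<open>p\<^sub>k\<close> of a character are log-convex (a Hausdorff moment argument with Bernstein
  polynomials), so the ratios \<open>p\<^sub>k\<^sub>+\<^sub>1 / p\<^sub>k\<close> increase to a limit \<open>q\<close>. Normalising the values at
  path-forests with one additional long branch shows that \<open>p\<^sub>k - q\<^sup>k\<close> again belongs to a character.
  Iterating gives \<open>p\<^sub>k = \<Sum>\<^sub>i q\<^sub>i\<^sup>k\<close> for \<open>k \<ge> 2\<close> and \<open>\<Sum>\<^sub>i q\<^sub>i \<le> p\<^sub>1\<close>. Conversely such \<open>p\<^sub>k\<close> come from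
  limits of convolutions of the characters \<open>x\<^sup>n\<close> on the chain with \<open>n\<close> edges.

  Since power sums determine the sequence \<open>q\<close>, an \<open>n\<close>-th root with parameter \<open>r\<close> forces
  \<open>q\<close> to be \<open>r\<close> with every entry repeated \<open>n\<close> times.
\<close>


section \<open>Grafting sums over plane representatives\<close>

text \<open>The functional \<open>ev\<close> is a definite description and yields nothing until a
  homomorphism with the prescribed power sums is at hand. It is not built from algebraic
  independence inside \<Lambda>: a character with these values is constructed on trees, by
  convolution and limits, and its values on path-forests supply the homomorphism. The two sides meet
  because the recursion on path-forests is the expansion of a power sum times an augmented monomial
  function.

  That convolution preserves multiplicativity is the compatibility of product and coproduct. The
  product is defined through chosen representatives, while this compatibility needs trees as they
  come; hence grafting is summed over arbitrary plane trees and arbitrary finite index sets, and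
  evaluated by splitting off one root branch at a time.

  The value p_1 stands apart: points that shrink to 0 disappear from p_k for k >= 2 but may leave
  mass in p_1, the dust. So q is always recovered from k >= 2 alone. For sequences and point
  measures the common currency is the multiplicity function, since masses, integrals and power sums
  are all sums over atoms.\<close>

lemma sum_PiE_bij:
  assumes b: "bij_betw b V V'"
  shows "(\<Sum>f\<in>K \<rightarrow>\<^sub>E V'. H f) = (\<Sum>f\<in>K \<rightarrow>\<^sub>E V. H (restrict (b \<circ> f) K))"
proof -
  let ?c = "inv_into V b"
  have c: "?c (b x) = x" if "x \<in> V" for x using b that by (simp add: bij_betw_inv_into_left)
  have d: "b (?c y) = y" if "y \<in> V'" for y using b that by (simp add: bij_betw_inv_into_right)
  have bV: "b x \<in> V'" if "x \<in> V" for x using b that by (auto simp: bij_betw_def)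
  have cV: "?c x \<in> V" if "x \<in> V'" for x using b that by (metis bij_betw_def inv_into_into)
  show ?thesis
    by (rule sum.reindex_bij_witness[where i = "\<lambda>f. restrict (b \<circ> f) K" and j = "\<lambda>f. restrict (?c \<circ> f) K"])
       (auto simp: fun_eq_iff PiE_iff extensional_def restrict_def c d bV cV intro!: arg_cong[of _ _ H])
qed

lemma finite_vertices: "finite (vertices p)"
  by (induction p rule: vertices.induct) auto

lemma attach_cong:
  "(\<And>v. v \<in> vertices p \<Longrightarrow> g v = g' v) \<Longrightarrow> attach p g = attach p g'"
proof (induction p g arbitrary: g' rule: attach.induct)
  case (1 ts g)
  have "attach (ts ! i) (\<lambda>v. g (i # v)) = attach (ts ! i) (\<lambda>v. g' (i # v))" if "i < length ts" for i
    using that 1(2) by (intro 1(1)) auto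
  moreover have "g [] = g' []" using 1(2) by auto
  ultimately show ?case by (auto intro!: image_mset_cong)
qed

lemma attach_empty: "attach p (\<lambda>_. {#}) = shape p"
proof (induction p)
  case (PNode ts)
  have "map (\<lambda>i. attach (ts ! i) (\<lambda>v. {#})) [0..<length ts] = map shape ts"
    by (rule nth_equalityI) (simp_all add: PNode)
  then show ?case
    unfolding attach.simps shape.simps by (simp only: add.right_neutral)
qed

lemma mset_map_upt_permutes:
  assumes "\<pi> permutes {..<n}"
  shows "mset (map (\<lambda>i. h (\<pi> i)) [0..<n]) = mset (map h [0..<n])"
proof -
  have "mset (map (\<lambda>i. h (\<pi> i)) [0..<n]) = image_mset h (image_mset \<pi> (mset_set {..<n}))"
    by (simp add: multiset.map_comp comp_def mset_map lessThan_atLeast0)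
  also have "image_mset \<pi> (mset_set {..<n}) = mset_set {..<n}"
    using assms by (metis image_mset_mset_set inj_on_subset permutes_image permutes_inj subset_UNIV)
  finally show ?thesis by (simp add: mset_map lessThan_atLeast0)
qed

text \<open>Two plane representatives differ by permuting branches at every vertex: a permutation
  \<pi> matches the root branches by shape, and the bijections obtained for matched branches are
  glued. The clause on \<open>attach\<close> is what makes sums over graftings independent of the
  representative.\<close>

lemma vertex_bijection:
  "shape p = shape p' \<Longrightarrow>
    \<exists>b. bij_betw b (vertices p) (vertices p') \<and> (\<forall>g. attach p (g \<circ> b) = attach p' g)"
proof (induction p arbitrary: p' rule: vertices.induct)
  case (1 ts)
  obtain ts' where p': "p' = PNode ts'" by (cases p')
  let ?n = "length ts"
  have m: "mset (map shape ts) = mset (map shape ts')" using 1(2) p' by simp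
  then have len: "length ts' = ?n" by (metis length_map mset_eq_length)
  obtain \<pi> where \<pi>: "\<pi> permutes {..<?n}" "permute_list \<pi> (map shape ts') = map shape ts"
    using mset_eq_permutation[OF m] len by auto
  have sh: "shape (ts ! i) = shape (ts' ! \<pi> i)" if "i < ?n" for i
  proof -
    have "\<pi> i < ?n" using permutes_in_image[OF \<pi>(1), of i] that by simp
    then show ?thesis using permute_list_nth[of \<pi> "map shape ts'" i] \<pi> that len by simp
  qed
  have "\<forall>i\<in>{..<?n}. \<exists>b. bij_betw b (vertices (ts ! i)) (vertices (ts' ! \<pi> i)) \<and>
      (\<forall>g. attach (ts ! i) (g \<circ> b) = attach (ts' ! \<pi> i) g)"
    using 1(1) sh by blast
  then obtain b where b: "\<And>i. i < ?n \<Longrightarrow> bij_betw (b i) (vertices (ts ! i)) (vertices (ts' ! \<pi> i))"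
      "\<And>i g. i < ?n \<Longrightarrow> attach (ts ! i) (g \<circ> b i) = attach (ts' ! \<pi> i) g"
    by (metis lessThan_iff)
  define \<beta> where "\<beta> = (\<lambda>v. case v of [] \<Rightarrow> [] | i # w \<Rightarrow> \<pi> i # b i w)"
  have "bij_betw \<beta> (vertices (PNode ts)) (vertices p')"
  proof (rule bij_betw_imageI)
    show "inj_on \<beta> (vertices (PNode ts))"
      using bij_betw_imp_inj_on[OF b(1)]
      by (auto simp: inj_on_def \<beta>_def inj_eq[OF permutes_inj[OF \<pi>(1)]])
    have "\<beta> ` vertices (PNode ts) = insert [] (\<Union>i\<in>{..<?n}. Cons (\<pi> i) ` b i ` vertices (ts ! i))"
      by (force simp: \<beta>_def)
    also have "\<dots> = insert [] (\<Union>i\<in>{..<?n}. Cons (\<pi> i) ` vertices (ts' ! \<pi> i))"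
      using b(1) by (auto simp: bij_betw_def)
    also have "\<dots> = insert [] (\<Union>i\<in>\<pi> ` {..<?n}. Cons i ` vertices (ts' ! i))"
      by simp
    also have "\<dots> = vertices p'"
      using permutes_image[OF \<pi>(1)] by (simp add: p' len)
    finally show "\<beta> ` vertices (PNode ts) = vertices p'" .
  qed
  moreover have "attach (PNode ts) (g \<circ> \<beta>) = attach p' g" for g
  proof -
    have "attach (ts ! i) (\<lambda>v. (g \<circ> \<beta>) (i # v)) = attach (ts' ! \<pi> i) (\<lambda>v. g (\<pi> i # v))"
      if "i < ?n" for i
      using b(2)[OF that, of "\<lambda>v. g (\<pi> i # v)"] by (simp add: \<beta>_def comp_def)
    then have "mset (map (\<lambda>i. attach (ts ! i) (\<lambda>v. (g \<circ> \<beta>) (i # v))) [0..<?n])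
        = mset (map (\<lambda>i. attach (ts' ! \<pi> i) (\<lambda>v. g (\<pi> i # v))) [0..<?n])"
      by (intro arg_cong[where f = mset]) auto
    also have "\<dots> = mset (map (\<lambda>i. attach (ts' ! i) (\<lambda>v. g (i # v))) [0..<?n])"
      by (rule mset_map_upt_permutes[OF \<pi>(1)])
    finally show ?thesis by (simp add: p' len \<beta>_def)
  qed
  ultimately show ?case by blast
qed

text \<open>The value of a functional \<open>h\<close> on a product, the right factor being given by
  any plane tree \<open>p\<close> and the branches of the left factor being indexed by any set
  \<open>K\<close>. Free choice of \<open>K\<close> allows the same expression for subsets of the
  branches.\<close>

definition graft_sum :: "ptree \<Rightarrow> 'i set \<Rightarrow> ('i \<Rightarrow> rtree) \<Rightarrow> (rtree \<Rightarrow> real) \<Rightarrow> real" where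
  "graft_sum p K s h =
     (\<Sum>f\<in>K \<rightarrow>\<^sub>E vertices p. h (attach p (\<lambda>v. image_mset s (mset_set {i\<in>K. f i = v}))))"

lemma graft_sum_shape:
  assumes "shape p = shape p'"
  shows "graft_sum p K s h = graft_sum p' K s h"
proof -
  obtain b where b: "bij_betw b (vertices p) (vertices p')"
      "\<And>g. attach p (g \<circ> b) = attach p' g"
    using vertex_bijection[OF assms] by blast
  have "attach p' (\<lambda>v. image_mset s (mset_set {i\<in>K. restrict (b \<circ> f) K i = v}))
      = attach p (\<lambda>v. image_mset s (mset_set {i\<in>K. f i = v}))" if f: "f \<in> K \<rightarrow>\<^sub>E vertices p" for f
  proof -
    have "{i\<in>K. restrict (b \<circ> f) K i = b v} = {i\<in>K. f i = v}" if "v \<in> vertices p" for v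
      using f b(1) that by (auto simp: bij_betw_def inj_on_def PiE_iff)
    then show ?thesis unfolding b(2)[symmetric] by (intro attach_cong) simp
  qed
  then show ?thesis
    unfolding graft_sum_def sum_PiE_bij[OF b(1)] by simp
qed

lemma image_mset_set_reindex:
  assumes "bij_betw k K K'" "\<And>i. i \<in> K \<Longrightarrow> s' (k i) = s i"
  shows "image_mset s' (mset_set {j\<in>K'. P j}) = image_mset s (mset_set {i\<in>K. P (k i)})"
proof -
  have inj: "inj_on k {i\<in>K. P (k i)}" using assms(1) by (auto simp: bij_betw_def inj_on_def)
  have im: "k ` {i\<in>K. P (k i)} = {j\<in>K'. P j}" using assms(1) by (auto simp: bij_betw_def)
  have "image_mset s' (mset_set {j\<in>K'. P j}) = image_mset (s' \<circ> k) (mset_set {i\<in>K. P (k i)})"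
    unfolding im[symmetric] image_mset_mset_set[OF inj, symmetric] by (simp add: multiset.map_comp)
  also have "\<dots> = image_mset s (mset_set {i\<in>K. P (k i)})"
    using assms(2)
    by (intro image_mset_cong) (metis (mono_tags, lifting) comp_apply elem_mset_set empty_iff
        infinite_set_mset_mset_set mem_Collect_eq)
  finally show ?thesis .
qed

lemma graft_sum_reindex:
  assumes k: "bij_betw k K K'" and s: "\<And>i. i \<in> K \<Longrightarrow> s' (k i) = s i"
  shows "graft_sum p K' s' h = graft_sum p K s h"
proof -
  let ?l = "inv_into K k"
  have l: "?l (k x) = x" if "x \<in> K" for x using k that by (simp add: bij_betw_inv_into_left)
  have l': "k (?l y) = y" if "y \<in> K'" for y using k that by (simp add: bij_betw_inv_into_right)
  have kK: "k x \<in> K'" if "x \<in> K" for x using k that by (auto simp: bij_betw_def)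
  have lK: "?l x \<in> K" if "x \<in> K'" for x using k that by (metis bij_betw_def inv_into_into)
  show ?thesis
    unfolding graft_sum_def
  proof (rule sum.reindex_bij_witness[where i = "\<lambda>f. restrict (f \<circ> ?l) K'" and j = "\<lambda>f. restrict (f \<circ> k) K"])
    fix f assume f: "f \<in> K' \<rightarrow>\<^sub>E vertices p"
    show "restrict (restrict (f \<circ> k) K \<circ> ?l) K' = f" "restrict (f \<circ> k) K \<in> K \<rightarrow>\<^sub>E vertices p"
      using f by (auto simp: fun_eq_iff PiE_iff extensional_def restrict_def l' lK kK)
    have "image_mset s (mset_set {i \<in> K. restrict (f \<circ> k) K i = v})
        = image_mset s' (mset_set {i \<in> K'. f i = v})" for v
    proof -
      have "{i \<in> K. restrict (f \<circ> k) K i = v} = {i \<in> K. f (k i) = v}" by auto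
      then show ?thesis
        using image_mset_set_reindex[of k K K' s' s "\<lambda>i. f i = v", OF k s] by simp
    qed
    then show "h (attach p (\<lambda>v. image_mset s (mset_set {i \<in> K. restrict (f \<circ> k) K i = v})))
        = h (attach p (\<lambda>v. image_mset s' (mset_set {i \<in> K'. f i = v})))" by simp
  next
    fix f assume f: "f \<in> K \<rightarrow>\<^sub>E vertices p"
    show "restrict (restrict (f \<circ> ?l) K' \<circ> k) K = f" "restrict (f \<circ> ?l) K' \<in> K' \<rightarrow>\<^sub>E vertices p"
      using f by (auto simp: fun_eq_iff PiE_iff extensional_def restrict_def l lK kK)
  qed
qed

lemma exists_list_indexing:
  assumes "finite K" "image_mset s (mset_set K) = mset xs"
  obtains k where "bij_betw k {..<length xs} K" "\<And>i. i < length xs \<Longrightarrow> s (k i) = xs ! i"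
proof -
  obtain ks where ks: "distinct ks" "set ks = K" using finite_distinct_list[OF assms(1)] by blast
  have "mset xs = mset (map s ks)"
    using ks assms(2) by (metis mset_map mset_set_set)
  then obtain \<pi> where \<pi>: "\<pi> permutes {..<length ks}" "permute_list \<pi> (map s ks) = xs"
    using mset_eq_permutation by (metis length_map)
  have len: "length xs = length ks" using \<pi>(2) by auto
  show thesis
  proof
    have "bij_betw ((!) ks) {..<length ks} K" using ks bij_betw_nth by blast
    then show "bij_betw (\<lambda>i. ks ! \<pi> i) {..<length xs} K"
      using bij_betw_trans[OF permutes_imp_bij[OF \<pi>(1)]] by (simp add: comp_def len)
    fix i assume i: "i < length xs"
    then have "\<pi> i < length ks" using permutes_in_image[OF \<pi>(1), of i] len by simp
    then show "s (ks ! \<pi> i) = xs ! i"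
      using permute_list_nth[of \<pi> "map s ks" i] \<pi> i len by simp
  qed
qed

text \<open>Multiplicativity on basis elements without reference to \<open>rep\<close> or
  \<open>branch_list\<close>. The indices are natural numbers because a definition cannot quantify
  over types; every finite multiset of trees can be indexed this way.\<close>

definition tree_mult :: "(rtree \<Rightarrow> real) \<Rightarrow> bool" where
  "tree_mult u \<longleftrightarrow> (\<forall>p (K :: nat set) s. finite K \<longrightarrow>
     graft_sum p K s u = u (Node (image_mset s (mset_set K))) * u (shape p))"

lemma graft_sum_list:
  "graft_sum p {..<length xs} ((!) xs) h = (\<Sum>f\<in>{..<length xs} \<rightarrow>\<^sub>E vertices p. h (graft p xs f))"
  by (simp add: graft_sum_def graft_def)

lemma tree_mult_iff:
  "tree_mult u \<longleftrightarrow> (\<forall>s t. (\<Sum>f\<in>{..<length (branch_list s)} \<rightarrow>\<^sub>E vertices (rep t).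
      u (graft (rep t) (branch_list s) f)) = u s * u t)"
proof
  assume *: "tree_mult u"
  show "\<forall>s t. (\<Sum>f\<in>{..<length (branch_list s)} \<rightarrow>\<^sub>E vertices (rep t).
      u (graft (rep t) (branch_list s) f)) = u s * u t"
  proof (intro allI)
    fix s t
    have "image_mset ((!) (branch_list s)) (mset_set {..<length (branch_list s)}) = branches s"
      unfolding mset_branch_list[symmetric]
      by (metis lessThan_atLeast0 map_nth mset_map mset_upt)
    then show "(\<Sum>f\<in>{..<length (branch_list s)} \<rightarrow>\<^sub>E vertices (rep t).
      u (graft (rep t) (branch_list s) f)) = u s * u t"
      using * unfolding graft_sum_list[symmetric] tree_mult_def by (simp add: shape_rep)
  qed
next
  assume *: "\<forall>s t. (\<Sum>f\<in>{..<length (branch_list s)} \<rightarrow>\<^sub>E vertices (rep t).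
      u (graft (rep t) (branch_list s) f)) = u s * u t"
  show "tree_mult u"
    unfolding tree_mult_def
  proof (intro allI impI)
    fix p and K :: "nat set" and s :: "nat \<Rightarrow> rtree" assume K: "finite K"
    let ?t = "Node (image_mset s (mset_set K))" 
    obtain k where k: "bij_betw k {..<length (branch_list ?t)} K"
        "\<And>i. i < length (branch_list ?t) \<Longrightarrow> s (k i) = branch_list ?t ! i"
      using exists_list_indexing[OF K, of s "branch_list ?t"] mset_branch_list[of ?t] by auto
    have "graft_sum p K s u = graft_sum (rep (shape p)) K s u"
      by (rule graft_sum_shape) (simp add: shape_rep)
    also have "\<dots> = graft_sum (rep (shape p)) {..<length (branch_list ?t)} ((!) (branch_list ?t)) u"
      using k by (intro graft_sum_reindex) auto
    finally show "graft_sum p K s u = u ?t * u (shape p)"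
      using * by (simp add: graft_sum_list)
  qed
qed

text \<open>The vertices of \<open>PNode (t # ts)\<close> split into those of \<open>t\<close> and those of \<open>PNode ts\<close>,
  the root being counted among the latter.\<close>

fun shift_head :: "nat list \<Rightarrow> nat list" where
  "shift_head [] = []"
| "shift_head (i # v) = Suc i # v"

lemma vertices_Cons:
  "vertices (PNode (t # ts)) = Cons 0 ` vertices t \<union> shift_head ` vertices (PNode ts)"
proof -
  have "(\<Union>i\<in>{..<length (t # ts)}. Cons i ` vertices ((t # ts) ! i))
      = Cons 0 ` vertices t \<union> (\<Union>i\<in>{..<length ts}. Cons (Suc i) ` vertices (ts ! i))"
    by (simp add: lessThan_Suc_eq_insert_0)
  moreover have "shift_head ` vertices (PNode ts)
      = insert [] (\<Union>i\<in>{..<length ts}. Cons (Suc i) ` vertices (ts ! i))"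
    by (auto simp: image_UN image_image)
  ultimately show ?thesis by simp
qed

lemma attach_Cons:
  "attach (PNode (t # ts)) g =
     Node (add_mset (attach t (\<lambda>v. g (0 # v))) (branches (attach (PNode ts) (g \<circ> shift_head))))"
  by (simp add: comp_def upt_rec[of 0 "Suc _"] map_Suc_upt[symmetric] del: upt_Suc map_Suc_upt)

text \<open>A function into a disjoint union amounts to the set \<open>I\<close> of arguments sent
  to the first part, together with one function on \<open>I\<close> and one on its complement. The
  parts appear as injective images since they will be address sets, prefixed by 0 or
  shifted.\<close>

lemma sum_PiE_Un:
  assumes K: "finite K" and \<alpha>: "inj_on \<alpha> V" and \<beta>: "inj_on \<beta> W" and d: "\<alpha> ` V \<inter> \<beta> ` W = {}"
    and fin: "finite V" "finite W"
  shows "(\<Sum>f\<in>K \<rightarrow>\<^sub>E (\<alpha> ` V \<union> \<beta> ` W). H f) =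
    (\<Sum>I\<in>Pow K. \<Sum>f\<in>I \<rightarrow>\<^sub>E V. \<Sum>g\<in>(K - I) \<rightarrow>\<^sub>E W.
       H (\<lambda>i. if i \<in> I then \<alpha> (f i) else if i \<in> K then \<beta> (g i) else undefined))"
proof -
  let ?S = "SIGMA I:Pow K. (I \<rightarrow>\<^sub>E V) \<times> ((K - I) \<rightarrow>\<^sub>E W)"
  have "(\<Sum>f\<in>K \<rightarrow>\<^sub>E (\<alpha> ` V \<union> \<beta> ` W). H f) = (\<Sum>(I, f, g)\<in>?S.
       H (\<lambda>i. if i \<in> I then \<alpha> (f i) else if i \<in> K then \<beta> (g i) else undefined))"
  proof (rule sum.reindex_bij_witness[where
      j = "\<lambda>f. ({i\<in>K. f i \<in> \<alpha> ` V}, \<lambda>i\<in>{i\<in>K. f i \<in> \<alpha> ` V}. inv_into V \<alpha> (f i),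
         \<lambda>i\<in>K - {i\<in>K. f i \<in> \<alpha> ` V}. inv_into W \<beta> (f i))" and
      i = "\<lambda>(I, f, g) i. if i \<in> I then \<alpha> (f i) else if i \<in> K then \<beta> (g i) else undefined"],
      goal_cases)
    case (1 f)
    then show ?case by (fastforce simp: fun_eq_iff PiE_iff extensional_def f_inv_into_f)
  next
    case (2 f)
    then show ?case by (force simp: PiE_iff inv_into_into)
  next
    case (3 x)
    obtain I f g where x: "x = (I, f, g)" by (cases x)
    have I: "I \<subseteq> K" "\<And>i. i \<in> I \<Longrightarrow> f i \<in> V" "\<And>i. i \<in> K - I \<Longrightarrow> g i \<in> W"
      "f \<in> extensional I" "g \<in> extensional (K - I)"
      using 3 x by (auto simp: PiE_iff)
    have *: "{i \<in> K. (if i \<in> I then \<alpha> (f i) else if i \<in> K then \<beta> (g i) else undefined) \<in> \<alpha> ` V} = I"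
      using I d by (auto split: if_splits) blast
    show ?case
      using I unfolding x prod.case *
      by (auto simp: fun_eq_iff inv_into_f_f[OF \<alpha>] inv_into_f_f[OF \<beta>] extensional_def restrict_def)
  next
    case (4 x)
    then show ?case by (auto simp: PiE_iff extensional_def split: if_splits)
  next
    case (5 f)
    then show ?case
      unfolding prod.case by (intro arg_cong[where f = H] ext)
        (use f_inv_into_f[of _ \<alpha> V] f_inv_into_f[of _ \<beta> W] in \<open>auto simp: PiE_iff extensional_def\<close>)
  qed
  also have "\<dots> = (\<Sum>I\<in>Pow K. \<Sum>f\<in>I \<rightarrow>\<^sub>E V. \<Sum>g\<in>(K - I) \<rightarrow>\<^sub>E W.
       H (\<lambda>i. if i \<in> I then \<alpha> (f i) else if i \<in> K then \<beta> (g i) else undefined))"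
    using K fin by (subst sum.Sigma[symmetric])
      (auto simp: sum.cartesian_product intro!: finite_PiE dest: finite_subset)
  finally show ?thesis .
qed

lemma graft_sum_Nil:
  "graft_sum (PNode []) K s h = h (Node (image_mset s (mset_set K)))"
proof -
  have "K \<rightarrow>\<^sub>E vertices (PNode []) = {\<lambda>i\<in>K. []}"
    by (auto simp: PiE_iff extensional_def fun_eq_iff)
  moreover have "{i\<in>K. (\<lambda>i\<in>K. []) i = []} = K" by auto
  ultimately show ?thesis by (simp add: graft_sum_def)
qed

text \<open>The occurrences in \<open>I\<close> are grafted into the first branch, the others onto
  the root or into the remaining branches. Together with the case of no branch this gives a
  recursion for products in which addresses no longer occur.\<close>

lemma graft_sum_Cons:
  assumes K: "finite K"
  shows "graft_sum (PNode (t # ts)) K s h = (\<Sum>I\<in>Pow K. graft_sum t I s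
     (\<lambda>b. graft_sum (PNode ts) (K - I) s (\<lambda>c. h (Node (add_mset b (branches c))))))"
proof -
  have inj: "inj_on shift_head (vertices (PNode ts))"
  proof (rule inj_onI)
    fix v w assume "shift_head v = shift_head w" then show "v = w" by (cases v; cases w) auto
  qed
  have sh0: "shift_head v \<noteq> 0 # w" for v w by (cases v) auto
  have "graft_sum (PNode (t # ts)) K s h = (\<Sum>I\<in>Pow K. \<Sum>f\<in>I \<rightarrow>\<^sub>E vertices t.
      \<Sum>g\<in>(K - I) \<rightarrow>\<^sub>E vertices (PNode ts). h (attach (PNode (t # ts)) (\<lambda>v. image_mset s (mset_set
        {i\<in>K. (if i \<in> I then 0 # f i else if i \<in> K then shift_head (g i) else undefined) = v}))))"
    unfolding graft_sum_def vertices_Cons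
  proof (rule sum_PiE_Un[OF K _ inj])
    show "Cons 0 ` vertices t \<inter> shift_head ` vertices (PNode ts) = {}"
      using sh0 by (metis disjoint_iff imageE)
  qed (auto simp only: finite_vertices inj_on_def list.inject)
  also have "\<dots> = (\<Sum>I\<in>Pow K. graft_sum t I s
     (\<lambda>b. graft_sum (PNode ts) (K - I) s (\<lambda>c. h (Node (add_mset b (branches c))))))"
    unfolding graft_sum_def
  proof (intro sum.cong refl)
    fix I f g assume I: "I \<in> Pow K" and f: "f \<in> I \<rightarrow>\<^sub>E vertices t"
      and g: "g \<in> (K - I) \<rightarrow>\<^sub>E vertices (PNode ts)"
    let ?e = "\<lambda>i. if i \<in> I then 0 # f i else if i \<in> K then shift_head (g i) else undefined"
    have 1: "{i\<in>K. ?e i = 0 # v} = {i\<in>I. f i = v}" for v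
      using I sh0 by auto
    have 2: "{i\<in>K. ?e i = shift_head v} = {i\<in>K - I. g i = v}" if v: "v \<in> vertices (PNode ts)" for v
    proof -
      have "shift_head (g i) = shift_head v \<longleftrightarrow> g i = v" if "i \<in> K - I" for i
        using g v that inj by (simp add: PiE_iff inj_on_eq_iff del: vertices.simps)
      then show ?thesis using I sh0 by (auto simp: sh0[symmetric])
    qed
    have "attach (PNode ts) ((\<lambda>v. image_mset s (mset_set {i\<in>K. ?e i = v})) \<circ> shift_head)
        = attach (PNode ts) (\<lambda>v. image_mset s (mset_set {i\<in>K - I. g i = v}))"
      by (rule attach_cong) (simp only: comp_apply 2)
    then show "h (attach (PNode (t # ts)) (\<lambda>v. image_mset s (mset_set {i\<in>K. ?e i = v})))
        = h (Node (add_mset (attach t (\<lambda>v. image_mset s (mset_set {i\<in>I. f i = v})))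
           (branches (attach (PNode ts) (\<lambda>v. image_mset s (mset_set {i\<in>K - I. g i = v}))))))"
      unfolding attach_Cons 1 by simp
  qed
  finally show ?thesis .
qed


section \<open>Convolution of multiplicative tree functionals\<close>

definition tree_conv :: "(rtree \<Rightarrow> real) \<Rightarrow> (rtree \<Rightarrow> real) \<Rightarrow> rtree \<Rightarrow> real" where
  "tree_conv u v t = (\<Sum>I\<in>Pow {..<length (branch_list t)}.
     u (Node (mset (nths (branch_list t) I))) *
     v (Node (mset (nths (branch_list t) ({..<length (branch_list t)} - I)))))"

lemma mset_nths:
  "I \<subseteq> {..<length ts} \<Longrightarrow> mset (nths ts I) = image_mset ((!) ts) (mset_set I)"
proof (induction ts arbitrary: I rule: rev_induct)
  case Nil
  then show ?case by simp
next
  case (snoc x xs)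
  let ?I = "I - {length xs}"
  have fin: "finite I" using snoc.prems finite_subset by blast
  have I: "?I \<subseteq> {..<length xs}" using snoc.prems by (auto simp: less_Suc_eq)
  have "image_mset ((!) xs) (mset_set ?I) = image_mset ((!) (xs @ [x])) (mset_set ?I)"
    using I fin by (intro image_mset_cong) (auto simp: nth_append less_Suc_eq)
  moreover have "nths xs I = nths xs ?I" unfolding nths_def
    by (intro arg_cong[where f = "map fst"] filter_cong) (auto dest: set_zip_rightD)
  moreover have "I = insert (length xs) ?I" if "length xs \<in> I" using that by auto
  then have "mset_set I = add_mset (length xs) (mset_set ?I)" if "length xs \<in> I"
    using that fin by (metis finite_Diff mset_set.insert_remove Diff_idemp)
  ultimately show ?case
    using snoc.IH[OF I] by (cases "length xs \<in> I") (auto simp: nths_append)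
qed

lemma tree_conv_index:
  assumes K: "finite K"
  shows "tree_conv u v (Node (image_mset s (mset_set K))) =
    (\<Sum>I\<in>Pow K. u (Node (image_mset s (mset_set I))) * v (Node (image_mset s (mset_set (K - I)))))"
proof -
  let ?t = "Node (image_mset s (mset_set K))"
  let ?n = "length (branch_list ?t)"
  obtain k where k: "bij_betw k {..<?n} K"
      "\<And>i. i < ?n \<Longrightarrow> s (k i) = branch_list ?t ! i"
    using exists_list_indexing[OF K, of s "branch_list ?t"] mset_branch_list[of ?t] by auto
  have *: "image_mset s (mset_set (k ` I)) = mset (nths (branch_list ?t) I)" if I: "I \<subseteq> {..<?n}" for I
  proof -
    have inj: "inj_on k I" using k(1) I by (metis bij_betw_imp_inj_on inj_on_subset)
    have "image_mset s (mset_set (k ` I)) = image_mset (s \<circ> k) (mset_set I)"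
      unfolding image_mset_mset_set[OF inj, symmetric] by (simp add: multiset.map_comp)
    also have "\<dots> = image_mset ((!) (branch_list ?t)) (mset_set I)"
      using I k(2) finite_subset[OF I] by (intro image_mset_cong) auto
    finally show ?thesis using mset_nths[OF I] by simp
  qed
  have P: "bij_betw ((`) k) (Pow {..<?n}) (Pow K)"
    using k(1) by (rule bij_betw_Pow)
  have d: "K - k ` I = k ` ({..<?n} - I)" if "I \<subseteq> {..<?n}" for I
    using k(1) that inj_on_image_set_diff[of k "{..<?n}" "{..<?n}" I] by (auto simp: bij_betw_def)
  show ?thesis
    unfolding tree_conv_def sum.reindex_bij_betw[OF P, symmetric]
    by (intro sum.cong refl) (simp add: d *)
qed

text \<open>A Leibniz rule: in an ordered bipartition the branch \<open>b\<close> lies in the left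
  or in the right part, and is then carried along by the corresponding functional.\<close>

lemma tree_conv_add_mset:
  "tree_conv u v (Node (add_mset b B)) =
     tree_conv (\<lambda>c. u (Node (add_mset b (branches c)))) v (Node B) +
     tree_conv u (\<lambda>c. v (Node (add_mset b (branches c)))) (Node B)"
proof -
  obtain bs where bs: "mset bs = B" using ex_mset by blast
  let ?n = "length bs" and ?s = "(!) (bs @ [b])"
  let ?K = "{..<?n}"
  have im: "image_mset ?s (mset_set ?K) = B"
    unfolding bs[symmetric] using mset_nths[of ?K bs] 
    by (subst image_mset_cong[where g = "(!) bs"]) (auto simp: nth_append nths_all)
  have add: "image_mset ?s (mset_set (insert ?n I)) = add_mset b (image_mset ?s (mset_set I))"
    if "I \<subseteq> ?K" for I
    using that finite_subset[OF that] by (subst mset_set.insert) auto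
  have im': "image_mset ?s (mset_set (insert ?n ?K)) = add_mset b B"
    by (simp only: add[OF order_refl] im)
  have inj: "inj_on (insert ?n) (Pow ?K)"
    by (intro inj_onI) (metis PowD insert_ident lessThan_iff less_irrefl subsetD)
  have d1: "insert ?n ?K - I = insert ?n (?K - I)" if "I \<subseteq> ?K" for I using that by auto
  have d2: "insert ?n ?K - insert ?n I = ?K - I" if "I \<subseteq> ?K" for I using that by auto
  have "tree_conv u v (Node (add_mset b B)) = (\<Sum>I\<in>Pow ?K \<union> insert ?n ` Pow ?K.
      u (Node (image_mset ?s (mset_set I))) * v (Node (image_mset ?s (mset_set (insert ?n ?K - I)))))"
    using tree_conv_index[of "insert ?n ?K" u v ?s] unfolding im' by (simp add: Pow_insert del: nth_append)
  also have "\<dots> = (\<Sum>I\<in>Pow ?K. u (Node (image_mset ?s (mset_set I))) *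
        v (Node (image_mset ?s (mset_set (insert ?n ?K - I))))) +
      (\<Sum>I\<in>Pow ?K. u (Node (image_mset ?s (mset_set (insert ?n I)))) *
        v (Node (image_mset ?s (mset_set (insert ?n ?K - insert ?n I)))))"
    by (subst sum.union_disjoint) (auto simp: sum.reindex[OF inj])
  also have "\<dots> = (\<Sum>I\<in>Pow ?K. u (Node (image_mset ?s (mset_set I))) *
        v (Node (add_mset b (image_mset ?s (mset_set (?K - I)))))) +
      (\<Sum>I\<in>Pow ?K. u (Node (add_mset b (image_mset ?s (mset_set I)))) *
        v (Node (image_mset ?s (mset_set (?K - I)))))"
    by (intro arg_cong2[where f = "(+)"] sum.cong refl) (simp_all only: Pow_iff d1 d2 add Diff_subset)
  finally show ?thesis
    using tree_conv_index[of ?K "\<lambda>c. u (Node (add_mset b (branches c)))" v ?s]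
      tree_conv_index[of ?K u "\<lambda>c. v (Node (add_mset b (branches c)))" ?s]
    unfolding im by simp
qed

lemma tree_conv_bullet: "tree_conv u v bullet = u bullet * v bullet"
  using tree_conv_index[of "{}" u v undefined] by simp

text \<open>Ordered bipartitions of the root branches, kept as lists so that both parts are again
  plane trees on which grafting can be summed.\<close>

fun bisections :: "'a list \<Rightarrow> ('a list \<times> 'a list) list" where
  "bisections [] = [([], [])]"
| "bisections (x # xs) = map (\<lambda>(a, b). (x # a, b)) (bisections xs) @ map (\<lambda>(a, b). (a, x # b)) (bisections xs)"

lemma tree_conv_shape:
  "tree_conv u v (shape (PNode ts)) = (\<Sum>(a, b)\<leftarrow>bisections ts. u (shape (PNode a)) * v (shape (PNode b)))"
  by (induction ts arbitrary: u v)
     (simp_all add: tree_conv_bullet tree_conv_add_mset comp_def case_prod_beta')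

lemma graft_sum_add: "graft_sum p K s (\<lambda>t. f t + g t) = graft_sum p K s f + graft_sum p K s g"
  by (simp add: graft_sum_def sum.distrib)

lemma graft_sum_sum: "graft_sum p K s (\<lambda>t. \<Sum>x\<in>X. f x t) = (\<Sum>x\<in>X. graft_sum p K s (f x))"
  unfolding graft_sum_def by (rule sum.swap)

lemma graft_sum_sum_list: "graft_sum p K s (\<lambda>t. \<Sum>x\<leftarrow>xs. f x t) = (\<Sum>x\<leftarrow>xs. graft_sum p K s (f x))"
  by (induction xs) (auto simp: graft_sum_add, simp add: graft_sum_def)

lemma graft_sum_mult_right: "graft_sum p K s (\<lambda>t. f t * a) = graft_sum p K s f * a"
  by (simp add: graft_sum_def sum_distrib_right)

lemma graft_sum_mult_left: "graft_sum p K s (\<lambda>t. a * f t) = a * graft_sum p K s f"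
  by (simp add: graft_sum_def sum_distrib_left)

lemma sum_sum_list_swap: "(\<Sum>i\<in>X. \<Sum>x\<leftarrow>xs. f i x :: real) = (\<Sum>x\<leftarrow>xs. \<Sum>i\<in>X. f i x)"
  by (induction xs) (simp_all add: sum.distrib)

text \<open>A sum over ordered pairs of disjoint subsets, regrouped by their union or by the second
  member. The two terms of the Leibniz rule need one regrouping each.\<close>

lemma sum_Pow_disjoint:
  assumes "finite K"
  shows "(\<Sum>I\<in>Pow K. \<Sum>J\<in>Pow (K - I). F I J) = (\<Sum>L\<in>Pow K. \<Sum>I\<in>Pow L. F I (L - I) :: real)"
    and "(\<Sum>I\<in>Pow K. \<Sum>J\<in>Pow (K - I). F I J) = (\<Sum>J\<in>Pow K. \<Sum>I\<in>Pow (K - J). F I J)"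
proof -
  have fin: "finite L" if "L \<in> Pow K" for L using that assms finite_subset by auto
  have 0: "(\<Sum>I\<in>Pow K. \<Sum>J\<in>Pow (K - I). F I J) = (\<Sum>(I, J)\<in>(SIGMA I:Pow K. Pow (K - I)). F I J)"
    using assms by (intro sum.Sigma) auto
  also have "\<dots> = (\<Sum>(L, I)\<in>(SIGMA L:Pow K. Pow L). F I (L - I))"
    by (rule sum.reindex_bij_witness[where i = "\<lambda>(L, I). (I, L - I)" and j = "\<lambda>(I, J). (I \<union> J, I)"]) 
      (auto simp: Un_Diff intro!: arg_cong2[where f = F])
  also have "\<dots> = (\<Sum>L\<in>Pow K. \<Sum>I\<in>Pow L. F I (L - I))"
    using assms fin by (subst sum.Sigma) auto
  finally show "(\<Sum>I\<in>Pow K. \<Sum>J\<in>Pow (K - I). F I J) = (\<Sum>L\<in>Pow K. \<Sum>I\<in>Pow L. F I (L - I))" .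
  have "(\<Sum>(I, J)\<in>(SIGMA I:Pow K. Pow (K - I)). F I J) = (\<Sum>(J, I)\<in>(SIGMA J:Pow K. Pow (K - J)). F I J)"
    by (rule sum.reindex_bij_witness[where i = "\<lambda>(I, J). (J, I)" and j = "\<lambda>(I, J). (J, I)"]) auto
  also have "\<dots> = (\<Sum>J\<in>Pow K. \<Sum>I\<in>Pow (K - J). F I J)"
    using assms by (subst sum.Sigma) auto
  finally show "(\<Sum>I\<in>Pow K. \<Sum>J\<in>Pow (K - I). F I J) = (\<Sum>J\<in>Pow K. \<Sum>I\<in>Pow (K - J). F I J)"
    using 0 by simp
qed

text \<open>The coproduct is multiplicative: bipartitions of the root branches of a grafted tree
  correspond to a bipartition of the branches of \<open>PNode ts\<close> and one of the grafted
  occurrences, because an occurrence grafted into a branch follows that branch, and one grafted onto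
  the root chooses its side freely.\<close>

lemma graft_sum_tree_conv:
  assumes "finite K"
  shows "graft_sum (PNode ts) K s (tree_conv u v) =
    (\<Sum>I\<in>Pow K. \<Sum>(a, b)\<leftarrow>bisections ts. graft_sum (PNode a) I s u * graft_sum (PNode b) (K - I) s v)"
  using assms
proof (induction ts arbitrary: K u v)
  case Nil
  then show ?case by (simp add: graft_sum_Nil tree_conv_index)
next
  case (Cons t ts)
  note K = \<open>finite K\<close>
  let ?B = "bisections ts"
  let ?u = "\<lambda>b c. u (Node (add_mset b (branches c)))" and ?v = "\<lambda>b c. v (Node (add_mset b (branches c)))"
  have split: "tree_conv u v (Node (add_mset b (branches c))) = tree_conv (?u b) v c + tree_conv u (?v b) c"
    for b c using tree_conv_add_mset[of u v b "branches c"] by simp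
  \<comment> \<open>In \<open>F\<close> the new branch \<open>t\<close> goes to the left factor, in
    \<open>G\<close> to the right one. The set \<open>I\<close> holds the occurrences grafted into
    \<open>t\<close>, and \<open>J\<close> those grafted onto the rest of the left factor.\<close>
  define F where "F I J x = graft_sum t I s (\<lambda>b. graft_sum (PNode (fst x)) J s (?u b)) *
      graft_sum (PNode (snd x)) (K - I - J) s v" for I J x
  define G where "G I J x = graft_sum (PNode (fst x)) J s u *
      graft_sum t I s (\<lambda>b. graft_sum (PNode (snd x)) (K - I - J) s (?v b))" for I J x
  have "graft_sum (PNode (t # ts)) K s (tree_conv u v) =
      (\<Sum>I\<in>Pow K. graft_sum t I s (\<lambda>b. graft_sum (PNode ts) (K - I) s (tree_conv (?u b) v) +
         graft_sum (PNode ts) (K - I) s (tree_conv u (?v b))))"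
    by (simp add: graft_sum_Cons[OF K] split graft_sum_add)
  also have "\<dots> = (\<Sum>I\<in>Pow K. (\<Sum>J\<in>Pow (K - I). \<Sum>x\<leftarrow>?B. F I J x) + (\<Sum>J\<in>Pow (K - I). \<Sum>x\<leftarrow>?B. G I J x))"
    using K by (intro sum.cong refl)
      (simp add: Cons.IH graft_sum_add graft_sum_sum graft_sum_sum_list graft_sum_mult_left
        graft_sum_mult_right F_def G_def case_prod_beta')
  also have "\<dots> = (\<Sum>I\<in>Pow K. \<Sum>J\<in>Pow (K - I). \<Sum>x\<leftarrow>?B. F I J x) + (\<Sum>I\<in>Pow K. \<Sum>J\<in>Pow (K - I). \<Sum>x\<leftarrow>?B. G I J x)"
    by (rule sum.distrib)
  \<comment> \<open>In \<open>F\<close> all occurrences on the left form the union of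
    \<open>I\<close> and \<open>J\<close>, now called \<open>L\<close>; in \<open>G\<close> they are
    just \<open>J\<close>, which becomes the outer variable.\<close>
  also have "\<dots> = (\<Sum>L\<in>Pow K. \<Sum>I\<in>Pow L. \<Sum>x\<leftarrow>?B. F I (L - I) x) + (\<Sum>J\<in>Pow K. \<Sum>I\<in>Pow (K - J). \<Sum>x\<leftarrow>?B. G I J x)"
    by (rule arg_cong2[where f = "(+)"], rule sum_Pow_disjoint(1)[OF K], rule sum_Pow_disjoint(2)[OF K])
  also have "(\<Sum>L\<in>Pow K. \<Sum>I\<in>Pow L. \<Sum>x\<leftarrow>?B. F I (L - I) x) = (\<Sum>L\<in>Pow K. \<Sum>x\<leftarrow>?B.
      graft_sum (PNode (t # fst x)) L s u * graft_sum (PNode (snd x)) (K - L) s v)"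
  proof (intro sum.cong refl)
    fix L assume L: "L \<in> Pow K"
    then have fL: "finite L" using K finite_subset by auto
    have "K - I - (L - I) = K - L" if "I \<in> Pow L" for I using that by auto
    then have "(\<Sum>I\<in>Pow L. \<Sum>x\<leftarrow>?B. F I (L - I) x) = (\<Sum>I\<in>Pow L. \<Sum>x\<leftarrow>?B.
        graft_sum t I s (\<lambda>b. graft_sum (PNode (fst x)) (L - I) s (?u b)) * graft_sum (PNode (snd x)) (K - L) s v)"
      by (simp add: F_def)
    then show "(\<Sum>I\<in>Pow L. \<Sum>x\<leftarrow>?B. F I (L - I) x) = (\<Sum>x\<leftarrow>?B.
      graft_sum (PNode (t # fst x)) L s u * graft_sum (PNode (snd x)) (K - L) s v)"
      by (simp add: graft_sum_Cons[OF fL] sum_distrib_right sum_sum_list_swap)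
  qed
  also have "(\<Sum>J\<in>Pow K. \<Sum>I\<in>Pow (K - J). \<Sum>x\<leftarrow>?B. G I J x) = (\<Sum>J\<in>Pow K. \<Sum>x\<leftarrow>?B.
      graft_sum (PNode (fst x)) J s u * graft_sum (PNode (t # snd x)) (K - J) s v)"
  proof (intro sum.cong refl)
    fix J assume "J \<in> Pow K"
    have fJ: "finite (K - J)" using K by auto
    have "K - I - J = K - J - I" for I by auto
    then have "(\<Sum>I\<in>Pow (K - J). \<Sum>x\<leftarrow>?B. G I J x) = (\<Sum>I\<in>Pow (K - J). \<Sum>x\<leftarrow>?B. 
        graft_sum (PNode (fst x)) J s u * graft_sum t I s (\<lambda>b. graft_sum (PNode (snd x)) (K - J - I) s (?v b)))"
      unfolding G_def by presburger
    then show "(\<Sum>I\<in>Pow (K - J). \<Sum>x\<leftarrow>?B. G I J x) = (\<Sum>x\<leftarrow>?B.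
      graft_sum (PNode (fst x)) J s u * graft_sum (PNode (t # snd x)) (K - J) s v)"
      by (simp add: graft_sum_Cons[OF fJ] sum_distrib_left sum_sum_list_swap)
  qed
  finally show ?case
    by (simp add: comp_def case_prod_beta' sum.distrib del: shape.simps)
qed

lemma tree_mult_conv:
  assumes "tree_mult u" "tree_mult v"
  shows "tree_mult (tree_conv u v)"
  unfolding tree_mult_def
proof (intro allI impI)
  fix p and K :: "nat set" and s :: "nat \<Rightarrow> rtree" assume K: "finite K"
  obtain ts where p: "p = PNode ts" by (cases p)
  let ?n = "\<lambda>I. Node (image_mset s (mset_set I))"
  have fin: "finite I" "finite (K - I)" if "I \<in> Pow K" for I using that K finite_subset by auto
  have "graft_sum p K s (tree_conv u v) = (\<Sum>I\<in>Pow K. \<Sum>(a, b)\<leftarrow>bisections ts.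
      (u (?n I) * u (shape (PNode a))) * (v (?n (K - I)) * v (shape (PNode b))))"
    unfolding p graft_sum_tree_conv[OF K]
    using assms fin unfolding tree_mult_def by (intro sum.cong refl) (simp del: shape.simps)
  also have "\<dots> = (\<Sum>I\<in>Pow K. (u (?n I) * v (?n (K - I))) *
      (\<Sum>(a, b)\<leftarrow>bisections ts. u (shape (PNode a)) * v (shape (PNode b))))"
    by (simp only: case_prod_beta' sum_list_const_mult[symmetric] mult_ac)
  finally show "graft_sum p K s (tree_conv u v) = tree_conv u v (?n K) * tree_conv u v (shape p)"
    unfolding p tree_conv_shape tree_conv_index[OF K] sum_distrib_right .
qed

section \<open>Chains and the characters supported on them\<close>

lemma chain_1: "chain (Suc 0) = bullet"
  by (simp add: chain_def)

lemma chain_Suc: "chain (Suc (Suc n)) = Node {#chain (Suc n)#}"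
  by (simp add: chain_def)

lemma chain_inj: "chain (Suc m) = chain (Suc n) \<longleftrightarrow> m = n"
proof (induction m arbitrary: n)
  case 0
  show ?case by (cases n) (auto simp: chain_1 chain_Suc)
next
  case (Suc m)
  show ?case by (cases n) (auto simp: chain_1 chain_Suc Suc)
qed

definition chain_char :: "real \<Rightarrow> rtree \<Rightarrow> real" where
  "chain_char x t = (if \<exists>n. t = chain (Suc n) then x ^ (THE n. t = chain (Suc n)) else 0)"

lemma chain_char_chain: "chain_char x (chain (Suc n)) = x ^ n"
  by (auto simp: chain_char_def chain_inj)

lemma chain_char_bullet: "chain_char x bullet = 1"
  using chain_char_chain[of x 0] by (simp add: chain_1)

lemma chain_char_single: "chain_char x (Node {#t#}) = x * chain_char x t"
proof (cases "\<exists>n. t = chain (Suc n)")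
  case True
  then show ?thesis using chain_char_chain by (metis chain_Suc power_Suc)
next
  case False
  then have "\<nexists>n. Node {#t#} = chain (Suc n)"
    by (metis chain_1 chain_Suc not0_implies_Suc rtree.inject single_eq_single add_mset_eq_singleton_iff empty_not_add_mset)
  with False show ?thesis by (simp add: chain_char_def)
qed

lemma chain_char_fork: "chain_char x (Node (add_mset a (add_mset b B))) = 0"
proof -
  have "Node (add_mset a (add_mset b B)) \<noteq> chain (Suc n)" for n
    by (cases n) (auto simp: chain_1 chain_Suc)
  then show ?thesis by (simp add: chain_char_def)
qed

lemma chain_char_nonneg: "0 \<le> x \<Longrightarrow> 0 \<le> chain_char x t"
  by (simp add: chain_char_def)

lemma graft_sum_zero: "graft_sum p K s (\<lambda>_. 0) = 0"
  by (simp add: graft_sum_def)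

text \<open>Grafting yields a chain only when a single chain, or nothing, is put on the top vertex
  of a chain, and then the numbers of edges add. The induction goes up the chain; a tree with two
  root branches makes both sides vanish.\<close>

lemma tree_mult_chain_char: "tree_mult (chain_char x)"
  unfolding tree_mult_def
proof (intro allI impI)
  fix p and K :: "nat set" and s :: "nat \<Rightarrow> rtree" assume "finite K"
  then show "graft_sum p K s (chain_char x) =
     chain_char x (Node (image_mset s (mset_set K))) * chain_char x (shape p)"
  proof (induction p arbitrary: K)
    case (PNode ts)
    note K = \<open>finite K\<close>
    consider "ts = []" | t where "ts = [t]" | t t' ts' where "ts = t # t' # ts'"
      by (metis list.exhaust)
    then show ?case
    proof cases
      case 1
      then show ?thesis by (simp add: graft_sum_Nil chain_char_bullet)
    next
      case 2
      have "graft_sum (PNode ts) K s (chain_char x) = (\<Sum>I\<in>Pow K.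
          graft_sum t I s (\<lambda>b. chain_char x (Node (add_mset b (image_mset s (mset_set (K - I)))))))"
        using K by (simp add: 2 graft_sum_Cons graft_sum_Nil)
      \<comment> \<open>An occurrence outside \<open>I\<close> stays at the root and forms a second
        root branch beside \<open>t\<close>, so only \<open>I = K\<close> contributes.\<close>
      also have "\<dots> = (\<Sum>I\<in>Pow K. if I = K then x * graft_sum t K s (chain_char x) else 0)"
      proof (intro sum.cong refl)
        fix I assume I: "I \<in> Pow K"
        show "graft_sum t I s (\<lambda>b. chain_char x (Node (add_mset b (image_mset s (mset_set (K - I))))))
          = (if I = K then x * graft_sum t K s (chain_char x) else 0)"
        proof (cases "I = K")
          case True
          then show ?thesis by (simp add: chain_char_single graft_sum_mult_left)
        next
          case False
          then obtain i where "i \<in> K - I" using I by auto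
          then have "image_mset s (mset_set (K - I)) = add_mset (s i) (image_mset s (mset_set (K - I - {i})))"
            using K by (metis finite_Diff image_mset_add_mset mset_set.remove)
          then show ?thesis using False by (simp add: chain_char_fork graft_sum_zero)
        qed
      qed
      also have "\<dots> = x * graft_sum t K s (chain_char x)"
        using K by (simp add: sum.delta)
      finally show ?thesis using PNode(1)[of t K] K 2 by (simp add: chain_char_single)
    next
      case 3
      have "graft_sum (PNode ts) K s (chain_char x) = 0"
        using K by (auto simp: 3 graft_sum_Cons chain_char_fork graft_sum_zero finite_subset intro!: sum.neutral)
      then show ?thesis by (simp add: 3 chain_char_fork)
    qed
  qed
qed


section \<open>Positivity and path-forests\<close>

definition tree_char :: "(rtree \<Rightarrow> real) \<Rightarrow> bool" where
  "tree_char u \<longleftrightarrow> tree_mult u \<and> u bullet = 1 \<and> (\<forall>t. 0 \<le> u t)"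

text \<open>The product with a one-branch tree as left factor. Its recursion over the branches of
  \<open>p\<close> has two terms in place of a sum over subsets.\<close>

definition insert_sum :: "ptree \<Rightarrow> rtree \<Rightarrow> (rtree \<Rightarrow> real) \<Rightarrow> real" where
  "insert_sum p x h = graft_sum p {0::nat} (\<lambda>_. x) h"

lemma graft_sum_empty: "graft_sum p {} s h = h (shape p)"
  by (simp add: graft_sum_def attach_empty)

lemma insert_sum_Nil: "insert_sum (PNode []) x h = h (Node {#x#})"
  by (simp add: insert_sum_def graft_sum_Nil)

lemma insert_sum_Cons:
  "insert_sum (PNode (t # ts)) x h =
     insert_sum (PNode ts) x (\<lambda>c. h (Node (add_mset (shape t) (branches c)))) +
     insert_sum t x (\<lambda>b. h (Node (add_mset b (image_mset shape (mset ts)))))"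
  by (simp add: insert_sum_def graft_sum_Cons graft_sum_empty Pow_insert)

lemma insert_sum_shape: "shape p = shape p' \<Longrightarrow> insert_sum p x h = insert_sum p' x h"
  unfolding insert_sum_def by (rule graft_sum_shape)

lemma insert_sum_nonneg: "(\<And>t. 0 \<le> h t) \<Longrightarrow> 0 \<le> insert_sum p x h"
  unfolding insert_sum_def graft_sum_def by (rule sum_nonneg) simp

lemma insert_sum_mult: "tree_mult u \<Longrightarrow> insert_sum p x u = u (Node {#x#}) * u (shape p)"
  by (simp add: insert_sum_def tree_mult_def)

inductive grow :: "rtree \<Rightarrow> rtree \<Rightarrow> bool" where
  root: "grow (Node B) (Node (add_mset x B))"
| below: "grow b b' \<Longrightarrow> grow (Node (add_mset b B)) (Node (add_mset b' B))"

text \<open>A growth step attaches one tree \<open>x\<close> at some vertex, so \<open>t'\<close> is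
  among the summands, and the others are nonnegative. The tree \<open>x\<close> is chosen before
  \<open>p\<close> and \<open>h\<close>, which lets the induction pass to a branch with a modified
  \<open>h\<close>.\<close>

lemma grow_le_insert_sum:
  "grow t t' \<Longrightarrow> \<exists>x. \<forall>p h. shape p = t \<longrightarrow> (\<forall>c. 0 \<le> h c) \<longrightarrow> h t' \<le> insert_sum p x h"
proof (induction rule: grow.induct)
  case (root B x)
  have "h (Node (add_mset x (image_mset shape (mset ts)))) \<le> insert_sum (PNode ts) x h"
    if "\<forall>c. 0 \<le> h c" for ts and h :: "rtree \<Rightarrow> real"
    using that
  proof (induction ts arbitrary: h)
    case Nil
    then show ?case by (simp add: insert_sum_Nil)
  next
    case (Cons t ts)
    let ?h = "\<lambda>c. h (Node (add_mset (shape t) (branches c)))"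
    have "?h (Node (add_mset x (image_mset shape (mset ts)))) \<le> insert_sum (PNode ts) x ?h"
      by (rule Cons.IH) (use Cons.prems in simp)
    also have "\<dots> \<le> insert_sum (PNode (t # ts)) x h"
      using Cons.prems by (simp add: insert_sum_Cons insert_sum_nonneg)
    finally show ?case by (simp add: add_mset_commute)
  qed
  then show ?case
    by (intro exI[of _ x] allI impI) (metis mset_map ptree.exhaust rtree.inject shape.simps)
next
  case (below b b' B)
  then obtain x where x: "\<And>p h. shape p = b \<Longrightarrow> (\<forall>c. 0 \<le> h c) \<Longrightarrow> h b' \<le> insert_sum p x h"
    by blast
  obtain bs where bs: "mset bs = B" using ex_mset by blast
  let ?qs = "map rep bs"
  have qs: "image_mset shape (mset ?qs) = B"
    by (simp add: multiset.map_comp comp_def shape_rep bs)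
  show ?case
  proof (intro exI[of _ x] allI impI)
    fix p and h :: "rtree \<Rightarrow> real" assume p: "shape p = Node (add_mset b B)" and h: "\<forall>c. 0 \<le> h c"
    have "h (Node (add_mset b' B)) \<le> insert_sum (rep b) x (\<lambda>c. h (Node (add_mset c B)))"
      using h by (intro x) (auto simp: shape_rep)
    also have "\<dots> \<le> insert_sum (PNode (rep b # ?qs)) x h"
      unfolding insert_sum_Cons qs using h by (simp add: insert_sum_nonneg)
    also have "\<dots> = insert_sum p x h"
      by (rule insert_sum_shape) (simp add: p multiset.map_comp comp_def shape_rep bs)
    finally show "h (Node (add_mset b' B)) \<le> insert_sum p x h" .
  qed
qed

text \<open>If \<open>u\<close> vanishes at a tree, it vanishes on each product with that tree as a
  factor; such a product is a sum of nonnegative values, one of which belongs to the grown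
  tree.\<close>

lemma tree_char_grow:
  assumes u: "tree_char u" and t: "u t = 0" and g: "grow\<^sup>*\<^sup>* t t'"
  shows "u t' = 0"
  using g
proof (induction rule: rtranclp_induct)
  case base
  then show ?case by (rule t)
next
  case (step y z)
  obtain x where "u z \<le> insert_sum (rep y) x u"
    using grow_le_insert_sum[OF step(2)] u shape_rep unfolding tree_char_def by blast
  then show ?case
    using u step.IH insert_sum_mult[of u "rep y" x] unfolding tree_char_def
    by (metis antisym mult_zero_right shape_rep)
qed

lemma grow_below: "grow\<^sup>*\<^sup>* b b' \<Longrightarrow> grow\<^sup>*\<^sup>* (Node (add_mset b B)) (Node (add_mset b' B))"
  by (induction rule: rtranclp_induct) (auto intro: below rtranclp.rtrancl_into_rtrancl)

lemma grow_root: "grow\<^sup>*\<^sup>* (Node B) (Node (B + C))"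
  by (induction C) (auto intro: root rtranclp.rtrancl_into_rtrancl)

lemma grow_bullet: "grow\<^sup>*\<^sup>* bullet t"
  using grow_root[of "{#}" "branches t"] by simp

section \<open>Vanishing on trees with a fork in a branch\<close>

inductive forked :: "rtree \<Rightarrow> bool" where
  fork: "forked (Node (add_mset a (add_mset b B)))"
| forked_below: "forked c \<Longrightarrow> forked (Node (add_mset c B))"

abbreviation cherry :: rtree where "cherry \<equiv> Node {#bullet, bullet#}"

text \<open>Some vertex at a depth d has two children. Keeping only the path to it and these two
  children leaves a stem of d edges with a cherry on top, from which all that was dropped grows
  back.\<close>

lemma forked_from_cherry: "forked b \<Longrightarrow> \<exists>d. grow\<^sup>*\<^sup>* (((\<lambda>t. Node {#t#}) ^^ d) cherry) b"
proof (induction rule: forked.induct)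
  case (fork a b B)
  have "grow\<^sup>*\<^sup>* cherry (Node {#a, bullet#})"
    using grow_below[OF grow_bullet[of a], of "{#bullet#}"] .
  also have "grow\<^sup>*\<^sup>* (Node {#a, bullet#}) (Node {#a, b#})"
    using grow_below[OF grow_bullet[of b], of "{#a#}"] by (simp add: add_mset_commute)
  also have "grow\<^sup>*\<^sup>* (Node {#a, b#}) (Node (add_mset a (add_mset b B)))"
    using grow_root[of "{#a, b#}" B] by simp
  finally show ?case by (intro exI[of _ 0]) simp
next
  case (forked_below c B)
  then obtain d where "grow\<^sup>*\<^sup>* (((\<lambda>t. Node {#t#}) ^^ d) cherry) c" by blast
  then have "grow\<^sup>*\<^sup>* (Node {#((\<lambda>t. Node {#t#}) ^^ d) cherry#}) (Node {#c#})" by (rule grow_below)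
  also have "grow\<^sup>*\<^sup>* (Node {#c#}) (Node (add_mset c B))"
    using grow_root[of "{#c#}" B] by simp
  finally show ?case by (intro exI[of _ "Suc d"]) simp
qed

text \<open>Expanding the two products of \<open>Node {#bullet#}\<close> and \<open>cherry\<close> shows that the value at
  \<open>Node {#cherry#}\<close>, which occurs in only one of them, vanishes.\<close>

lemma tree_char_cherry:
  assumes u: "tree_char u"
  shows "u (Node {#cherry#}) = 0"
proof -
  let ?P = "PNode [PNode []]" and ?S = "PNode [PNode [], PNode []]"
  have m: "tree_mult u" using u by (simp add: tree_char_def)
  have "insert_sum ?S bullet u = u (Node {#bullet#}) * u cherry"
    by (simp add: insert_sum_mult[OF m])
  moreover have "insert_sum ?S bullet u =
      u (Node {#bullet, bullet, bullet#}) + 2 * u (Node {#Node {#bullet#}, bullet#})"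
    by (simp add: insert_sum_Cons insert_sum_Nil add_mset_commute)
  moreover have "graft_sum ?P {0, 1::nat} (\<lambda>_. bullet) u = u cherry * u (Node {#bullet#})"
    using m[unfolded tree_mult_def, rule_format, of "{0, 1}" ?P "\<lambda>_. bullet"] by simp
  moreover have "graft_sum ?P {0, 1::nat} (\<lambda>_. bullet) u =
      u (Node {#bullet, bullet, bullet#}) + 2 * u (Node {#Node {#bullet#}, bullet#}) + u (Node {#cherry#})"
  proof -
    have "Pow {0, 1} = {{}, {0}, {1}, {0, 1::nat}}" by (auto simp: Pow_insert)
    moreover have "{0, Suc 0} - {Suc 0} = {0}" by auto
    ultimately show ?thesis by (simp add: graft_sum_Cons graft_sum_Nil)
  qed
  ultimately show ?thesis by simp
qed

text \<open>The vanishing at a cherry one step below the root is carried to cherries at any greater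
  depth by products with the one-edge tree; every tree with a forked branch grows out of one of
  these.\<close>

lemma tree_char_forked:
  assumes u: "tree_char u" and b: "forked b"
  shows "u (Node (add_mset b B)) = 0"
proof -
  have m: "tree_mult u" and nn: "\<And>t. 0 \<le> u t" using u by (auto simp: tree_char_def)
  have *: "u (Node {#((\<lambda>t. Node {#t#}) ^^ d) cherry#}) = 0" for d
  proof (induction d)
    case 0
    then show ?case using tree_char_cherry[OF u] by simp
  next
    case (Suc d)
    let ?t = "((\<lambda>t. Node {#t#}) ^^ d) cherry"
    \<comment> \<open>In this product \<open>?t\<close> lands on the root or on the leaf of the
      one-edge tree; the second place gives the stem with one more edge.\<close>
    have "insert_sum (PNode [PNode []]) ?t u = 0"
      using Suc by (simp add: insert_sum_mult[OF m])
    then have "u (Node {#bullet, ?t#}) + u (Node {#Node {#?t#}#}) = 0"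
      by (simp add: insert_sum_Cons insert_sum_Nil)
    then show ?case using nn[of "Node {#bullet, ?t#}"] nn[of "Node {#Node {#?t#}#}"] by simp
  qed
  obtain d where "grow\<^sup>*\<^sup>* (((\<lambda>t. Node {#t#}) ^^ d) cherry) b" using forked_from_cherry[OF b] by blast
  from grow_below[OF this, of "{#}"] have "u (Node {#b#}) = 0"
    by (rule tree_char_grow[OF u *])
  then show ?thesis
    by (rule tree_char_grow[OF u]) (use grow_root[of "{#b#}" B] in simp)
qed

lemma forked_or_chain: "forked b \<or> (\<exists>n. b = chain (Suc n))"
proof (induction b)
  case (Node B)
  show ?case
  proof (cases B)
    case empty
    then show ?thesis by (metis chain_1)
  next
    case (add c C)
    show ?thesis
    proof (cases C)
      case empty
      then show ?thesis using Node[of c] add by (auto simp: chain_Suc[symmetric] intro: forked_below)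
    next
      case (add d D)
      then show ?thesis using \<open>B = add_mset c C\<close> by (auto intro: fork)
    qed
  qed
qed

lemma tree_char_not_path_forest:
  assumes u: "tree_char u" and t: "\<nexists>\<mu>. int_partition \<mu> \<and> t = path_forest \<mu>"
  shows "u t = 0"
proof -
  have "\<exists>b\<in>#branches t. forked b"
  proof (rule ccontr)
    assume "\<not> (\<exists>b\<in>#branches t. forked b)"
    then obtain l where l: "\<And>b. b \<in># branches t \<Longrightarrow> b = chain (Suc (l b))"
      using forked_or_chain by metis
    let ?\<mu> = "image_mset (\<lambda>b. Suc (l b)) (branches t)"
    have "image_mset chain ?\<mu> = image_mset (\<lambda>b. b) (branches t)"
      unfolding multiset.map_comp comp_def using l by (intro image_mset_cong) auto
    then have "t = path_forest ?\<mu>" by (simp add: path_forest_def)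
    moreover have "int_partition ?\<mu>" by (auto simp: int_partition_def)
    ultimately show False using t by blast
  qed
  then obtain b where "b \<in># branches t" "forked b" by blast
  then show ?thesis
    using tree_char_forked[OF u, of b "branches t - {#b#}"] by simp
qed

text \<open>The values, at augmented monomial functions, of a unital homomorphism from \<Lambda> to
  the reals that is nonnegative there. The recursion expands p_k times such a function: the new part
  k either stays separate or is added to an existing part.\<close>

definition monomial_state :: "(nat multiset \<Rightarrow> real) \<Rightarrow> bool" where
  "monomial_state y \<longleftrightarrow> y {#} = 1 \<and> (\<forall>\<mu>. int_partition \<mu> \<longrightarrow> 0 \<le> y \<mu>) \<and>
     (\<forall>k>0. \<forall>\<mu>. int_partition \<mu> \<longrightarrow>
        y {#k#} * y \<mu> = y (add_mset k \<mu>) + (\<Sum>j\<in>#\<mu>. y (add_mset (j + k) (\<mu> - {#j#}))))"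

fun pchain :: "nat \<Rightarrow> ptree" where
  "pchain 0 = PNode []"
| "pchain (Suc n) = PNode [pchain n]"

lemma shape_pchain: "shape (pchain n) = chain (Suc n)"
  by (induction n) (simp_all add: chain_1 chain_Suc)

lemma shape_pchain_pred: "0 < l \<Longrightarrow> shape (pchain (l - Suc 0)) = chain l"
  by (simp add: shape_pchain)

text \<open>Grafting anywhere below the top vertex produces a fork, where \<open>h\<close> vanishes;
  only the extension at the top survives. Since \<open>pchain m\<close> has m edges, it has
  \<open>Suc m\<close> vertices.\<close>

lemma insert_sum_pchain:
  "(\<And>t. forked t \<Longrightarrow> h t = 0) \<Longrightarrow> insert_sum (pchain m) (chain (Suc k)) h = h (chain (Suc m + Suc k))"
proof (induction m arbitrary: h)
  case 0
  then show ?case by (simp add: insert_sum_Nil chain_Suc)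
next
  case (Suc m)
  have "insert_sum (pchain m) (chain (Suc k)) (\<lambda>b. h (Node {#b#})) = h (Node {#chain (Suc m + Suc k)#})"
    by (rule Suc.IH) (use Suc.prems forked_below in blast)
  then show ?case
    by (simp add: insert_sum_Cons insert_sum_Nil chain_Suc Suc.prems fork)
qed

text \<open>A chain grafted onto a path-forest becomes a branch of its own at the root, or prolongs
  a branch at its top; every other place forks a branch. These are the two kinds of terms in the
  recursion.\<close>

lemma insert_sum_path_forest:
  assumes "\<And>b B. forked b \<Longrightarrow> h (Node (add_mset b B)) = 0" "0 < k" "0 \<notin> set ls"
  shows "insert_sum (PNode (map (\<lambda>l. pchain (l - 1)) ls)) (chain k) h =
    h (path_forest (add_mset k (mset ls))) + (\<Sum>j\<leftarrow>ls. h (path_forest (add_mset (j + k) (mset ls - {#j#}))))"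
  using assms
proof (induction ls arbitrary: h)
  case Nil
  then show ?case by (simp add: insert_sum_Nil path_forest_def)
next
  case (Cons l ls)
  have l: "l = Suc (l - 1)" "k = Suc (k - 1)" using Cons.prems by auto
  have sh: "shape (pchain (l - Suc 0)) = chain l" using l by (intro shape_pchain_pred) simp
  have sh': "image_mset shape (mset (map (\<lambda>l. pchain (l - 1)) ls)) = image_mset chain (mset ls)"
    unfolding mset_map multiset.map_comp comp_def
    using Cons.prems(3) by (intro image_mset_cong) (auto intro!: shape_pchain_pred gr0I)
  let ?h = "\<lambda>c. h (Node (add_mset (chain l) (branches c)))"
  have "insert_sum (PNode (map (\<lambda>l. pchain (l - 1)) ls)) (chain k) ?h =
      ?h (path_forest (add_mset k (mset ls))) +
      (\<Sum>j\<leftarrow>ls. ?h (path_forest (add_mset (j + k) (mset ls - {#j#}))))"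
    by (rule Cons.IH) (use Cons.prems in \<open>auto simp: add_mset_commute[of "chain l"]\<close>)
  also have "?h (path_forest (add_mset k (mset ls))) = h (path_forest (add_mset k (mset (l # ls))))"
    by (simp add: path_forest_def add_mset_commute)
  also have "(\<Sum>j\<leftarrow>ls. ?h (path_forest (add_mset (j + k) (mset ls - {#j#})))) =
      (\<Sum>j\<leftarrow>ls. h (path_forest (add_mset (j + k) (mset (l # ls) - {#j#}))))"
  proof (intro arg_cong[where f = sum_list] map_cong refl)
    fix j assume "j \<in> set ls"
    then have "mset (l # ls) - {#j#} = add_mset l (mset ls - {#j#})"
      by (simp add: multiset_eq_iff)
    then show "?h (path_forest (add_mset (j + k) (mset ls - {#j#}))) =
        h (path_forest (add_mset (j + k) (mset (l # ls) - {#j#})))"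
      by (simp add: path_forest_def add_mset_commute)
  qed
  moreover have "insert_sum (pchain (l - 1)) (chain k) (\<lambda>b. h (Node (add_mset b (image_mset chain (mset ls)))))
      = h (path_forest (add_mset (l + k) (mset ls)))"
    using insert_sum_pchain[of "\<lambda>b. h (Node (add_mset b (image_mset chain (mset ls))))" "l - 1" "k - 1"]
      Cons.prems(1) l by (simp add: path_forest_def)
  ultimately show ?case
    using sh' by (simp add: insert_sum_Cons sh del: mset_map)
qed

lemma tree_char_monomial_state:
  assumes u: "tree_char u"
  shows "monomial_state (\<lambda>\<mu>. u (path_forest \<mu>))"
  unfolding monomial_state_def
proof (intro conjI allI impI)
  show "u (path_forest {#}) = 1" using u by (simp add: path_forest_def tree_char_def)
  show "0 \<le> u (path_forest \<mu>)" for \<mu> using u by (simp add: tree_char_def)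
  fix k :: nat and \<mu> assume k: "0 < k" and \<mu>: "int_partition \<mu>"
  obtain ls where ls: "mset ls = \<mu>" using ex_mset by blast
  then have 0: "0 \<notin> set ls" using \<mu> by (auto simp: int_partition_def)
  let ?p = "PNode (map (\<lambda>l. pchain (l - 1)) ls)"
  have "image_mset shape (mset (map (\<lambda>l. pchain (l - 1)) ls)) = image_mset chain (mset ls)"
    unfolding mset_map multiset.map_comp comp_def
    using 0 by (intro image_mset_cong) (auto intro!: shape_pchain_pred gr0I)
  then have "shape ?p = path_forest \<mu>" by (simp only: shape.simps mset_map path_forest_def ls)
  then have "insert_sum ?p (chain k) u = u (path_forest {#k#}) * u (path_forest \<mu>)"
    using u by (simp only: insert_sum_mult tree_char_def) (simp add: path_forest_def)
  moreover have "insert_sum ?p (chain k) u =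
      u (path_forest (add_mset k (mset ls))) + (\<Sum>j\<leftarrow>ls. u (path_forest (add_mset (j + k) (mset ls - {#j#}))))"
    using tree_char_forked[OF u] k 0 by (rule insert_sum_path_forest)
  moreover have "(\<Sum>j\<leftarrow>ls. f j) = (\<Sum>j\<in>#\<mu>. f j)" for f :: "nat \<Rightarrow> real"
    unfolding ls[symmetric] by (metis mset_map sum_mset_sum_list)
  ultimately show "u (path_forest {#k#}) * u (path_forest \<mu>) =
      u (path_forest (add_mset k \<mu>)) + (\<Sum>j\<in>#\<mu>. u (path_forest (add_mset (j + k) (\<mu> - {#j#}))))"
    by (simp only: ls)
qed


section \<open>Monomial-positive states\<close>

lemma int_partition_simps [simp]:
  "int_partition {#}" "int_partition (add_mset k \<mu>) \<longleftrightarrow> 0 < k \<and> int_partition \<mu>"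
  by (auto simp: int_partition_def)

lemma int_partition_diff: "int_partition \<mu> \<Longrightarrow> int_partition (\<mu> - \<nu>)"
  by (auto simp: int_partition_def dest: in_diffD)

lemma tendsto_sum_mset:
  fixes f :: "'b \<Rightarrow> 'a \<Rightarrow> real"
  shows "(\<And>j. j \<in># \<mu> \<Longrightarrow> ((\<lambda>n. f n j) \<longlongrightarrow> g j) F) \<Longrightarrow>
    ((\<lambda>n. \<Sum>j\<in>#\<mu>. f n j) \<longlongrightarrow> (\<Sum>j\<in>#\<mu>. g j)) F"
  by (induction \<mu>) (auto intro: tendsto_add)

lemma sum_mset_nonneg: "(\<And>j. j \<in># \<mu> \<Longrightarrow> 0 \<le> f j) \<Longrightarrow> 0 \<le> (\<Sum>j\<in>#\<mu>. f j :: real)"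
  by (induction \<mu>) auto

text \<open>The recursion for \<open>add_mset k \<mu>\<close> refers to \<mu> and to the partitions
  in which k was merged with a part of \<mu>. All of them have one part fewer, so the induction is
  on the number of parts and not on their sum.\<close>

lemma partition_induct [consumes 1, case_names empty add]:
  assumes "int_partition \<mu>" "P {#}"
    and step: "\<And>k \<mu>. 0 < k \<Longrightarrow> int_partition \<mu> \<Longrightarrow> P \<mu> \<Longrightarrow>
      (\<And>j. j \<in># \<mu> \<Longrightarrow> P (add_mset (j + k) (\<mu> - {#j#}))) \<Longrightarrow> P (add_mset k \<mu>)"
  shows "P \<mu>"
  using assms(1)
proof (induction "size \<mu>" arbitrary: \<mu>)
  case 0
  then show ?case using assms(2) by simp
next
  case (Suc n)
  obtain k \<nu> where \<mu>: "\<mu> = add_mset k \<nu>" using Suc(2) by (metis size_eq_Suc_imp_eq_union)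
  then have \<nu>: "0 < k" "int_partition \<nu>" "n = size \<nu>" using Suc by auto
  show ?case
    unfolding \<mu>
  proof (rule step[OF \<nu>(1,2)])
    show "P \<nu>" using Suc.hyps(1) \<nu> by simp
    fix j assume j: "j \<in># \<nu>"
    then have "n = size (add_mset (j + k) (\<nu> - {#j#}))"
      using \<nu>(3) by (metis insert_DiffM size_add_mset)
    then show "P (add_mset (j + k) (\<nu> - {#j#}))"
      by (rule Suc.hyps(1)) (use \<nu> in \<open>auto intro: int_partition_diff\<close>)
  qed
qed

lemma monomial_stateD:
  assumes "monomial_state y"
  shows monomial_state_empty: "y {#} = 1"
    and monomial_state_nonneg: "int_partition \<mu> \<Longrightarrow> 0 \<le> y \<mu>"
    and monomial_state_rec: "0 < k \<Longrightarrow> int_partition \<mu> \<Longrightarrow>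
      y {#k#} * y \<mu> = y (add_mset k \<mu>) + (\<Sum>j\<in>#\<mu>. y (add_mset (j + k) (\<mu> - {#j#})))"
  using assms by (auto simp: monomial_state_def)

lemma monomial_state_unique:
  assumes y: "monomial_state y" and z: "monomial_state z"
    and eq: "\<And>k. 0 < k \<Longrightarrow> y {#k#} = z {#k#}" and \<mu>: "int_partition \<mu>"
  shows "y \<mu> = z \<mu>"
  using \<mu>
proof (induction rule: partition_induct)
  case empty
  then show ?case using y z by (simp add: monomial_state_empty)
next
  case (add k \<mu>)
  then have "(\<Sum>j\<in>#\<mu>. y (add_mset (j + k) (\<mu> - {#j#}))) = (\<Sum>j\<in>#\<mu>. z (add_mset (j + k) (\<mu> - {#j#})))"
    by (intro arg_cong[where f = sum_mset] image_mset_cong) auto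
  then show ?case
    using add monomial_state_rec[OF y, of k \<mu>] monomial_state_rec[OF z, of k \<mu>] eq by simp
qed

text \<open>Limits are taken along a general family of functions that satisfies the recursion only
  asymptotically, with a shift of the index; the peeling step needs this.\<close>

lemma monomial_state_limit:
  fixes w :: "nat \<Rightarrow> nat multiset \<Rightarrow> real"
  assumes empty: "\<And>n. w n {#} = 1" and nonneg: "\<And>n \<mu>. int_partition \<mu> \<Longrightarrow> 0 \<le> w n \<mu>"
    and a: "\<And>k. 0 < k \<Longrightarrow> (\<lambda>n. a n k) \<longlonglongrightarrow> \<alpha> k" and b: "\<And>k. 0 < k \<Longrightarrow> (\<lambda>n. b n k) \<longlonglongrightarrow> \<beta> k"
    and rec: "\<And>n k \<mu>. 0 < k \<Longrightarrow> int_partition \<mu> \<Longrightarrow> a n k * w n \<mu> =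
      w n (add_mset k \<mu>) + (\<Sum>j\<in>#\<mu>. w n (add_mset (j + k) (\<mu> - {#j#}))) + b n k * w (n + k) \<mu>"
  shows "\<exists>z. monomial_state z \<and> (\<forall>\<mu>. int_partition \<mu> \<longrightarrow> (\<lambda>n. w n \<mu>) \<longlonglongrightarrow> z \<mu>) \<and>
    (\<forall>k>0. z {#k#} = \<alpha> k - \<beta> k)"
proof -
  define z where "z \<mu> = lim (\<lambda>n. w n \<mu>)" for \<mu>
  have step: "(\<lambda>n. w n (add_mset k \<mu>)) \<longlonglongrightarrow>
      (\<alpha> k - \<beta> k) * z \<mu> - (\<Sum>j\<in>#\<mu>. z (add_mset (j + k) (\<mu> - {#j#})))"
    if k: "0 < k" and \<mu>: "int_partition \<mu>" and l: "(\<lambda>n. w n \<mu>) \<longlonglongrightarrow> z \<mu>"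
      and l': "\<And>j. j \<in># \<mu> \<Longrightarrow> (\<lambda>n. w n (add_mset (j + k) (\<mu> - {#j#}))) \<longlonglongrightarrow> z (add_mset (j + k) (\<mu> - {#j#}))"
    for k \<mu>
  proof -
    have "(\<lambda>n. a n k * w n \<mu> - b n k * w (n + k) \<mu> - (\<Sum>j\<in>#\<mu>. w n (add_mset (j + k) (\<mu> - {#j#}))))
      \<longlonglongrightarrow> \<alpha> k * z \<mu> - \<beta> k * z \<mu> - (\<Sum>j\<in>#\<mu>. z (add_mset (j + k) (\<mu> - {#j#})))"
      using a[OF k] b[OF k] l l' LIMSEQ_ignore_initial_segment[OF l, of k]
      by (intro tendsto_diff tendsto_mult tendsto_sum_mset) auto
    then show ?thesis using rec[OF k \<mu>] by (simp add: algebra_simps)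
  qed
  have lim: "(\<lambda>n. w n \<mu>) \<longlonglongrightarrow> z \<mu>" if "int_partition \<mu>" for \<mu>
    using that
  proof (induction rule: partition_induct)
    case empty
    then show ?case using assms(1) by (simp add: z_def)
  next
    case (add k \<mu>)
    then have "convergent (\<lambda>n. w n (add_mset k \<mu>))" by (intro convergentI[OF step])
    then show ?case unfolding z_def by (simp only: convergent_LIMSEQ_iff)
  qed
  have rec': "z (add_mset k \<mu>) = (\<alpha> k - \<beta> k) * z \<mu> - (\<Sum>j\<in>#\<mu>. z (add_mset (j + k) (\<mu> - {#j#})))"
    if "0 < k" "int_partition \<mu>" for k \<mu>
    using lim[of "add_mset k \<mu>"] that
    by (intro LIMSEQ_unique[OF _ step]) (auto intro!: lim int_partition_diff)
  have e: "z {#} = 1" by (simp add: z_def empty)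
  have single: "z {#k#} = \<alpha> k - \<beta> k" if "0 < k" for k
    using rec'[OF that, of "{#}"] e by simp
  have nn: "0 \<le> z \<mu>" if "int_partition \<mu>" for \<mu>
    using lim[OF that] nonneg[OF that] by (intro LIMSEQ_le_const) auto
  have "z {#k#} * z \<mu> = z (add_mset k \<mu>) + (\<Sum>j\<in>#\<mu>. z (add_mset (j + k) (\<mu> - {#j#})))"
    if "0 < k" "int_partition \<mu>" for k \<mu>
    unfolding rec'[OF that] single[OF that(1)] by simp
  then have "monomial_state z"
    unfolding monomial_state_def using e nn by blast
  then show ?thesis using lim single by blast
qed

lemma monomial_state_closed:
  assumes "\<And>n. monomial_state (w n)" "\<And>k. 0 < k \<Longrightarrow> (\<lambda>n. w n {#k#}) \<longlonglongrightarrow> p k"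
  obtains z where "monomial_state z" "\<And>\<mu>. int_partition \<mu> \<Longrightarrow> (\<lambda>n. w n \<mu>) \<longlonglongrightarrow> z \<mu>"
    "\<And>k. 0 < k \<Longrightarrow> z {#k#} = p k"
proof -
  have "\<exists>z. monomial_state z \<and> (\<forall>\<mu>. int_partition \<mu> \<longrightarrow> (\<lambda>n. w n \<mu>) \<longlonglongrightarrow> z \<mu>) \<and>
    (\<forall>k>0. z {#k#} = p k - 0)"
    by (rule monomial_state_limit[where a = "\<lambda>n k. w n {#k#}" and b = "\<lambda>n k. 0"])
       (use assms in \<open>auto simp: monomial_state_empty monomial_state_nonneg monomial_state_rec\<close>)
  then show thesis using that by auto
qed

section \<open>Moment functionals and log-convexity\<close>

definition poly_functional :: "(nat \<Rightarrow> real) \<Rightarrow> real poly \<Rightarrow> real" where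
  "poly_functional z f = (\<Sum>i\<le>degree f. coeff f i * z i)"

lemma poly_functional_bound: "degree f \<le> n \<Longrightarrow> poly_functional z f = (\<Sum>i\<le>n. coeff f i * z i)"
  unfolding poly_functional_def by (rule sum.mono_neutral_left) (auto simp: coeff_eq_0)

lemma poly_functional_add: "poly_functional z (f + g) = poly_functional z f + poly_functional z g"
proof -
  let ?n = "max (degree f) (degree g)"
  have "degree (f + g) \<le> ?n" by (rule degree_add_le_max)
  then show ?thesis
    by (simp add: poly_functional_bound[of _ ?n] sum.distrib algebra_simps)
qed

lemma poly_functional_0: "poly_functional z 0 = 0"
  by (simp add: poly_functional_def)

lemma poly_functional_smult: "poly_functional z (smult a f) = a * poly_functional z f"
  by (simp add: poly_functional_bound[of _ "degree f"] degree_smult_le sum_distrib_left mult_ac)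

lemma poly_functional_sum: "poly_functional z (\<Sum>i\<in>I. f i) = (\<Sum>i\<in>I. poly_functional z (f i))"
  by (induction I rule: infinite_finite_induct) (auto simp: poly_functional_0 poly_functional_add)

lemma poly_functional_pCons: "poly_functional z (pCons a f) = a * z 0 + poly_functional (\<lambda>i. z (Suc i)) f"
proof -
  have "degree (pCons a f) \<le> Suc (degree f)" by (rule degree_pCons_le)
  then show ?thesis
    by (simp add: poly_functional_bound[of "pCons a f" "Suc (degree f)"] sum.atMost_Suc_shift
        poly_functional_def del: sum.atMost_Suc)
qed

lemma poly_functional_seq:
  "poly_functional (\<lambda>i. z i + z' i) f = poly_functional z f + poly_functional z' f"
  "poly_functional (\<lambda>i. a * z i) f = a * poly_functional z f"
  "poly_functional (\<lambda>i. \<Sum>j\<in>#\<mu>. w j i) f = (\<Sum>j\<in>#\<mu>. poly_functional (w j) f)"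
  by (simp add: poly_functional_def sum.distrib algebra_simps)
     (simp add: poly_functional_def sum_distrib_left mult_ac,
      induction \<mu>, simp_all add: poly_functional_def sum.distrib algebra_simps)

lemma poly_functional_monom: "poly_functional z (monom a n) = a * z n"
proof -
  have "poly_functional z (monom a n) = (\<Sum>i\<le>n. coeff (monom a n) i * z i)"
    by (rule poly_functional_bound) (rule degree_monom_le)
  also have "\<dots> = (\<Sum>i\<le>n. if i = n then a * z i else 0)"
    by (intro sum.cong) auto
  finally show ?thesis by simp
qed

text \<open>Marking the variable that carries a distinguished part, multiplication by that variable and
  by the sum of the other variables both preserve monomial positivity.\<close>

lemma monomial_state_hausdorff:
  assumes y: "monomial_state y" and \<mu>: "int_partition \<mu>"
  shows "0 \<le> poly_functional (\<lambda>i. y (add_mset (Suc i) \<mu>)) (monom 1 a * [:y {#1#}, -1:] ^ b)"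
  using \<mu>
proof (induction b arbitrary: \<mu>)
  case 0
  then show ?case using y by (simp add: poly_functional_monom monomial_state_nonneg)
next
  case (Suc b)
  let ?f = "monom 1 a * [:y {#1#}, -1:] ^ b"
  \<comment> \<open>The recursion for the part 1, with the term where 1 is added to the marked part
    \<open>Suc i\<close> moved to the left. The left side is then multiplication by c - x, with c
    the value at \<open>{#1#}\<close>, and on the right the marked part is untouched.\<close>
  have *: "y {#1#} * y (add_mset (Suc i) \<mu>) + - 1 * y (add_mset (Suc (Suc i)) \<mu>) =
      y (add_mset (Suc i) (add_mset 1 \<mu>)) +
      (\<Sum>j\<in>#\<mu>. y (add_mset (Suc i) (add_mset (Suc j) (\<mu> - {#j#}))))" for i
  proof -
    have "(\<Sum>j\<in>#\<mu>. y (add_mset (j + 1) (add_mset (Suc i) \<mu> - {#j#}))) =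
      (\<Sum>j\<in>#\<mu>. y (add_mset (Suc i) (add_mset (Suc j) (\<mu> - {#j#}))))"
      by (intro arg_cong[where f = sum_mset] image_mset_cong) (simp add: add_mset_commute)
    then show ?thesis
      using monomial_state_rec[OF y, of 1 "add_mset (Suc i) \<mu>"] Suc.prems
      by (simp add: add_mset_commute)
  qed
  have "monom 1 a * [:y {#1#}, -1:] ^ Suc b = smult (y {#1#}) ?f + smult (- 1) (pCons 0 ?f)"
    by (subst poly_eq_poly_eq_iff[symmetric]) (simp add: fun_eq_iff poly_monom algebra_simps)
  then have "poly_functional (\<lambda>i. y (add_mset (Suc i) \<mu>)) (monom 1 a * [:y {#1#}, -1:] ^ Suc b) =
      poly_functional (\<lambda>i. y {#1#} * y (add_mset (Suc i) \<mu>) + - 1 * y (add_mset (Suc (Suc i)) \<mu>)) ?f"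
    by (simp only: poly_functional_seq poly_functional_add poly_functional_smult poly_functional_pCons) simp
  also have "\<dots> = poly_functional (\<lambda>i. y (add_mset (Suc i) (add_mset 1 \<mu>))) ?f +
      (\<Sum>j\<in>#\<mu>. poly_functional (\<lambda>i. y (add_mset (Suc i) (add_mset (Suc j) (\<mu> - {#j#})))) ?f)"
    unfolding * poly_functional_seq ..
  also have "\<dots> \<ge> 0"
    using Suc.prems by (intro add_nonneg_nonneg sum_mset_nonneg Suc.IH) (auto intro: int_partition_diff)
  finally show ?case .
qed

text \<open>The second moment about t of a binomial average: squared bias plus variance.\<close>

lemma sum_square_Bernstein:
  assumes "0 < n"
  shows "(\<Sum>k\<le>n. (real k / real n - t)\<^sup>2 * Bernstein n k x) = (x - t)\<^sup>2 + x * (1 - x) / real n"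
proof -
  have "(\<Sum>k\<le>n. (real k / real n - t)\<^sup>2 * Bernstein n k x) =
      (\<Sum>k\<le>n. 1 / (real n)\<^sup>2 * (real k * (real k - 1) * Bernstein n k x) +
         (1 / (real n)\<^sup>2 - 2 * t / real n) * (real k * Bernstein n k x) + t\<^sup>2 * Bernstein n k x)"
    using assms by (intro sum.cong refl) (simp add: power2_eq_square field_simps)
  also have "\<dots> = 1 / (real n)\<^sup>2 * (real n * (real n - 1) * x\<^sup>2) +
      (1 / (real n)\<^sup>2 - 2 * t / real n) * (real n * x) + t\<^sup>2"
    by (simp only: sum.distrib sum_distrib_left[symmetric] sum_k_Bernstein sum_kk_Bernstein sum_Bernstein)
  also have "\<dots> = (x - t)\<^sup>2 + x * (1 - x) / real n"
    using assms by (simp add: power2_eq_square field_simps)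
  finally show ?thesis .
qed

text \<open>No measure is constructed. The functional sending x^i to \<open>y {#Suc i#}\<close> is
  nonnegative on the products x^a x^k (c - x)^(n - k). The Bernstein approximant of (x/c - s)^2,
  multiplied by x^a, is a nonnegative combination of these and differs from the exact polynomial by
  a fixed polynomial divided by n; the limit in n gives nonnegativity on the square.\<close>

lemma monomial_state_quadratic:
  assumes y: "monomial_state y" and c: "0 < y {#1#}"
  shows "0 \<le> t\<^sup>2 * y {#Suc a#} - 2 * t * y {#Suc (Suc a)#} + y {#Suc (Suc (Suc a))#}"
proof -
  define c where "c = y {#1#}"
  \<comment> \<open>Bernstein polynomials live on [0, 1] whereas the moments belong to [0, c]; so
    variable and target are both divided by c, and the factor c^2 is restored at the end.\<close>
  define s where "s = t / c"
  have c0: "0 < c" using c by (simp add: c_def)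
  let ?L = "poly_functional (\<lambda>i. y {#Suc i#})"
  let ?A = "monom 1 a * [:- s, 1 / c:] ^ 2" and ?B = "monom 1 a * ([:0, 1 / c:] * [:1, - 1 / c:])"
  have "0 \<le> ?L ?A + 1 / real (Suc m) * ?L ?B" for m
  proof -
    let ?n = "Suc m"
    have "poly (\<Sum>k\<le>?n. smult ((real k / real ?n - s)\<^sup>2 * real (?n choose k) / c ^ ?n)
        (monom 1 (a + k) * [:c, -1:] ^ (?n - k))) x = poly (?A + smult (1 / real ?n) ?B) x" for x
    proof -
      have e: "1 / c ^ ?n * (x ^ k * (c - x) ^ (?n - k)) = (x / c) ^ k * (1 - x / c) ^ (?n - k)"
        if "k \<le> ?n" for k
      proof -
        have "c ^ ?n = c ^ k * c ^ (?n - k)" using that by (metis le_add_diff_inverse power_add)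
        moreover have "1 - x / c = (c - x) / c" using c0 by (simp add: diff_divide_distrib)
        ultimately show ?thesis by (simp add: power_divide)
      qed
      have "poly (\<Sum>k\<le>?n. smult ((real k / real ?n - s)\<^sup>2 * real (?n choose k) / c ^ ?n)
        (monom 1 (a + k) * [:c, -1:] ^ (?n - k))) x =
        (\<Sum>k\<le>?n. x ^ a * ((real k / real ?n - s)\<^sup>2 * (real (?n choose k) * (1 / c ^ ?n * (x ^ k * (c - x) ^ (?n - k))))))"
        by (simp add: poly_sum poly_monom power_add mult_ac del: sum.atMost_Suc power_Suc of_nat_Suc)
      also have "\<dots> = x ^ a * (\<Sum>k\<le>?n. (real k / real ?n - s)\<^sup>2 * Bernstein ?n k (x / c))"
        unfolding sum_distrib_left Bernstein_def by (intro sum.cong refl) (simp only: e atMost_iff mult.assoc)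
      also have "\<dots> = x ^ a * ((x / c - s)\<^sup>2 + x / c * (1 - x / c) / real ?n)"
        by (subst sum_square_Bernstein) simp_all
      also have "\<dots> = poly (?A + smult (1 / real ?n) ?B) x"
        using c0 by (simp add: poly_monom power2_eq_square field_simps)
      finally show ?thesis .
    qed
    then have E: "(\<Sum>k\<le>?n. smult ((real k / real ?n - s)\<^sup>2 * real (?n choose k) / c ^ ?n)
        (monom 1 (a + k) * [:c, -1:] ^ (?n - k))) = ?A + smult (1 / real ?n) ?B"
      by (simp add: poly_eq_poly_eq_iff[symmetric] fun_eq_iff)
    have "?L ?A + 1 / real ?n * ?L ?B = (\<Sum>k\<le>?n. ((real k / real ?n - s)\<^sup>2 * real (?n choose k) / c ^ ?n) *
        ?L (monom 1 (a + k) * [:c, -1:] ^ (?n - k)))"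
      using arg_cong[OF E, of ?L, symmetric]
      by (simp only: poly_functional_add poly_functional_sum poly_functional_smult)
    also have "\<dots> \<ge> 0"
      using monomial_state_hausdorff[OF y, of "{#}"] c0
      by (intro sum_nonneg mult_nonneg_nonneg) (auto simp: c_def)
    finally show ?thesis .
  qed
  moreover have "(\<lambda>m. ?L ?A + 1 / real (Suc m) * ?L ?B) \<longlonglongrightarrow> ?L ?A + 0 * ?L ?B"
    by (intro tendsto_intros LIMSEQ_Suc[OF lim_1_over_n])
  ultimately have "0 \<le> ?L ?A"
    by (intro LIMSEQ_le_const[of "\<lambda>m. ?L ?A + 1 / real (Suc m) * ?L ?B"]) auto
  moreover have "?A = monom (s\<^sup>2) a + monom (- 2 * s / c) (Suc a) + monom (1 / c\<^sup>2) (Suc (Suc a))"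
    by (subst poly_eq_poly_eq_iff[symmetric]) 
       (simp add: fun_eq_iff poly_monom power2_eq_square algebra_simps)
  ultimately have "0 \<le> s\<^sup>2 * y {#Suc a#} + - 2 * s / c * y {#Suc (Suc a)#} + 1 / c\<^sup>2 * y {#Suc (Suc (Suc a))#}"
    by (simp only: poly_functional_add poly_functional_monom)
  then have "0 \<le> c\<^sup>2 * (s\<^sup>2 * y {#Suc a#} + - 2 * s / c * y {#Suc (Suc a)#} + 1 / c\<^sup>2 * y {#Suc (Suc (Suc a))#})"
    by (intro mult_nonneg_nonneg) auto
  also have "\<dots> = t\<^sup>2 * y {#Suc a#} - 2 * t * y {#Suc (Suc a)#} + y {#Suc (Suc (Suc a))#}"
    using c0 by (simp add: s_def power2_eq_square field_simps)
  finally show ?thesis .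
qed

lemma monomial_state_submult:
  assumes y: "monomial_state y" and "0 < j" "0 < k"
  shows "y {#j + k#} \<le> y {#j#} * y {#k#}"
  using monomial_state_rec[OF y, of k "{#j#}"] monomial_state_nonneg[OF y, of "{#k, j#}"] assms
  by (simp add: mult.commute)

lemma monomial_state_log_convex:
  assumes y: "monomial_state y"
  shows "(y {#Suc (Suc a)#})\<^sup>2 \<le> y {#Suc a#} * y {#Suc (Suc (Suc a))#}"
proof (cases "0 < y {#Suc a#}")
  case True
  have nn: "0 \<le> y {#Suc i#}" for i using monomial_state_nonneg[OF y, of "{#Suc i#}"] by simp
  have c: "0 < y {#1#}"
  proof (rule ccontr)
    assume "\<not> 0 < y {#1#}"
    then have "y {#1#} = 0" using nn[of 0] by simp
    then have "y {#Suc a#} \<le> 0"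
      using monomial_state_submult[OF y, of a 1] by (cases a) auto
    then show False using True by simp
  qed
  \<comment> \<open>The minimiser of the quadratic, where nonnegativity becomes the discriminant
    inequality.\<close>
  let ?t = "y {#Suc (Suc a)#} / y {#Suc a#}"
  have "0 \<le> y {#Suc a#} * (?t\<^sup>2 * y {#Suc a#} - 2 * ?t * y {#Suc (Suc a)#} + y {#Suc (Suc (Suc a))#})"
    by (intro mult_nonneg_nonneg nn monomial_state_quadratic[OF y c])
  also have "\<dots> = y {#Suc a#} * y {#Suc (Suc (Suc a))#} - (y {#Suc (Suc a)#})\<^sup>2"
    using True by (simp add: power2_eq_square field_simps)
  finally show ?thesis by simp
next
  case False
  then have "y {#Suc a#} = 0" using monomial_state_nonneg[OF y, of "{#Suc a#}"] by simp
  moreover have "y {#Suc (Suc a)#} = 0"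
    using monomial_state_submult[OF y, of "Suc a" 1] monomial_state_nonneg[OF y, of "{#Suc (Suc a)#}"]
      calculation by simp
  ultimately show ?thesis by simp
qed


section \<open>Removing the largest point\<close>

text \<open>Log-convexity forbids a positive value from being followed by 0 when its successor is
  positive: the square of the middle value bounds the product of its neighbours from below. Hence
  two consecutive values are carried through the induction.\<close>

lemma monomial_state_positive:
  assumes y: "monomial_state y" and p2: "0 < y {#2#}"
  shows "0 < y {#Suc k#}"
proof -
  have "0 < y {#Suc k#} \<and> 0 < y {#Suc (Suc k)#}"
  proof (induction k)
    case 0
    have "0 < y {#1#} * y {#1#}"
      using monomial_state_submult[OF y, of 1 1] p2 by (simp add: numeral_2_eq_2)
    then show ?case
      using p2 monomial_state_nonneg[OF y, of "{#1#}"] by (auto simp: numeral_2_eq_2 zero_less_mult_iff)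
  next
    case (Suc k)
    then have "0 < (y {#Suc (Suc k)#})\<^sup>2" by simp
    also have "\<dots> \<le> y {#Suc k#} * y {#Suc (Suc (Suc k))#}" by (rule monomial_state_log_convex[OF y])
    finally show ?case using Suc by (simp add: zero_less_mult_iff)
  qed
  then show ?thesis ..
qed

text \<open>For large \<open>k\<close> the part \<open>k\<close> in \<open>y (add_mset k \<mu>) / y {#k#}\<close> sits on the largest point
  \<open>q\<close>, so that the limit is the value at \<open>\<mu>\<close> of the state with this point removed.\<close>

lemma monomial_state_peel:
  assumes y: "monomial_state y"
  shows "\<exists>q z. monomial_state z \<and> 0 \<le> q \<and> (\<forall>k>0. z {#k#} = y {#k#} - q ^ k) \<and>
    (\<forall>k. y {#Suc k#} \<le> q ^ k * y {#1#})"
proof (cases "0 < y {#2#}")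
  case False
  have "y {#Suc k#} \<le> 0 ^ k * y {#1#}" for k
  proof (cases k rule: nat.exhaust[case_names 0 Suc])
    case (Suc l)
    have "y {#Suc k#} \<le> 0"
    proof (cases l)
      case 0
      then show ?thesis using False Suc by (simp add: numeral_2_eq_2)
    next
      case (Suc m)
      have "y {#Suc m + 2#} \<le> y {#Suc m#} * y {#2#}" by (rule monomial_state_submult[OF y]) auto
      also have "\<dots> \<le> 0"
        using False monomial_state_nonneg[OF y, of "{#Suc m#}"] by (simp add: mult_nonneg_nonpos)
      finally show ?thesis using \<open>k = Suc l\<close> Suc by simp
    qed
    then show ?thesis using Suc by simp
  qed simp
  \<comment> \<open>If p_2 = 0, then every p_k with k >= 2 vanishes: there are no points left, and
    peeling off the point 0 leaves the state as it is.\<close>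
  then show ?thesis using y by (intro exI[of _ 0] exI[of _ y]) simp
next
  case True
  note pos = monomial_state_positive[OF y True]
  define r where "r k = y {#Suc (Suc k)#} / y {#Suc k#}" for k
  have r_step: "r k \<le> r (Suc k)" for k
    using monomial_state_log_convex[OF y, of k] pos[of k] pos[of "Suc k"]
    by (simp add: r_def field_simps power2_eq_square)
  then have inc: "incseq r" by (rule incseq_SucI)
  have bound: "r k \<le> y {#1#}" for k
    using monomial_state_submult[OF y, of "Suc k" 1] pos[of k] by (simp add: r_def field_simps)
  obtain q where q: "r \<longlonglongrightarrow> q" "\<And>k. r k \<le> q"
    using incseq_convergent[OF inc] bound by blast
  have q0: "0 \<le> q" using q(2)[of 0] pos[of 0] pos[of 1] by (auto simp: r_def intro: order_trans[rotated])
  have le: "y {#Suc (Suc k)#} \<le> q * y {#Suc k#}" for k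
    using q(2)[of k] pos[of k] by (simp add: r_def field_simps)
  have le': "y {#Suc k#} \<le> q ^ k * y {#1#}" for k
  proof (induction k)
    case (Suc k)
    have "y {#Suc (Suc k)#} \<le> q * y {#Suc k#}" by (rule le)
    also have "\<dots> \<le> q * (q ^ k * y {#1#})" using Suc q0 by (rule mult_left_mono)
    finally show ?case by simp
  qed simp
  have ratio: "(\<lambda>n. y {#Suc n + k#} / y {#Suc n#}) \<longlonglongrightarrow> q ^ k" for k
  proof (induction k)
    case 0
    then show ?case using pos by (simp add: less_imp_neq[symmetric])
  next
    case (Suc k)
    have "(\<lambda>n. y {#Suc n + k#} / y {#Suc n#} * r (n + k)) \<longlonglongrightarrow> q ^ k * q"
      by (intro tendsto_mult Suc LIMSEQ_ignore_initial_segment q)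
    moreover have "y {#Suc n + k#} / y {#Suc n#} * r (n + k) = y {#Suc n + Suc k#} / y {#Suc n#}" for n
      using pos[of "n + k"] by (simp add: r_def)
    ultimately show ?case by (simp only: power_Suc2)
  qed
  \<comment> \<open>The recursion for \<mu> enlarged by the long part \<open>Suc n\<close>, divided
    by \<open>y {#Suc n#}\<close>. Adding k to the long part replaces n by n + k and costs a ratio
    that tends to \<open>q ^ k\<close>; this is the shifted term allowed in
    \<open>monomial_state_limit\<close>.\<close>
  have rec: "y {#k#} * (y (add_mset (Suc n) \<mu>) / y {#Suc n#}) =
      y (add_mset (Suc n) (add_mset k \<mu>)) / y {#Suc n#} +
      (\<Sum>j\<in>#\<mu>. y (add_mset (Suc n) (add_mset (j + k) (\<mu> - {#j#}))) / y {#Suc n#}) +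
      y {#Suc n + k#} / y {#Suc n#} * (y (add_mset (Suc (n + k)) \<mu>) / y {#Suc (n + k)#})"
    if k: "0 < k" and \<mu>: "int_partition \<mu>" for n k \<mu>
  proof -
    have "y {#k#} * y (add_mset (Suc n) \<mu>) = y (add_mset (Suc n) (add_mset k \<mu>)) +
        (y (add_mset (Suc n + k) \<mu>) + (\<Sum>j\<in>#\<mu>. y (add_mset (j + k) (add_mset (Suc n) \<mu> - {#j#}))))"
      using monomial_state_rec[OF y k, of "add_mset (Suc n) \<mu>"] \<mu> by (simp add: add_mset_commute)
    also have "(\<Sum>j\<in>#\<mu>. y (add_mset (j + k) (add_mset (Suc n) \<mu> - {#j#}))) =
        (\<Sum>j\<in>#\<mu>. y (add_mset (Suc n) (add_mset (j + k) (\<mu> - {#j#}))))"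
      by (intro arg_cong[where f = sum_mset] image_mset_cong) (simp add: add_mset_commute)
    finally have "y {#k#} * y (add_mset (Suc n) \<mu>) / y {#Suc n#} = 
        y (add_mset (Suc n) (add_mset k \<mu>)) / y {#Suc n#} + (y (add_mset (Suc n + k) \<mu>) / y {#Suc n#} +
        (\<Sum>j\<in>#\<mu>. y (add_mset (Suc n) (add_mset (j + k) (\<mu> - {#j#})))) / y {#Suc n#})"
      by (simp add: add_divide_distrib)
    moreover have "(\<Sum>j\<in>#\<mu>. f j) / a = (\<Sum>j\<in>#\<mu>. f j / a)" for f :: "nat \<Rightarrow> real" and a
      by (induction \<mu>) (simp_all add: add_divide_distrib)
    ultimately show ?thesis using pos[of "n + k"] by simp
  qed
  have "\<exists>z. monomial_state z \<and>
      (\<forall>\<mu>. int_partition \<mu> \<longrightarrow> (\<lambda>n. y (add_mset (Suc n) \<mu>) / y {#Suc n#}) \<longlonglongrightarrow> z \<mu>) \<and>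
      (\<forall>k>0. z {#k#} = y {#k#} - q ^ k)"
  proof (rule monomial_state_limit[where a = "\<lambda>_ k. y {#k#}" and b = "\<lambda>n k. y {#Suc n + k#} / y {#Suc n#}"])
    show "y {#Suc n#} / y {#Suc n#} = 1" for n using pos[of n] by simp
    show "0 \<le> y (add_mset (Suc n) \<mu>) / y {#Suc n#}" if "int_partition \<mu>" for n \<mu>
      using that pos[of n] monomial_state_nonneg[OF y, of "add_mset (Suc n) \<mu>"] by simp
  qed (use rec ratio in auto)
  then show ?thesis using q0 le' by blast
qed

text \<open>What remains after peeling n points is nonnegative, which at k = 1 bounds the partial
  sums of \<open>q\<close>. For k >= 2 the remainder is at most \<open>q n ^ (k - 1) * ?c\<close>
  and tends to 0; for k = 1 this bound does not shrink, and what is left is the dust.\<close>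

lemma monomial_state_classify:
  assumes y: "monomial_state y"
  obtains q where "(y {#1#}, q) \<in> KK" "\<And>k. 2 \<le> k \<Longrightarrow> (\<lambda>i. q i ^ k) sums y {#k#}"
proof -
  obtain Q Z where peel: "\<And>y. monomial_state y \<Longrightarrow> monomial_state (Z y) \<and> 0 \<le> Q y \<and>
      (\<forall>k>0. Z y {#k#} = y {#k#} - Q y ^ k) \<and> (\<forall>k. y {#Suc k#} \<le> Q y ^ k * y {#1#})"
    using monomial_state_peel by metis
  define w where "w n = (Z ^^ n) y" for n
  define q where "q n = Q (w n)" for n
  have w: "monomial_state (w n)" for n
    by (induction n) (use y peel in \<open>auto simp: w_def\<close>)
  have w_Suc: "w (Suc n) = Z (w n)" for n by (simp add: w_def)
  have q0: "0 \<le> q n" for n using peel[OF w] by (simp add: q_def)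
  have step: "w (Suc n) {#k#} = w n {#k#} - q n ^ k" if "0 < k" for n k
    using peel[OF w] that by (simp add: q_def w_Suc)
  have wk: "w n {#k#} = y {#k#} - (\<Sum>i<n. q i ^ k)" if "0 < k" for n k
    by (induction n) (use step that in \<open>auto simp: w_def\<close>)
  have nn: "0 \<le> w n {#k#}" if "0 < k" for n k
    using monomial_state_nonneg[OF w, of "{#k#}"] that by simp
  let ?c = "y {#1#}"
  have wc: "w n {#1#} \<le> ?c" for n using wk[of 1 n] q0 by (simp add: sum_nonneg)
  have up: "w n {#Suc k#} \<le> q n ^ k * ?c" for n k
  proof -
    have "w n {#Suc k#} \<le> q n ^ k * w n {#1#}" using peel[OF w] by (simp add: q_def)
    also have "\<dots> \<le> q n ^ k * ?c" using wc q0 by (intro mult_left_mono) auto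
    finally show ?thesis .
  qed
  \<comment> \<open>Each point is only the limit of ratios of its own remainder, so the order is not
    built in. A larger later point is already contained in the earlier remainder, whence
    \<open>q (Suc n) ^ Suc k\<close> would be at most \<open>q n ^ k * ?c\<close> for all k, against
    geometric growth.\<close>
  have dec: "q (Suc n) \<le> q n" for n
  proof (rule ccontr)
    assume "\<not> q (Suc n) \<le> q n"
    then have lt: "q n < q (Suc n)" by simp
    have le: "q (Suc n) ^ Suc k \<le> q n ^ k * ?c" for k
    proof -
      have "q (Suc n) ^ Suc k \<le> w (Suc n) {#Suc k#}"
        using step[of "Suc k" "Suc n"] nn[of "Suc k" "Suc (Suc n)"] by simp
      also have "\<dots> \<le> w n {#Suc k#}" using step[of "Suc k" n] q0[of n] by simp
      also have "\<dots> \<le> q n ^ k * ?c" by (rule up)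
      finally show ?thesis .
    qed
    show False
    proof (cases "q n = 0")
      case True
      then have "q (Suc n) * q (Suc n) \<le> 0" using le[of 1] by simp
      moreover have "0 < q (Suc n) * q (Suc n)" using lt True by (intro mult_pos_pos) simp_all
      ultimately show ?thesis by linarith
    next
      case False
      then have qn: "0 < q n" using q0[of n] by simp
      then have "1 < q (Suc n) / q n" using lt by simp
      then obtain k where k: "?c / q (Suc n) < (q (Suc n) / q n) ^ k"
        using real_arch_pow by blast
      have "q n ^ k * ?c < q (Suc n) ^ Suc k"
        using k lt qn by (simp add: field_simps)
      then show False using le[of k] by simp
    qed
  qed
  have partial: "(\<Sum>i<n. q i) \<le> ?c" for n using wk[of 1 n] nn[of 1 n] by simp
  have summ: "summable q"
    by (rule summableI_nonneg_bounded[OF q0 partial])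
  have "q \<longlonglongrightarrow> 0" by (rule summable_LIMSEQ_zero[OF summ])
  have "(\<lambda>i. q i ^ k) sums y {#k#}" if k: "2 \<le> k" for k
  proof -
    have "(\<lambda>n. q n ^ (k - 1) * ?c) \<longlonglongrightarrow> 0 ^ (k - 1) * ?c"
      by (intro tendsto_mult tendsto_power tendsto_const) fact
    then have lim0: "(\<lambda>n. q n ^ (k - 1) * ?c) \<longlonglongrightarrow> 0" using k by (simp add: power_0_left)
    have "(\<lambda>n. w n {#k#}) \<longlonglongrightarrow> 0"
      by (rule tendsto_sandwich[OF _ _ tendsto_const lim0])
         (use up[of _ "k - 1"] nn k in auto)
    then have "(\<lambda>n. y {#k#} - w n {#k#}) \<longlonglongrightarrow> y {#k#} - 0" by (intro tendsto_diff tendsto_const)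
    then show ?thesis using wk k by (simp add: sums_def)
  qed
  moreover have "(?c, q) \<in> KK"
    using q0 summ partial monomial_state_nonneg[OF y, of "{#1#}"] decseq_SucI[of q, OF dec]
    by (auto simp: KK_def intro: suminf_le_const)
  ultimately show thesis using that by blast
qed


section \<open>Symmetric functions\<close>

definition aug_factor :: "nat multiset \<Rightarrow> real" where
  "aug_factor \<mu> = (\<Prod>j\<in>set_mset \<mu>. fact (count \<mu> j))"

lemma aug_factor_add: "aug_factor (add_mset k \<mu>) = aug_factor \<mu> * real (count \<mu> k + 1)"
proof -
  have "(\<Prod>j\<in>insert k (set_mset \<mu>) - {k}. fact (count (add_mset k \<mu>) j)) =
      (\<Prod>j\<in>set_mset \<mu> - {k}. fact (count \<mu> j) :: real)"
    by (intro prod.cong) auto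
  then have "aug_factor (add_mset k \<mu>) = fact (Suc (count \<mu> k)) * (\<Prod>j\<in>set_mset \<mu> - {k}. fact (count \<mu> j))"
    unfolding aug_factor_def by (subst prod.remove[of _ k]) auto
  moreover have "aug_factor \<mu> = fact (count \<mu> k) * (\<Prod>j\<in>set_mset \<mu> - {k}. fact (count \<mu> j))"
  proof (cases "k \<in># \<mu>")
    case True
    then show ?thesis unfolding aug_factor_def by (subst prod.remove[of _ k]) auto
  next
    case False
    then show ?thesis unfolding aug_factor_def by (simp add: not_in_iff)
  qed
  ultimately show ?thesis by simp
qed

lemma aug_factor_pos: "0 < aug_factor \<mu>"
  unfolding aug_factor_def by (rule prod_pos) simp

lemma sym_coeff_aug: "sym_coeff (aug_monomial_sym \<mu>) m = (if exponents m = \<mu> then aug_factor \<mu> else 0)"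
  by (simp add: aug_monomial_sym_def scaleR_symfun.rep_eq monomial_sym.rep_eq aug_factor_def)

lemma exponents_partition: "int_partition (exponents m)"
  by (auto simp: int_partition_def exponents_def count_eq_zero_iff)

lemma exponents_eqD:
  assumes "exponents m = exponents m'"
  obtains \<pi> where "bij \<pi>" "image_mset \<pi> m = m'"
proof -
  let ?A = "set_mset m \<union> set_mset m'"
  \<comment> \<open>Exponents are padded by zeros on the union of the two supports; both monomials
    get equally many zeros, and one permutation of this finite set matches all exponents.\<close>
  have ext: "image_mset (count a) (mset_set A) = exponents a + replicate_mset (card A - card (set_mset a)) 0"
    if A: "finite A" "set_mset a \<subseteq> A" for a A
  proof -
    have "mset_set A = mset_set (set_mset a) + mset_set (A - set_mset a)"
      using A by (metis Diff_disjoint Diff_partition finite_Diff finite_set_mset mset_set_Union)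
    moreover have "image_mset (count a) (mset_set (A - set_mset a)) = image_mset (\<lambda>_. 0) (mset_set (A - set_mset a))"
      using A by (intro image_mset_cong) (auto simp: not_in_iff)
    ultimately show ?thesis
      using A by (simp add: exponents_def image_mset_const_eq card_Diff_subset)
  qed
  have size: "size (exponents a) = card (set_mset a)" for a
    by (simp add: exponents_def)
  have "card (set_mset m) = card (set_mset m')"
    using size[of m] size[of m'] assms by simp
  then have "image_mset (count m) (mset_set ?A) = image_mset (count m') (mset_set ?A)"
    using ext[of ?A m] ext[of ?A m'] assms by simp
  then obtain \<pi> where \<pi>: "\<pi> permutes ?A" "\<forall>x\<in>?A. count m x = count m' (\<pi> x)"
    using image_mset_eq_implies_permutes[of ?A "count m" "count m'"] by auto
  have out: "count m x = count m' (\<pi> x)" for x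
  proof (cases "x \<in> ?A")
    case False
    then have "\<pi> x = x" using \<pi>(1) by (meson permutes_not_in)
    then show ?thesis using False by (simp add: not_in_iff)
  qed (use \<pi>(2) in blast)
  have bij: "bij \<pi>" using \<pi>(1) by (rule permutes_bij)
  have "count (image_mset \<pi> m) y = count m' y" for y
  proof -
    obtain x where x: "y = \<pi> x" using bij by (metis bij_pointE)
    have "count (image_mset \<pi> m) (\<pi> x) = count m x"
      using bij_is_inj[OF bij] by (induction m) (auto simp: inj_eq)
    then show ?thesis using out x by simp
  qed
  then have "image_mset \<pi> m = m'" by (rule multiset_eqI)
  with bij show thesis using that by blast
qed

lemma sym_coeff_exponents:
  assumes "exponents m = exponents m'"
  shows "sym_coeff f m = sym_coeff f m'"
  using exponents_eqD[OF assms] sym_coeff[of f] by (metis (mono_tags, lifting) mem_Collect_eq)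

definition multiset_of_exponents :: "nat multiset \<Rightarrow> nat multiset" where
  "multiset_of_exponents \<mu> = (SOME m. exponents m = \<mu>)"

lemma exponents_multiset_of_exponents:
  assumes "int_partition \<mu>"
  shows "exponents (multiset_of_exponents \<mu>) = \<mu>"
proof -
  obtain ls where ls: "mset ls = \<mu>" using ex_mset by blast
  have pos: "0 < ls ! i" if "i < length ls" for i
    using assms nth_mem[OF that] by (auto simp: int_partition_def simp flip: ls intro: gr0I)
  let ?m = "\<Sum>i<length ls. replicate_mset (ls ! i) i"
  have c: "count ?m i = (if i < length ls then ls ! i else 0)" for i
    by (simp add: count_sum sum.delta cong: if_cong)
  have s: "set_mset ?m = {..<length ls}"
    using pos c by (auto simp: set_mset_def split: if_splits)
  have "exponents ?m = image_mset ((!) ls) (mset_set {..<length ls})"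
    unfolding exponents_def s by (intro image_mset_cong) (simp add: c)
  also have "\<dots> = \<mu>" unfolding ls[symmetric] by (metis lessThan_atLeast0 map_nth mset_map mset_upt)
  finally have "exponents ?m = \<mu>" .
  then show ?thesis unfolding multiset_of_exponents_def by (rule someI)
qed

text \<open>The coefficient of an augmented monomial function in \<open>f\<close>, read off at one
  monomial with these exponents. The value 0 off partitions keeps the support finite.\<close>

definition partition_coeff :: "symfun \<Rightarrow> nat multiset \<Rightarrow> real" where
  "partition_coeff f \<mu> = (if int_partition \<mu> then sym_coeff f (multiset_of_exponents \<mu>) / aug_factor \<mu> else 0)"

lemma partition_coeff_linear:
  "partition_coeff (f + g) \<mu> = partition_coeff f \<mu> + partition_coeff g \<mu>"
  "partition_coeff (r *\<^sub>R f) \<mu> = r * partition_coeff f \<mu>"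
  by (simp_all add: partition_coeff_def plus_symfun.rep_eq scaleR_symfun.rep_eq add_divide_distrib)

lemma partition_coeff_aug:
  "int_partition \<mu> \<Longrightarrow> partition_coeff (aug_monomial_sym \<mu>) \<nu> = (if \<nu> = \<mu> then 1 else 0)"
  using aug_factor_pos[of \<mu>]
  by (auto simp: partition_coeff_def sym_coeff_aug exponents_multiset_of_exponents)

lemma finite_partition_coeff: "finite {\<mu>. partition_coeff f \<mu> \<noteq> 0}"
proof -
  obtain d where d: "\<And>m. d < size m \<Longrightarrow> sym_coeff f m = 0"
    using sym_coeff[of f] by auto
  have "{\<mu>. partition_coeff f \<mu> \<noteq> 0} \<subseteq> mset ` {xs. set xs \<subseteq> {..d} \<and> length xs \<le> d}"
  proof
    fix \<mu> assume \<mu>: "\<mu> \<in> {\<mu>. partition_coeff f \<mu> \<noteq> 0}"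
    then have p: "int_partition \<mu>" by (auto simp: partition_coeff_def split: if_splits)
    have sz: "sum_mset (exponents m) = size m" for m
      unfolding exponents_def by (simp add: size_multiset_overloaded_eq sum_unfold_sum_mset)
    have "size (multiset_of_exponents \<mu>) \<le> d"
      using \<mu> d by (force simp: partition_coeff_def split: if_splits)
    then have s: "sum_mset \<mu> \<le> d" using sz exponents_multiset_of_exponents[OF p] by metis
    obtain xs where xs: "mset xs = \<mu>" using ex_mset by blast
    have sl: "sum_list xs \<le> d" using s unfolding xs[symmetric] sum_mset_sum_list .
    have "x \<le> d" if "x \<in> set xs" for x
      using member_le_sum_list[of x xs] that sl by simp
    moreover have "length xs \<le> sum_list xs"
    proof -
      have "0 \<notin> set xs" using p xs by (auto simp: int_partition_def)
      then show ?thesis by (induction xs) auto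
    qed
    ultimately show "\<mu> \<in> mset ` {xs. set xs \<subseteq> {..d} \<and> length xs \<le> d}"
      using sl xs by (intro image_eqI[of _ _ xs]) auto
  qed
  then show ?thesis by (rule finite_subset) (intro finite_imageI finite_lists_length_le, simp)
qed

lemma symfun_expansion:
  "f = (\<Sum>\<mu> | partition_coeff f \<mu> \<noteq> 0. partition_coeff f \<mu> *\<^sub>R aug_monomial_sym \<mu>)"
proof -
  have sum: "sym_coeff (\<Sum>\<mu>\<in>S. h \<mu>) m = (\<Sum>\<mu>\<in>S. sym_coeff (h \<mu>) m)" for S m and h :: "nat multiset \<Rightarrow> symfun"
    by (induction S rule: infinite_finite_induct) (auto simp: zero_symfun.rep_eq plus_symfun.rep_eq)
  have "sym_coeff f m = sym_coeff (\<Sum>\<mu> | partition_coeff f \<mu> \<noteq> 0. partition_coeff f \<mu> *\<^sub>R aug_monomial_sym \<mu>) m" for m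
  proof -
    let ?e = "exponents m"
    have "sym_coeff (\<Sum>\<mu> | partition_coeff f \<mu> \<noteq> 0. partition_coeff f \<mu> *\<^sub>R aug_monomial_sym \<mu>) m =
        (\<Sum>\<mu> | partition_coeff f \<mu> \<noteq> 0. if \<mu> = ?e then partition_coeff f ?e * aug_factor ?e else 0)"
      unfolding sum scaleR_symfun.rep_eq sym_coeff_aug by (intro sum.cong) auto
    also have "\<dots> = partition_coeff f ?e * aug_factor ?e"
      using finite_partition_coeff[of f] by (simp add: sum.delta)
    also have "\<dots> = sym_coeff f m"
      using aug_factor_pos[of ?e] exponents_partition[of m]
        sym_coeff_exponents[OF exponents_multiset_of_exponents[OF exponents_partition[of m]], of f]
      by (simp add: partition_coeff_def)
    finally show ?thesis by simp
  qed
  then show ?thesis by (intro sym_coeff_inject[THEN iffD1] ext)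
qed

lemma linear_symfun_eqI:
  fixes \<phi> \<psi> :: "symfun \<Rightarrow> 'a::real_vector"
  assumes "linear \<phi>" "linear \<psi>" "\<And>\<mu>. int_partition \<mu> \<Longrightarrow> \<phi> (aug_monomial_sym \<mu>) = \<psi> (aug_monomial_sym \<mu>)"
  shows "\<phi> f = \<psi> f"
proof -
  have "partition_coeff f \<mu> *\<^sub>R \<phi> (aug_monomial_sym \<mu>) = partition_coeff f \<mu> *\<^sub>R \<psi> (aug_monomial_sym \<mu>)" for \<mu>
    using assms(3)[of \<mu>] by (auto simp: partition_coeff_def)
  then show ?thesis
    by (subst (1 2) symfun_expansion[of f]) (simp only: linear_sum[OF assms(1)] linear_sum[OF assms(2)]
        linear_scale[OF assms(1)] linear_scale[OF assms(2)])
qed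

definition symfun_linear :: "(nat multiset \<Rightarrow> real) \<Rightarrow> symfun \<Rightarrow> real" where
  "symfun_linear y f = (\<Sum>\<mu> | partition_coeff f \<mu> \<noteq> 0. partition_coeff f \<mu> * y \<mu>)"

lemma symfun_linear_superset:
  "finite S \<Longrightarrow> {\<mu>. partition_coeff f \<mu> \<noteq> 0} \<subseteq> S \<Longrightarrow> symfun_linear y f = (\<Sum>\<mu>\<in>S. partition_coeff f \<mu> * y \<mu>)"
  unfolding symfun_linear_def by (rule sum.mono_neutral_left) auto

lemma linear_symfun_linear: "linear (symfun_linear y)"
proof (rule linearI)
  fix f g r
  let ?S = "{\<mu>. partition_coeff f \<mu> \<noteq> 0} \<union> {\<mu>. partition_coeff g \<mu> \<noteq> 0}"
  have fin: "finite ?S" by (simp add: finite_partition_coeff)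
  show "symfun_linear y (f + g) = symfun_linear y f + symfun_linear y g"
    by (subst (1 2 3) symfun_linear_superset[OF fin])
      (auto simp: partition_coeff_linear sum.distrib algebra_simps)
  show "symfun_linear y (r *\<^sub>R f) = r *\<^sub>R symfun_linear y f"
    by (subst (1 2) symfun_linear_superset[OF fin])
      (auto simp: partition_coeff_linear sum_distrib_left mult.assoc)
qed

lemma symfun_linear_aug: "int_partition \<mu> \<Longrightarrow> symfun_linear y (aug_monomial_sym \<mu>) = y \<mu>"
  by (subst symfun_linear_superset[of "{\<mu>}"]) (auto simp: partition_coeff_aug)

section \<open>Product of a power sum and an augmented monomial function\<close>

lemma sum_mset_count: "(\<Sum>x\<in>#M. f x) = (\<Sum>x\<in>set_mset M. real (count M x) * f x)"
proof (induction M)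
  case (add x M)
  have "(\<Sum>y\<in>set_mset (add_mset x M). real (count (add_mset x M) y) * f y) =
     (\<Sum>y\<in>insert x (set_mset M). real (count M y) * f y + (if y = x then f x else 0))"
    by (intro sum.cong) (auto simp: algebra_simps)
  also have "\<dots> = (\<Sum>y\<in>insert x (set_mset M). real (count M y) * f y) + f x"
    by (simp add: sum.distrib sum.delta)
  also have "(\<Sum>y\<in>insert x (set_mset M). real (count M y) * f y) = (\<Sum>y\<in>set_mset M. real (count M y) * f y)"
    by (rule sum.mono_neutral_right) (auto simp: not_in_iff)
  finally show ?case using add by simp
qed simp

text \<open>\<open>A \<mu> \<nu>\<close> is the coefficient of the augmented monomial function of
  \<mu> at a monomial with exponents \<nu>. On the left, p_k takes k off some exponent e of \<nu>.
  If e = k, then k was a separate new part; if e > k, it was added to the part e - k of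
  \<mu>.\<close>

lemma aug_recursion_partition:
  fixes A :: "nat multiset \<Rightarrow> nat multiset \<Rightarrow> real"
  assumes A: "\<And>\<mu> \<nu>. A \<mu> \<nu> = (if \<nu> = \<mu> then aug_factor \<mu> else 0)"
    and k: "0 < k" and \<mu>: "int_partition \<mu>"
  shows "(\<Sum>e\<in>#\<nu>. if e < k then 0 else A \<mu> (if e = k then \<nu> - {#k#} else add_mset (e - k) (\<nu> - {#e#}))) =
    A (add_mset k \<mu>) \<nu> + (\<Sum>j\<in>#\<mu>. A (add_mset (j + k) (\<mu> - {#j#})) \<nu>)"
proof -
  let ?f = "\<lambda>e. if e < k then 0 else A \<mu> (if e = k then \<nu> - {#k#} else add_mset (e - k) (\<nu> - {#e#}))"
  let ?g = "\<lambda>e. if e \<le> k then 0 else A \<mu> (add_mset (e - k) (\<nu> - {#e#}))"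
  have "(\<Sum>e\<in>#\<nu>. ?f e) = (\<Sum>e\<in>set_mset \<nu>. real (count \<nu> e) * ?f e)" by (rule sum_mset_count)
  also have "\<dots> = (\<Sum>e\<in>set_mset \<nu>. (if e = k then real (count \<nu> k) * A \<mu> (\<nu> - {#k#}) else 0) + real (count \<nu> e) * ?g e)"
    by (intro sum.cong) auto
  also have "\<dots> = real (count \<nu> k) * A \<mu> (\<nu> - {#k#}) + (\<Sum>e\<in>set_mset \<nu>. real (count \<nu> e) * ?g e)"
    by (simp add: sum.distrib sum.delta not_in_iff)
  also have "real (count \<nu> k) * A \<mu> (\<nu> - {#k#}) = A (add_mset k \<mu>) \<nu>"
  proof (cases "k \<in># \<nu>")
    case True
    then obtain \<rho> where "\<nu> = add_mset k \<rho>" by (metis insert_DiffM)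
    then show ?thesis by (simp add: A aug_factor_add)
  qed (auto simp: A not_in_iff)
  also have "(\<Sum>e\<in>set_mset \<nu>. real (count \<nu> e) * ?g e) =
      (\<Sum>e | e \<in># \<nu> \<and> k < e \<and> add_mset (e - k) (\<nu> - {#e#}) = \<mu>. real (count \<nu> e) * aug_factor \<mu>)"
    by (rule sum.mono_neutral_cong_right) (auto simp: A)
  \<comment> \<open>The bijection is j = e - k. With \<rho> the parts common to both partitions,
    either weight is \<open>aug_factor \<rho>\<close> times the multiplicities of e and of e - k in
    \<rho>, each increased by 1. This balance is what the factorials are for.\<close>
  also have "\<dots> = (\<Sum>j | j \<in># \<mu> \<and> add_mset (j + k) (\<mu> - {#j#}) = \<nu>. real (count \<mu> j) * aug_factor \<nu>)"
  proof (rule sum.reindex_bij_witness[where i = "\<lambda>j. j + k" and j = "\<lambda>e. e - k"])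
    fix e assume "e \<in> {e. e \<in># \<nu> \<and> k < e \<and> add_mset (e - k) (\<nu> - {#e#}) = \<mu>}"
    then have e: "e \<in># \<nu>" "k < e" "add_mset (e - k) (\<nu> - {#e#}) = \<mu>" by auto
    then obtain \<rho> where \<rho>: "\<nu> = add_mset e \<rho>" by (metis insert_DiffM)
    then have \<mu>': "\<mu> = add_mset (e - k) \<rho>" using e by simp
    show "e - k + k = e" using e by simp
    show "e - k \<in> {j. j \<in># \<mu> \<and> add_mset (j + k) (\<mu> - {#j#}) = \<nu>}"
      using e \<rho> \<mu>' by simp
    show "real (count \<mu> (e - k)) * aug_factor \<nu> = real (count \<nu> e) * aug_factor \<mu>"
      by (simp add: \<rho> \<mu>' aug_factor_add)
  next
    fix j assume "j \<in> {j. j \<in># \<mu> \<and> add_mset (j + k) (\<mu> - {#j#}) = \<nu>}"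
    then have j: "j \<in># \<mu>" "\<nu> = add_mset (j + k) (\<mu> - {#j#})" by auto
    have "0 < j" using j \<mu> by (auto simp: int_partition_def intro: gr0I)
    then show "j + k \<in> {e. e \<in># \<nu> \<and> k < e \<and> add_mset (e - k) (\<nu> - {#e#}) = \<mu>}"
      using j by simp
  qed simp
  also have "\<dots> = (\<Sum>j\<in>set_mset \<mu>. real (count \<mu> j) * A (add_mset (j + k) (\<mu> - {#j#})) \<nu>)"
    by (rule sum.mono_neutral_cong_left) (auto simp: A)
  also have "\<dots> = (\<Sum>j\<in>#\<mu>. A (add_mset (j + k) (\<mu> - {#j#})) \<nu>)" by (rule sum_mset_count[symmetric])
  finally show ?thesis .
qed

lemma power_sum_mult_aug:
  assumes k: "0 < k" and \<mu>: "int_partition \<mu>"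
  shows "power_sum k * aug_monomial_sym \<mu> =
    aug_monomial_sym (add_mset k \<mu>) + (\<Sum>j\<in>#\<mu>. aug_monomial_sym (add_mset (j + k) (\<mu> - {#j#})))"
proof -
  define A where "A \<mu> \<nu> = (if \<nu> = \<mu> then aug_factor \<mu> else 0)" for \<mu> \<nu>
  have "sym_coeff (power_sum k * aug_monomial_sym \<mu>) m =
      sym_coeff (aug_monomial_sym (add_mset k \<mu>) + (\<Sum>j\<in>#\<mu>. aug_monomial_sym (add_mset (j + k) (\<mu> - {#j#})))) m" for m
  proof -
    let ?J = "{i \<in> set_mset m. k \<le> count m i}"
    have inj: "inj_on (replicate_mset k) ?J"
      using k by (auto simp: inj_on_def replicate_mset_eq_iff)
    have sub: "replicate_mset k ` ?J \<subseteq> {a. a \<subseteq># m}"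
      by (auto simp: count_le_replicate_mset_subset_eq[symmetric])
    have "sym_coeff (power_sum k * aug_monomial_sym \<mu>) m =
        (\<Sum>a | a \<subseteq># m. (if \<exists>i. a = replicate_mset k i then 1 else 0) * A \<mu> (exponents (m - a)))"
      by (simp add: times_symfun.rep_eq power_sum.rep_eq sym_coeff_aug A_def)
    also have "\<dots> = (\<Sum>a\<in>replicate_mset k ` ?J. A \<mu> (exponents (m - a)))"
    proof (rule sum.mono_neutral_cong_right[OF finite_submultisets sub])
      show "\<forall>a\<in>{a. a \<subseteq># m} - replicate_mset k ` ?J.
          (if \<exists>i. a = replicate_mset k i then 1 else 0) * A \<mu> (exponents (m - a)) = 0"
        using k by (auto simp: count_le_replicate_mset_subset_eq[symmetric] count_greater_zero_iff[symmetric]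
            simp del: count_greater_zero_iff)
    qed auto
    also have "\<dots> = (\<Sum>i\<in>?J. A \<mu> (exponents (m - replicate_mset k i)))"
      by (simp add: sum.reindex[OF inj])
    also have "\<dots> = (\<Sum>i\<in>set_mset m. if count m i < k then 0 else
        A \<mu> (if count m i = k then exponents m - {#k#} else add_mset (count m i - k) (exponents m - {#count m i#})))"
    proof (rule sum.mono_neutral_cong_left)
      fix i assume i: "i \<in> ?J"
      let ?R = "image_mset (count m) (mset_set (set_mset m - {i}))"
      have em: "exponents m = add_mset (count m i) ?R"
        unfolding exponents_def using i
        by (metis (no_types, lifting) finite_set_mset image_mset_add_mset mem_Collect_eq mset_set.remove)
      have R': "image_mset (count (m - replicate_mset k i)) (mset_set (set_mset m - {i})) = ?R"
        by (intro image_mset_cong) auto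
      \<comment> \<open>An exponent lowered to 0 leaves the list of exponents altogether, hence the
        separate case.\<close>
      have "exponents (m - replicate_mset k i) = (if count m i = k then ?R else add_mset (count m i - k) ?R)"
      proof (cases "count m i = k")
        case True
        then have "set_mset (m - replicate_mset k i) = set_mset m - {i}"
          by (auto simp: set_mset_def simp del: count_greater_zero_iff)
        then show ?thesis using True R' by (simp add: exponents_def)
      next
        case False
        then have "set_mset (m - replicate_mset k i) = insert i (set_mset m - {i})"
          using i by (auto simp: set_mset_def simp del: count_greater_zero_iff)
        then have "mset_set (set_mset (m - replicate_mset k i)) = add_mset i (mset_set (set_mset m - {i}))"
          using mset_set.insert[of "set_mset m - {i}" i] by simp
        then show ?thesis using False R' by (simp add: exponents_def)
      qed
      then show "A \<mu> (exponents (m - replicate_mset k i)) = (if count m i < k then 0 else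
        A \<mu> (if count m i = k then exponents m - {#k#} else add_mset (count m i - k) (exponents m - {#count m i#})))"
        using i em by auto
    qed auto
    also have "\<dots> = (\<Sum>e\<in>#exponents m. if e < k then 0 else
        A \<mu> (if e = k then exponents m - {#k#} else add_mset (e - k) (exponents m - {#e#})))"
      unfolding sum_unfold_sum_mset by (simp add: exponents_def multiset.map_comp comp_def)
    also have "\<dots> = A (add_mset k \<mu>) (exponents m) + (\<Sum>j\<in>#\<mu>. A (add_mset (j + k) (\<mu> - {#j#})) (exponents m))"
      by (rule aug_recursion_partition[OF A_def k \<mu>])
    also have "\<dots> = sym_coeff (aug_monomial_sym (add_mset k \<mu>) +
        (\<Sum>j\<in>#\<mu>. aug_monomial_sym (add_mset (j + k) (\<mu> - {#j#})))) m"
    proof -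
      have "sym_coeff (\<Sum>j\<in>#\<nu>. aug_monomial_sym (h j)) m = (\<Sum>j\<in>#\<nu>. A (h j) (exponents m))" for \<nu> :: "nat multiset" and h
        by (induction \<nu>) (auto simp: zero_symfun.rep_eq plus_symfun.rep_eq sym_coeff_aug A_def)
      then show ?thesis by (simp add: plus_symfun.rep_eq sym_coeff_aug A_def)
    qed
    finally show ?thesis .
  qed
  then show ?thesis by (intro sym_coeff_inject[THEN iffD1] ext)
qed

lemma aug_empty: "aug_monomial_sym {#} = 1"
proof (intro sym_coeff_inject[THEN iffD1] ext)
  show "sym_coeff (aug_monomial_sym {#}) m = sym_coeff 1 m" for m
    by (auto simp: sym_coeff_aug one_symfun.rep_eq aug_factor_def exponents_def mset_set_empty_iff)
qed

lemma power_sum_aug: "0 < k \<Longrightarrow> power_sum k = aug_monomial_sym {#k#}"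
  using power_sum_mult_aug[of k "{#}"] by (simp add: aug_empty)

lemma linear_sum_mset:
  assumes "linear \<phi>"
  shows "\<phi> (\<Sum>j\<in>#\<mu>. f j) = (\<Sum>j\<in>#\<mu>. \<phi> (f j))"
  by (induction \<mu>) (simp_all add: linear_0[OF assms] linear_add[OF assms])

section \<open>The evaluation homomorphisms\<close>

lemma symfun_hom_aug:
  assumes y: "monomial_state y" and \<phi>: "linear \<phi>" "\<phi> 1 = 1" "\<And>f g. \<phi> (f * g) = \<phi> f * \<phi> g"
    "\<And>k. 0 < k \<Longrightarrow> \<phi> (power_sum k) = y {#k#}" and \<mu>: "int_partition \<mu>"
  shows "\<phi> (aug_monomial_sym \<mu>) = y \<mu>"
  using \<mu>
proof (induction rule: partition_induct)
  case empty
  then show ?case using \<phi> y by (simp add: aug_empty monomial_state_empty)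
next
  case (add k \<mu>)
  have "y {#k#} * y \<mu> = \<phi> (power_sum k * aug_monomial_sym \<mu>)" using add \<phi> by simp
  also have "\<dots> = \<phi> (aug_monomial_sym (add_mset k \<mu>)) + (\<Sum>j\<in>#\<mu>. \<phi> (aug_monomial_sym (add_mset (j + k) (\<mu> - {#j#}))))"
    using add by (simp add: power_sum_mult_aug linear_add[OF \<phi>(1)] linear_sum_mset[OF \<phi>(1)])
  also have "(\<Sum>j\<in>#\<mu>. \<phi> (aug_monomial_sym (add_mset (j + k) (\<mu> - {#j#})))) =
      (\<Sum>j\<in>#\<mu>. y (add_mset (j + k) (\<mu> - {#j#})))"
    using add by (intro arg_cong[where f = sum_mset] image_mset_cong) auto
  finally show ?case using monomial_state_rec[OF y add(1,2)] by simp
qed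

text \<open>The recursion of \<open>y\<close> is multiplicativity when the left factor is a power
  sum. Induction over partitions extends this to augmented monomial functions on the left; the right
  factor \<open>g\<close> stays universally quantified, because the power sum rule is applied to
  products with \<open>g\<close>.\<close>

lemma symfun_linear_mult:
  assumes y: "monomial_state y"
  shows "symfun_linear y (f * g) = symfun_linear y f * symfun_linear y g"
proof -
  let ?L = "symfun_linear y"
  note lin = linear_symfun_linear[of y]
  have mult_left: "linear (\<lambda>f. ?L (h * f))" "linear (\<lambda>f. ?L (f * h))" for h
    by (auto intro!: linearI simp: distrib_left distrib_right linear_add[OF lin] linear_scale[OF lin])
  have scale: "linear (\<lambda>f. a * ?L f)" "linear (\<lambda>f. ?L f * a)" for a
    by (auto intro!: linearI simp: distrib_left distrib_right linear_add[OF lin] linear_scale[OF lin])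
  have p: "?L (power_sum k * f) = y {#k#} * ?L f" if k: "0 < k" for k f
  proof (rule linear_symfun_eqI[OF mult_left(1) scale(1)])
    fix \<mu> assume \<mu>: "int_partition \<mu>"
    have "(\<Sum>j\<in>#\<mu>. ?L (aug_monomial_sym (add_mset (j + k) (\<mu> - {#j#})))) = (\<Sum>j\<in>#\<mu>. y (add_mset (j + k) (\<mu> - {#j#})))"
      using k \<mu> by (intro arg_cong[where f = sum_mset] image_mset_cong symfun_linear_aug) (simp add: int_partition_diff)
    then show "?L (power_sum k * aug_monomial_sym \<mu>) = y {#k#} * ?L (aug_monomial_sym \<mu>)"
      using k \<mu> monomial_state_rec[OF y k \<mu>]
      by (simp add: power_sum_mult_aug linear_add[OF lin] linear_sum_mset[OF lin] symfun_linear_aug)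
  qed
  have aug: "\<forall>g. ?L (aug_monomial_sym \<mu> * g) = y \<mu> * ?L g" if "int_partition \<mu>" for \<mu>
    using that
  proof (induction rule: partition_induct)
    case empty
    then show ?case using y by (simp add: aug_empty monomial_state_empty)
  next
    case (add k \<mu>)
    show ?case
    proof
      fix g
      let ?a = "\<lambda>j. add_mset (j + k) (\<mu> - {#j#})"
      have m: "(\<Sum>j\<in>#\<mu>. h j) * g = (\<Sum>j\<in>#\<mu>. h j * g)" for h :: "nat \<Rightarrow> symfun"
        by (rule sum_mset_distrib_right)
      have "y {#k#} * (y \<mu> * ?L g) = ?L (power_sum k * aug_monomial_sym \<mu> * g)"
        using add by (simp add: p mult.assoc)
      also have "\<dots> = ?L (aug_monomial_sym (add_mset k \<mu>) * g) + (\<Sum>j\<in>#\<mu>. ?L (aug_monomial_sym (?a j) * g))"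
        using add by (simp add: power_sum_mult_aug distrib_right m linear_add[OF lin] linear_sum_mset[OF lin])
      also have "(\<Sum>j\<in>#\<mu>. ?L (aug_monomial_sym (?a j) * g)) = (\<Sum>j\<in>#\<mu>. y (?a j) * ?L g)"
        using add by (intro arg_cong[where f = sum_mset] image_mset_cong) auto
      also have "\<dots> = (\<Sum>j\<in>#\<mu>. y (?a j)) * ?L g" by (rule sum_mset_distrib_right[symmetric])
      finally show "?L (aug_monomial_sym (add_mset k \<mu>) * g) = y (add_mset k \<mu>) * ?L g"
        using arg_cong[OF monomial_state_rec[OF y add(1,2)], of "\<lambda>a. a * ?L g"]
        by (simp add: algebra_simps)
    qed
  qed
  show ?thesis
    by (rule linear_symfun_eqI[OF mult_left(2) scale(2), of _ _ f]) (simp add: aug symfun_linear_aug)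
qed

text \<open>Resolves the definite description, existence and uniqueness together, as soon as some
  state \<open>y\<close> has the required power sums. Such a \<open>y\<close> will come from a
  character on trees.\<close>

lemma ev_eq_symfun_linear:
  assumes y: "monomial_state y" and c: "y {#1#} = c" and q: "\<And>k. 2 \<le> k \<Longrightarrow> y {#k#} = suminf (\<lambda>i. q i ^ k)"
  shows "ev c q = symfun_linear y"
  unfolding ev_def
proof (rule the_equality, goal_cases)
  case 1
  have "symfun_linear y 1 = 1"
    using symfun_linear_aug[of "{#}" y] y by (simp add: aug_empty monomial_state_empty)
  then show ?case
    using symfun_linear_mult[OF y] linear_symfun_linear[of y] c q
    by (simp add: power_sum_aug symfun_linear_aug)
next
  case (2 \<phi>)
  have "\<phi> (power_sum k) = y {#k#}" if "0 < k" for k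
    using 2 c q that by (cases "k = 1") auto
  then have "\<phi> (aug_monomial_sym \<mu>) = y \<mu>" if "int_partition \<mu>" for \<mu>
    using symfun_hom_aug[OF y, of \<phi>] 2 that by blast
  then have "\<phi> f = symfun_linear y f" for f
    using 2 linear_symfun_eqI[OF _ linear_symfun_linear, of \<phi> y f] by (simp add: symfun_linear_aug)
  then show ?case by (rule ext)
qed


section \<open>Unital basis-positive characters\<close>

text \<open>Linear extension from a basis. The coproduct, \<open>tensor_fun\<close> and
  \<open>Q_map\<close> are all of this form, so their linearity is proved once.\<close>

definition pm_extend :: "('b \<Rightarrow> 'a::real_vector) \<Rightarrow> ('b \<Rightarrow>\<^sub>0 real) \<Rightarrow> 'a" where
  "pm_extend u x = (\<Sum>t\<in>Poly_Mapping.keys x. Poly_Mapping.lookup x t *\<^sub>R u t)"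

lemma pm_extend_superset:
  "finite S \<Longrightarrow> Poly_Mapping.keys x \<subseteq> S \<Longrightarrow> pm_extend u x = (\<Sum>t\<in>S. Poly_Mapping.lookup x t *\<^sub>R u t)"
  unfolding pm_extend_def by (rule sum.mono_neutral_left) (auto simp: in_keys_iff)

lemma lookup_scaleR: "Poly_Mapping.lookup (c *\<^sub>R x) t = c *\<^sub>R Poly_Mapping.lookup x t"
  by transfer simp

lemma linear_pm_extend:
  fixes u :: "'b \<Rightarrow> 'a::real_vector"
  shows "linear (pm_extend u)"
proof (rule linearI)
  fix x y :: "'b \<Rightarrow>\<^sub>0 real" and r :: real
  let ?S = "Poly_Mapping.keys x \<union> Poly_Mapping.keys y"
  have "Poly_Mapping.keys (x + y) \<subseteq> ?S" by (rule keys_add)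
  then show "pm_extend u (x + y) = pm_extend u x + pm_extend u y"
    by (subst (1 2 3) pm_extend_superset[of ?S]) (auto simp: lookup_add scaleR_add_left sum.distrib)
  have "Poly_Mapping.keys (r *\<^sub>R x) \<subseteq> Poly_Mapping.keys x"
    by (auto simp: in_keys_iff lookup_scaleR)
  then show "pm_extend u (r *\<^sub>R x) = r *\<^sub>R pm_extend u x"
    by (subst (1 2) pm_extend_superset[of "Poly_Mapping.keys x"]) (auto simp: lookup_scaleR scaleR_sum_right)
qed

lemma pm_extend_single: "pm_extend u (Poly_Mapping.single t 1) = u t"
  by (simp add: pm_extend_def)

lemma pm_expansion:
  fixes x :: "'b \<Rightarrow>\<^sub>0 real"
  shows "x = pm_extend (\<lambda>t. Poly_Mapping.single t 1) x"
proof (rule poly_mapping_eqI)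
  fix s
  have "Poly_Mapping.lookup (\<Sum>t\<in>S. h t) s = (\<Sum>t\<in>S. Poly_Mapping.lookup (h t) s)"
    for S and h :: "'b \<Rightarrow> 'b \<Rightarrow>\<^sub>0 real"
    by (induction S rule: infinite_finite_induct) (auto simp: lookup_add)
  then have "Poly_Mapping.lookup (pm_extend (\<lambda>t. Poly_Mapping.single t (1::real)) x) s =
      (\<Sum>t\<in>Poly_Mapping.keys x. Poly_Mapping.lookup (Poly_Mapping.lookup x t *\<^sub>R Poly_Mapping.single t (1::real)) s)"
    unfolding pm_extend_def .
  also have "\<dots> = (\<Sum>t\<in>Poly_Mapping.keys x. if t = s then Poly_Mapping.lookup x s else 0)"
    by (intro sum.cong refl) (auto simp: lookup_scaleR lookup_single when_def)
  finally have "Poly_Mapping.lookup (pm_extend (\<lambda>t. Poly_Mapping.single t (1::real)) x) s =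
      (\<Sum>t\<in>Poly_Mapping.keys x. if t = s then Poly_Mapping.lookup x s else 0)" .
  then show "Poly_Mapping.lookup x s = Poly_Mapping.lookup (pm_extend (\<lambda>t. Poly_Mapping.single t 1) x) s"
    by (simp add: sum.delta in_keys_iff)
qed

lemma linear_eq_pm_extend:
  assumes "linear \<phi>"
  shows "\<phi> x = pm_extend (\<lambda>t. \<phi> (Poly_Mapping.single t 1)) x"
  by (subst pm_expansion) (simp add: pm_extend_def linear_sum[OF assms] linear_scale[OF assms])

lemma linear_gl_eqI:
  assumes "linear \<phi>" "linear \<psi>" "\<And>t. \<phi> (gl_basis t) = \<psi> (gl_basis t)"
  shows "\<phi> = \<psi>"
proof
  fix x
  have "(\<lambda>t. \<phi> (Poly_Mapping.single t 1)) = (\<lambda>t. \<psi> (Poly_Mapping.single t 1))"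
    using assms(3) by (simp add: gl_basis_def)
  then show "\<phi> x = \<psi> x"
    by (simp only: linear_eq_pm_extend[OF assms(1), of x] linear_eq_pm_extend[OF assms(2), of x])
qed

lemma tensor_fun_pm_extend:
  "tensor_fun f g = pm_extend (\<lambda>(s, t). f (gl_basis s) * g (gl_basis t))"
  by (simp add: tensor_fun_def pm_extend_def fun_eq_iff case_prod_beta)

lemma gl_comult_pm_extend: "gl_comult = pm_extend gl_comult_basis"
  by (simp add: gl_comult_def pm_extend_def fun_eq_iff)

lemma Q_map_pm_extend: "Q_map = pm_extend Q_basis"
  by (simp add: Q_map_def pm_extend_def fun_eq_iff)

lemma linear_convolve: "linear (f \<star> g)"
proof -
  have "f \<star> g = tensor_fun f g \<circ> gl_comult" by (simp add: convolve_def fun_eq_iff)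
  then show ?thesis
    unfolding tensor_fun_pm_extend gl_comult_pm_extend
    by (metis linear_compose linear_pm_extend)
qed

lemma convolve_basis:
  "(f \<star> g) (gl_basis t) = tree_conv (\<lambda>t. f (gl_basis t)) (\<lambda>t. g (gl_basis t)) t"
proof -
  have "(f \<star> g) (gl_basis t) = tensor_fun f g (gl_comult_basis t)"
    unfolding convolve_def gl_comult_pm_extend gl_basis_def pm_extend_single ..
  also have "\<dots> = tree_conv (\<lambda>t. f (gl_basis t)) (\<lambda>t. g (gl_basis t)) t"
    unfolding tensor_fun_pm_extend gl_comult_basis_def Let_def linear_sum[OF linear_pm_extend]
      pm_extend_single tree_conv_def by simp
  finally show ?thesis .
qed

lemma gl_mult_basis_basis: "gl_mult (gl_basis s) (gl_basis t) = gl_mult_basis s t"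
  by (simp add: gl_mult_def gl_basis_def)

lemma ubp_character_iff:
  "ubp_character \<phi> \<longleftrightarrow> linear \<phi> \<and> tree_char (\<lambda>t. \<phi> (gl_basis t))"
proof -
  have "(\<forall>x y. \<phi> (gl_mult x y) = \<phi> x * \<phi> y) \<longleftrightarrow> tree_mult (\<lambda>t. \<phi> (gl_basis t))" if \<phi>: "linear \<phi>"
  proof -
    have basis: "\<phi> (gl_mult_basis s t) = (\<Sum>f\<in>{..<length (branch_list s)} \<rightarrow>\<^sub>E vertices (rep t).
      \<phi> (gl_basis (graft (rep t) (branch_list s) f)))" for s t
      unfolding gl_mult_basis_def by (rule linear_sum[OF \<phi>])
    show ?thesis
      unfolding tree_mult_iff basis[symmetric]
    proof (intro iffI allI)
      fix s t assume "\<forall>x y. \<phi> (gl_mult x y) = \<phi> x * \<phi> y"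
      then show "\<phi> (gl_mult_basis s t) = \<phi> (gl_basis s) * \<phi> (gl_basis t)"
        by (metis gl_mult_basis_basis)
    next
      fix x y assume *: "\<forall>s t. \<phi> (gl_mult_basis s t) = \<phi> (gl_basis s) * \<phi> (gl_basis t)"
      have "\<phi> (gl_mult x y) = pm_extend (\<lambda>t. \<phi> (gl_basis t)) x * pm_extend (\<lambda>t. \<phi> (gl_basis t)) y"
        unfolding gl_mult_def pm_extend_def sum_product
        by (simp add: linear_sum[OF \<phi>] linear_scale[OF \<phi>] * mult_ac)
      then show "\<phi> (gl_mult x y) = \<phi> x * \<phi> y"
        using linear_eq_pm_extend[OF \<phi>, of x] linear_eq_pm_extend[OF \<phi>, of y] by (simp add: gl_basis_def)
    qed
  qed
  then show ?thesis unfolding ubp_character_def tree_char_def by blast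
qed

section \<open>Characters and their power values\<close>

definition power_value :: "(gl \<Rightarrow> real) \<Rightarrow> nat \<Rightarrow> real" where
  "power_value \<phi> k = \<phi> (gl_basis (path_forest {#k#}))"

lemma chain_pos_inj: "0 < a \<Longrightarrow> 0 < b \<Longrightarrow> chain a = chain b \<longleftrightarrow> a = b"
  using chain_inj[of "a - 1" "b - 1"] by auto

lemma path_forest_inj:
  assumes "int_partition \<mu>" "int_partition \<nu>" "path_forest \<mu> = path_forest \<nu>"
  shows "\<mu> = \<nu>"
proof -
  define l where "l = inv_into {0<..} chain"
  have "l (chain a) = a" if "0 < a" for a
    unfolding l_def by (rule inv_into_f_f) (use that in \<open>auto simp: inj_on_def chain_pos_inj\<close>)
  then have "image_mset l (image_mset chain \<mu>) = image_mset (\<lambda>a. a) \<mu>" if "int_partition \<mu>" for \<mu>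
    using that unfolding multiset.map_comp comp_def int_partition_def
    by (intro image_mset_cong) (metis gr0I)
  then show ?thesis using assms by (metis path_forest_def image_mset.id image_mset_cong rtree.inject id_apply multiset.map_ident)
qed

lemma Q_basis_path_forest: "int_partition \<mu> \<Longrightarrow> Q_basis (path_forest \<mu>) = aug_monomial_sym \<mu>"
  unfolding Q_basis_def using path_forest_inj
  by (auto intro!: arg_cong[where f = aug_monomial_sym] the_equality)

lemma ubp_monomial_state:
  "ubp_character \<phi> \<Longrightarrow> monomial_state (\<lambda>\<mu>. \<phi> (gl_basis (path_forest \<mu>)))"
  using tree_char_monomial_state by (auto simp: ubp_character_iff)

lemma ubp_eqI:
  assumes \<phi>: "ubp_character \<phi>" and \<psi>: "ubp_character \<psi>"
    and eq: "\<And>k. 0 < k \<Longrightarrow> power_value \<phi> k = power_value \<psi> k"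
  shows "\<phi> = \<psi>"
proof -
  have "\<phi> (gl_basis t) = \<psi> (gl_basis t)" for t
  proof (cases "\<exists>\<mu>. int_partition \<mu> \<and> t = path_forest \<mu>")
    case True
    then show ?thesis
      using monomial_state_unique[OF ubp_monomial_state[OF \<phi>] ubp_monomial_state[OF \<psi>]] eq
      by (auto simp: power_value_def)
  next
    case False
    then show ?thesis
      using tree_char_not_path_forest \<phi> \<psi> unfolding ubp_character_iff by metis
  qed
  then show ?thesis
    using \<phi> \<psi> by (intro linear_gl_eqI) (auto simp: ubp_character_iff)
qed

text \<open>Trees with one branch are primitive, hence power values add under convolution.\<close>

lemma tree_conv_single: "tree_conv u v (Node {#t#}) = u bullet * v (Node {#t#}) + u (Node {#t#}) * v bullet"
  using tree_conv_add_mset[of u v t "{#}"] by (simp add: tree_conv_bullet)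

lemma tree_char_conv:
  assumes "tree_char u" "tree_char v"
  shows "tree_char (tree_conv u v)"
proof -
  have "0 \<le> tree_conv u v t" for t
    using assms unfolding tree_conv_def tree_char_def by (intro sum_nonneg mult_nonneg_nonneg) auto
  then show ?thesis
    using assms tree_mult_conv by (auto simp: tree_char_def tree_conv_bullet)
qed

lemma ubp_convolve: "ubp_character \<phi> \<Longrightarrow> ubp_character \<psi> \<Longrightarrow> ubp_character (\<phi> \<star> \<psi>)"
  using tree_char_conv by (simp add: ubp_character_iff linear_convolve convolve_basis)

lemma power_value_convolve:
  "ubp_character \<phi> \<Longrightarrow> ubp_character \<psi> \<Longrightarrow> power_value (\<phi> \<star> \<psi>) k = power_value \<phi> k + power_value \<psi> k"
  by (simp add: power_value_def convolve_basis path_forest_def tree_conv_single ubp_character_def)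

lemma ubp_pm_extend:
  assumes "tree_char u"
  shows "ubp_character (pm_extend u)" "pm_extend u (gl_basis t) = u t"
  using assms by (simp_all add: ubp_character_iff linear_pm_extend gl_basis_def pm_extend_single)

lemma ubp_chain:
  assumes "0 \<le> x"
  shows "ubp_character (pm_extend (chain_char x))"
    "0 < k \<Longrightarrow> power_value (pm_extend (chain_char x)) k = x ^ k"
proof -
  have c: "tree_char (chain_char x)"
    using assms by (simp add: tree_char_def tree_mult_chain_char chain_char_bullet chain_char_nonneg)
  then show "ubp_character (pm_extend (chain_char x))" by (rule ubp_pm_extend)
  assume "0 < k"
  then have "path_forest {#k#} = chain (Suc k)"
    using chain_Suc[of "k - 1"] by (simp add: path_forest_def)
  then show "power_value (pm_extend (chain_char x)) k = x ^ k"
    using ubp_pm_extend(2)[OF c] chain_char_chain by (simp add: power_value_def)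
qed

text \<open>Here \<open>0 ^ 0 = 1\<close> gives the value at the one-vertex tree. As a chain
  character the counit is a character without further computation.\<close>

lemma gl_counit_chain_char: "gl_counit = pm_extend (chain_char 0)"
proof
  fix x
  have "chain_char 0 t = (if t = bullet then 1 else 0)" for t
  proof (cases "\<exists>n. t = chain (Suc n)")
    case True
    then obtain n where "t = chain (Suc n)" by blast
    then show ?thesis using chain_inj[of n 0] by (simp add: chain_char_chain chain_1 power_0_left)
  next
    case False
    then show ?thesis by (metis chain_1 chain_char_def)
  qed
  then have "pm_extend (chain_char 0) x =
      (\<Sum>t\<in>Poly_Mapping.keys x. if t = bullet then Poly_Mapping.lookup x bullet else 0)"
    unfolding pm_extend_def by (intro sum.cong) auto
  then show "gl_counit x = pm_extend (chain_char 0) x"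
    by (simp add: gl_counit_def sum.delta in_keys_iff)
qed

lemma ubp_counit: "ubp_character gl_counit" "0 < k \<Longrightarrow> power_value gl_counit k = 0"
  using ubp_chain[of 0] by (simp_all add: gl_counit_chain_char)

lemma ubp_conv_power:
  assumes "ubp_character \<phi>"
  shows "ubp_character (conv_power \<phi> n)" "0 < k \<Longrightarrow> power_value (conv_power \<phi> n) k = real n * power_value \<phi> k"
proof -
  have "ubp_character (conv_power \<phi> n) \<and> (0 < k \<longrightarrow> power_value (conv_power \<phi> n) k = real n * power_value \<phi> k)"
  proof (induction n)
    case 0
    then show ?case by (simp add: conv_power_def ubp_counit)
  next
    case (Suc n)
    have "conv_power \<phi> (Suc n) = \<phi> \<star> conv_power \<phi> n" by (simp add: conv_power_def)
    then show ?case using Suc assms by (simp add: ubp_convolve power_value_convolve algebra_simps)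
  qed
  then show "ubp_character (conv_power \<phi> n)" "0 < k \<Longrightarrow> power_value (conv_power \<phi> n) k = real n * power_value \<phi> k"
    by blast+
qed

text \<open>Convergence of the power values spreads to all path-forests by the recursion, and all
  other trees have value 0 throughout. Multiplicativity is a family of identities between finite
  sums and passes to the limit.\<close>

lemma ubp_limit:
  assumes \<phi>: "\<And>n. ubp_character (\<phi> n)" and lim: "\<And>k. 0 < k \<Longrightarrow> (\<lambda>n. power_value (\<phi> n) k) \<longlonglongrightarrow> p k"
  obtains \<psi> where "ubp_character \<psi>" "\<And>t. (\<lambda>n. \<phi> n (gl_basis t)) \<longlonglongrightarrow> \<psi> (gl_basis t)"
    "\<And>k. 0 < k \<Longrightarrow> power_value \<psi> k = p k"
proof -
  obtain z where z: "\<And>\<mu>. int_partition \<mu> \<Longrightarrow> (\<lambda>n. \<phi> n (gl_basis (path_forest \<mu>))) \<longlonglongrightarrow> z \<mu>"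
      "\<And>k. 0 < k \<Longrightarrow> z {#k#} = p k"
    using monomial_state_closed[of "\<lambda>n \<mu>. \<phi> n (gl_basis (path_forest \<mu>))" p]
      ubp_monomial_state[OF \<phi>] lim unfolding power_value_def by metis
  define u where "u t = lim (\<lambda>n. \<phi> n (gl_basis t))" for t
  have tc: "tree_char (\<lambda>t. \<phi> n (gl_basis t))" for n using \<phi> by (simp add: ubp_character_iff)
  have u: "(\<lambda>n. \<phi> n (gl_basis t)) \<longlonglongrightarrow> u t" for t
  proof (cases "\<exists>\<mu>. int_partition \<mu> \<and> t = path_forest \<mu>")
    case True
    then show ?thesis using z(1) unfolding u_def by (metis convergentI convergent_LIMSEQ_iff)
  next
    case False
    then have "\<phi> n (gl_basis t) = 0" for n by (rule tree_char_not_path_forest[OF tc])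
    then show ?thesis by (simp add: u_def)
  qed
  have "tree_char u"
    unfolding tree_char_def tree_mult_def
  proof (intro conjI allI impI)
    show "u bullet = 1"
      using u[of bullet] tc by (simp add: tree_char_def LIMSEQ_const_iff)
    show "0 \<le> u t" for t
      by (rule LIMSEQ_le_const[OF u]) (use tc in \<open>auto simp: tree_char_def\<close>)
    fix p and K :: "nat set" and s :: "nat \<Rightarrow> rtree" assume K: "finite K"
    have "(\<lambda>n. graft_sum p K s (\<lambda>t. \<phi> n (gl_basis t))) \<longlonglongrightarrow> graft_sum p K s u"
      unfolding graft_sum_def by (intro tendsto_sum u)
    moreover have "graft_sum p K s (\<lambda>t. \<phi> n (gl_basis t)) =
        \<phi> n (gl_basis (Node (image_mset s (mset_set K)))) * \<phi> n (gl_basis (shape p))" for n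
      using tc[of n] K unfolding tree_char_def tree_mult_def by blast
    ultimately show "graft_sum p K s u = u (Node (image_mset s (mset_set K))) * u (shape p)"
      using tendsto_mult[OF u u, of "Node (image_mset s (mset_set K))" "shape p"]
      by (simp add: LIMSEQ_unique)
  qed
  note ext = ubp_pm_extend[OF this]
  have "power_value (pm_extend u) k = p k" if "0 < k" for k
    using LIMSEQ_unique[OF u z(1)] z(2) that by (simp add: power_value_def ext)
  then show thesis using that[of "pm_extend u"] ext u by simp
qed

section \<open>Existence of characters with given power sums\<close>

lemma ubp_exists_finite:
  fixes x :: "nat \<Rightarrow> real"
  assumes "\<And>i. 0 \<le> x i"
  shows "\<exists>\<phi>. ubp_character \<phi> \<and> (\<forall>k>0. power_value \<phi> k = (\<Sum>i<n. x i ^ k))"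
proof (induction n)
  case 0
  then show ?case using ubp_counit by (intro exI[of _ gl_counit]) simp
next
  case (Suc n)
  then obtain \<phi> where \<phi>: "ubp_character \<phi>" "\<And>k. 0 < k \<Longrightarrow> power_value \<phi> k = (\<Sum>i<n. x i ^ k)" by blast
  then show ?case
    using ubp_chain(1)[OF assms, of n] ubp_chain(2)[OF assms]
    by (intro exI[of _ "\<phi> \<star> pm_extend (chain_char (x n))"]) (simp add: ubp_convolve power_value_convolve)
qed

definition power_sums :: "real \<Rightarrow> (nat \<Rightarrow> real) \<Rightarrow> nat \<Rightarrow> real" where
  "power_sums c q k = (if k = 1 then c else suminf (\<lambda>i. q i ^ k))"

lemma KK_D:
  assumes "(c, q) \<in> KK"
  shows "0 \<le> c" "decseq q" "0 \<le> q i" "summable q" "suminf q \<le> c"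
  using assms by (auto simp: KK_def)

lemma summable_power:
  fixes q :: "nat \<Rightarrow> real"
  assumes "summable q" "\<And>i. 0 \<le> q i" "0 < k"
  shows "summable (\<lambda>i. q i ^ k)"
proof (rule summable_comparison_test_ev)
  have "eventually (\<lambda>i. q i < 1) sequentially"
    using summable_LIMSEQ_zero[OF assms(1)] by (rule order_tendstoD) simp
  then show "eventually (\<lambda>i. norm (q i ^ k) \<le> q i) sequentially"
  proof eventually_elim
    case (elim i)
    then show ?case
      using power_decreasing[of 1 k "q i"] assms by (simp add: Suc_leI)
  qed
qed fact

text \<open>The dust \<open>d\<close> is approximated by \<open>n\<close> points \<open>d / n\<close>.\<close>

lemma ubp_exists:
  assumes K: "(c, q) \<in> KK"
  shows "\<exists>\<phi>. ubp_character \<phi> \<and> (\<forall>k>0. power_value \<phi> k = power_sums c q k)"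
proof -
  note q = KK_D[OF K]
  let ?d = "c - suminf q"
  have "\<exists>\<phi>. ubp_character \<phi> \<and> (\<forall>k>0. power_value \<phi> k = (\<Sum>i<n. q i ^ k) + real n * (?d / real n) ^ k)" for n
  proof -
    obtain \<phi> where \<phi>: "ubp_character \<phi>" "\<And>k. 0 < k \<Longrightarrow> power_value \<phi> k = (\<Sum>i<n. q i ^ k)"
      using ubp_exists_finite[of q n] q by blast
    obtain \<psi> where \<psi>: "ubp_character \<psi>" "\<And>k. 0 < k \<Longrightarrow> power_value \<psi> k = (\<Sum>i<n. (?d / real n) ^ k)"
      using ubp_exists_finite[of "\<lambda>_. ?d / real n" n] q by (auto simp: divide_nonneg_nonneg)
    show ?thesis
      using \<phi> \<psi> by (intro exI[of _ "\<phi> \<star> \<psi>"]) (simp add: ubp_convolve power_value_convolve)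
  qed
  then obtain \<phi> where \<phi>: "\<And>n. ubp_character (\<phi> n)"
    "\<And>n k. 0 < k \<Longrightarrow> power_value (\<phi> n) k = (\<Sum>i<n. q i ^ k) + real n * (?d / real n) ^ k"
    by metis
  have "(\<lambda>n. power_value (\<phi> n) k) \<longlonglongrightarrow> power_sums c q k" if k: "0 < k" for k
  proof -
    have s: "(\<lambda>n. \<Sum>i<n. q i ^ k) \<longlonglongrightarrow> suminf (\<lambda>i. q i ^ k)"
      by (rule summable_LIMSEQ[OF summable_power]) (use q k in auto)
    show ?thesis
    proof (cases "k = 1")
      case True
      have "(\<lambda>n. real n * (?d / real n) ^ k) \<longlonglongrightarrow> ?d"
        by (rule tendsto_eventually, rule eventually_sequentiallyI[of 1]) (use True in auto)
      from tendsto_add[OF s this] show ?thesis using True k by (simp add: \<phi>(2) power_sums_def)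
    next
      case False
      then have "2 \<le> k" using k by simp
      then obtain l where l: "k = Suc (Suc l)" by (metis add_2_eq_Suc le_Suc_ex)
      have "(\<lambda>n. ?d * (?d / real n) ^ Suc l) \<longlonglongrightarrow> ?d * 0 ^ Suc l"
        by (intro tendsto_mult tendsto_power tendsto_const lim_const_over_n)
      moreover have "eventually (\<lambda>n. ?d * (?d / real n) ^ Suc l = real n * (?d / real n) ^ k) sequentially"
        by (rule eventually_sequentiallyI[of 1]) (simp add: l)
      ultimately have "(\<lambda>n. real n * (?d / real n) ^ k) \<longlonglongrightarrow> 0"
        by (simp add: tendsto_cong)
      from tendsto_add[OF s this] show ?thesis using False k by (simp add: \<phi>(2) power_sums_def)
    qed
  qed
  from ubp_limit[OF \<phi>(1) this] show ?thesis by metis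
qed

text \<open>The character \<phi> with the prescribed power sums provides the state that identifies
  \<open>ev c q\<close>. Then \<open>Psi c q\<close> and \<phi> agree at path-forests by
  construction, and both vanish at all other trees.\<close>

lemma Psi_ubp:
  assumes K: "(c, q) \<in> KK"
  shows "ubp_character (Psi c q)" "0 < k \<Longrightarrow> power_value (Psi c q) k = power_sums c q k"
proof -
  obtain \<phi> where \<phi>: "ubp_character \<phi>" "\<And>k. 0 < k \<Longrightarrow> power_value \<phi> k = power_sums c q k"
    using ubp_exists[OF K] by blast
  define y where "y \<mu> = \<phi> (gl_basis (path_forest \<mu>))" for \<mu>
  have y: "monomial_state y" using ubp_monomial_state[OF \<phi>(1)] by (simp add: y_def[abs_def])
  have "ev c q = symfun_linear y"
    by (rule ev_eq_symfun_linear[OF y])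
      (use \<phi>(2) in \<open>auto simp: y_def power_value_def power_sums_def\<close>)
  then have Psi: "Psi c q = symfun_linear y \<circ> pm_extend Q_basis"
    by (simp add: Psi_def Q_map_pm_extend)
  have tc: "tree_char (\<lambda>t. \<phi> (gl_basis t))" and lin: "linear \<phi>" using \<phi>(1) by (auto simp: ubp_character_iff)
  have lin': "linear (Psi c q)" unfolding Psi
    by (intro linear_compose linear_pm_extend linear_symfun_linear)
  have "Psi c q (gl_basis t) = \<phi> (gl_basis t)" for t
  proof (cases "\<exists>\<mu>. int_partition \<mu> \<and> t = path_forest \<mu>")
    case True
    then obtain \<mu> where \<mu>: "int_partition \<mu>" "t = path_forest \<mu>" by blast
    then show ?thesis
      by (simp add: Psi gl_basis_def pm_extend_single Q_basis_path_forest symfun_linear_aug)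
        (simp add: y_def gl_basis_def)
  next
    case False
    then have "Q_basis t = 0" unfolding Q_basis_def by (rule if_not_P)
    then show ?thesis
      using tree_char_not_path_forest[OF tc False] linear_0[OF linear_symfun_linear[of y]]
      by (simp add: Psi pm_extend_single gl_basis_def)
  qed
  then have "Psi c q = \<phi>" by (rule linear_gl_eqI[OF lin' lin])
  then show "ubp_character (Psi c q)" "0 < k \<Longrightarrow> power_value (Psi c q) k = power_sums c q k"
    using \<phi> by auto
qed

lemma ubp_classify:
  assumes "ubp_character \<phi>"
  obtains c q where "(c, q) \<in> KK" "\<phi> = Psi c q"
proof -
  let ?y = "\<lambda>\<mu>. \<phi> (gl_basis (path_forest \<mu>))"
  obtain q where q: "(?y {#1#}, q) \<in> KK" "\<And>k. 2 \<le> k \<Longrightarrow> (\<lambda>i. q i ^ k) sums ?y {#k#}"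
    using monomial_state_classify[OF ubp_monomial_state[OF assms]] by blast
  have "\<phi> = Psi (?y {#1#}) q"
  proof (rule ubp_eqI[OF assms Psi_ubp(1)[OF q(1)]])
    fix k :: nat assume k: "0 < k"
    show "power_value \<phi> k = power_value (Psi (?y {#1#}) q) k"
      unfolding Psi_ubp(2)[OF q(1) k]
      using k q(2)[of k] by (cases "k = 1") (auto simp: power_sums_def power_value_def sums_iff)
  qed
  with q(1) show thesis using that by blast
qed


section \<open>Decreasing sequences and point measures\<close>

lemma sets_pos_borel: "A \<in> sets pos_borel \<longleftrightarrow> A \<in> sets borel \<and> A \<subseteq> {0<..}"
  unfolding pos_borel_def by (subst sets_restrict_space_iff) auto

lemma space_pos_borel: "space pos_borel = {0<..}"
  by (simp add: pos_borel_def space_restrict_space)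

lemma sets_eta: "sets (eta q) = sets pos_borel"
  unfolding eta_def by (rule sets.sets_measure_of_eq)

lemma space_eta: "space (eta q) = {0<..}"
  using sets_eq_imp_space_eq[OF sets_eta] by (simp add: space_pos_borel)

text \<open>Null sequences instead of summable ones: an enumeration of atoms exists before
  integrability is known.\<close>

definition tail_seq :: "(nat \<Rightarrow> real) \<Rightarrow> bool" where
  "tail_seq q \<longleftrightarrow> decseq q \<and> (\<forall>i. 0 \<le> q i) \<and> q \<longlonglongrightarrow> 0"

text \<open>Meaningful for x > 0 and null sequences, whose level sets are finite there. At x = 0 the
  level set may be infinite, and its cardinality then defaults to 0.\<close>

definition mult_of :: "(nat \<Rightarrow> real) \<Rightarrow> real \<Rightarrow> nat" where
  "mult_of q x = card {i. q i = x}"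

abbreviation atom_sum :: "(real \<Rightarrow> nat) \<Rightarrow> (real \<Rightarrow> ennreal) \<Rightarrow> ennreal" where
  "atom_sum m f \<equiv> \<integral>\<^sup>+x. of_nat (m x) * f x \<partial>count_space {0<..}"

lemma finite_level:
  fixes q :: "nat \<Rightarrow> real"
  assumes "q \<longlonglongrightarrow> 0" "0 < x"
  shows "finite {i. x \<le> q i}" "finite {i. q i = x}"
proof -
  have "eventually (\<lambda>i. q i < x) sequentially" by (rule order_tendstoD(2)[OF assms])
  then obtain N where "\<And>i. N \<le> i \<Longrightarrow> q i < x" by (auto simp: eventually_sequentially)
  then have "{i. x \<le> q i} \<subseteq> {..<N}" by (force simp: not_le[symmetric])
  then show "finite {i. x \<le> q i}" using finite_subset by blast
  then show "finite {i. q i = x}" by (rule rev_finite_subset) auto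
qed

text \<open>Summation over pairs of an index i and an atom x with q i = x, in either order. Through
  this identity masses and power sums depend on the multiplicities only.\<close>

lemma suminf_by_multiplicity:
  fixes f :: "real \<Rightarrow> ennreal"
  assumes q: "q \<longlonglongrightarrow> 0"
  shows "(suminf (\<lambda>i. if 0 < q i then f (q i) else 0)) = atom_sum (mult_of q) f"
proof -
  have "suminf (\<lambda>i. if 0 < q i then f (q i) else 0) =
      suminf (\<lambda>i. \<integral>\<^sup>+x. f x * indicator {q i} x \<partial>count_space {0<..})"
  proof (intro suminf_cong)
    fix i
    show "(if 0 < q i then f (q i) else 0) = (\<integral>\<^sup>+x. f x * indicator {q i} x \<partial>count_space {0<..})"
    proof (cases "0 < q i")
      case True
      then show ?thesis by (subst nn_integral_indicator_singleton) auto
    next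
      case False
      then have "(\<integral>\<^sup>+x. f x * indicator {q i} x \<partial>count_space {0<..}) = (\<integral>\<^sup>+(x::real). 0 \<partial>count_space {0<..})"
        by (intro nn_integral_cong) (auto simp: indicator_def)
      then show ?thesis using False by simp
    qed
  qed
  also have "\<dots> = (\<integral>\<^sup>+x. suminf (\<lambda>i. f x * indicator {q i} x) \<partial>count_space {0<..})"
    by (rule nn_integral_suminf[symmetric]) simp
  also have "\<dots> = atom_sum (mult_of q) f"
  proof (intro nn_integral_cong)
    fix x :: real assume "x \<in> space (count_space {0<..})"
    then have fin: "finite {i. q i = x}" by (intro finite_level(2)[OF q]) simp
    have "suminf (\<lambda>i. f x * indicator {q i} x) = (\<Sum>i\<in>{i. q i = x}. f x * indicator {q i} x)"
      by (rule suminf_finite[OF fin]) auto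
    also have "\<dots> = (\<Sum>i\<in>{i. q i = x}. f x)" by (intro sum.cong) auto
    finally show "suminf (\<lambda>i. f x * indicator {q i} x) = of_nat (mult_of q x) * f x"
      by (simp add: mult_of_def)
  qed
  finally show ?thesis .
qed

lemma emeasure_eta_mult:
  assumes "q \<longlonglongrightarrow> 0" "A \<in> sets pos_borel"
  shows "emeasure (eta q) A = atom_sum (mult_of q) (indicator A)"
  unfolding emeasure_eta[OF assms(2)] by (rule suminf_by_multiplicity[OF assms(1)])

lemma nn_integral_singleton:
  fixes f :: "real \<Rightarrow> ennreal"
  assumes "0 < x"
  shows "(\<integral>\<^sup>+y. f y * indicator {x} y \<partial>count_space {0<..}) = f x"
  by (subst nn_integral_indicator_singleton) (use assms in auto)

lemma singleton_pos_borel: "0 < x \<Longrightarrow> {x} \<in> sets pos_borel"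
  by (simp add: sets_pos_borel)

lemma emeasure_eta_singleton:
  assumes "q \<longlonglongrightarrow> 0" "0 < x"
  shows "emeasure (eta q) {x} = of_nat (mult_of q x)"
  using assms by (simp add: emeasure_eta_mult singleton_pos_borel nn_integral_singleton)

lemma card_level_eta:
  assumes q: "q \<longlonglongrightarrow> 0" and x: "0 < x"
  shows "emeasure (eta q) {x..} = of_nat (card {i. x \<le> q i})"
proof -
  have "{x..} \<in> sets pos_borel" using x by (auto simp: sets_pos_borel)
  then have "emeasure (eta q) {x..} = (suminf (\<lambda>i. if 0 < q i then indicator {x..} (q i) else 0))"
    by (rule emeasure_eta)
  also have "\<dots> = (suminf (\<lambda>i. indicator {i. x \<le> q i} i))"
    using x by (intro suminf_cong) (auto simp: indicator_def)
  also have "\<dots> = (\<Sum>i\<in>{i. x \<le> q i}. indicator {i. x \<le> q i} i)"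
    by (rule suminf_finite[OF finite_level(1)[OF q x]]) auto
  also have "\<dots> = (\<Sum>i\<in>{i. x \<le> q i}. 1)" by (intro sum.cong) auto
  finally show ?thesis by simp
qed

lemma eta_eqI:
  assumes "q \<longlonglongrightarrow> 0" "sets \<eta> = sets pos_borel"
    and "\<And>A. A \<in> sets pos_borel \<Longrightarrow> emeasure \<eta> A = atom_sum m (indicator A)"
    and "\<And>x. 0 < x \<Longrightarrow> mult_of q x = m x"
  shows "eta q = \<eta>"
proof (rule measure_eqI)
  show "sets (eta q) = sets \<eta>" using assms by (simp add: sets_eta)
  fix A assume "A \<in> sets (eta q)"
  then have A: "A \<in> sets pos_borel" by (simp add: sets_eta)
  show "emeasure (eta q) A = emeasure \<eta> A"
    unfolding emeasure_eta_mult[OF assms(1) A] assms(3)[OF A]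
    by (intro nn_integral_cong) (simp add: assms(4))
qed

text \<open>The entries of the enumeration are atoms \<open>y\<close> with more than \<open>i\<close> points in \<open>[y, \<infinity>)\<close>.\<close>

lemma exists_enumeration:
  fixes m :: "real \<Rightarrow> nat"
  assumes fin: "\<And>x. 0 < x \<Longrightarrow> finite {y. x \<le> y \<and> m y \<noteq> 0}"
  obtains q where "tail_seq q" "\<And>x. 0 < x \<Longrightarrow> mult_of q x = m x"
proof -
  \<comment> \<open>\<open>N x\<close> counts the points in [x, oo), \<open>N' x\<close> those in
    (x, oo); the indices with value x will be those from \<open>N' x\<close> up to but excluding
    \<open>N x\<close>.\<close>
  define N where "N x = (\<Sum>y | x \<le> y \<and> m y \<noteq> 0. m y)" for x
  define N' where "N' x = (\<Sum>y | x < y \<and> m y \<noteq> 0. m y)" for x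
  define S where "S i = {y. 0 < y \<and> m y \<noteq> 0 \<and> i < N y}" for i
  have fin': "finite {y. x < y \<and> m y \<noteq> 0}" if "0 < x" for x
    using fin[OF that] by (rule rev_finite_subset) auto
  have max: "\<exists>y\<in>S i. \<forall>z\<in>S i. z \<le> y" if ne: "S i \<noteq> {}" for i
  proof -
    obtain a where a: "a \<in> S i" using ne by blast
    let ?T = "{y\<in>S i. a \<le> y}"
    have f: "finite ?T" by (rule finite_subset[OF _ fin[of a]]) (use a in \<open>auto simp: S_def\<close>)
    have "a \<in> ?T" using a by simp
    then have "Max ?T \<in> ?T" "\<And>z. z \<in> ?T \<Longrightarrow> z \<le> Max ?T" using f Max_in by auto
    then show ?thesis by (metis (mono_tags, lifting) mem_Collect_eq order_trans linear)
  qed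
  define q where "q i = (if S i = {} then 0 else SOME y. y \<in> S i \<and> (\<forall>z\<in>S i. z \<le> y))" for i
  have q: "q i \<in> S i \<and> (\<forall>z\<in>S i. z \<le> q i)" if "S i \<noteq> {}" for i
    unfolding q_def using that someI_ex[of "\<lambda>y. y \<in> S i \<and> (\<forall>z\<in>S i. z \<le> y)"] max[OF that] by auto
  have q0: "0 \<le> q i" for i using q[of i] by (cases "S i = {}") (auto simp: q_def S_def)
  have qpos: "q i \<in> S i" if "0 < q i" for i using that q[of i] by (cases "S i = {}") (auto simp: q_def)
  have N_anti: "N b \<le> N a" if "0 < a" "a \<le> b" for a b
    unfolding N_def by (rule sum_mono2[OF fin[OF that(1)]]) (use that in auto)
  have ge: "x \<le> q i \<longleftrightarrow> i < N x" if x: "0 < x" for x i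
  proof
    assume "x \<le> q i"
    then have "i < N (q i)" using qpos[of i] x by (auto simp: S_def)
    also have "N (q i) \<le> N x" by (rule N_anti[OF x]) fact
    finally show "i < N x" .
  next
    assume i: "i < N x"
    \<comment> \<open>Its minimum is the lowest atom at or above x. No atom lies between x and it,
      so \<open>N\<close> has the same value at both.\<close>
    let ?T = "{y. x \<le> y \<and> m y \<noteq> 0}"
    have "?T \<noteq> {}" using i unfolding N_def by (metis sum.empty not_less_zero)
    then have a: "Min ?T \<in> ?T" "\<And>y. y \<in> ?T \<Longrightarrow> Min ?T \<le> y" using fin[OF x] Min_in by auto
    then have "{y. Min ?T \<le> y \<and> m y \<noteq> 0} = ?T" by auto
    then have "N (Min ?T) = N x" by (simp add: N_def)
    then have "Min ?T \<in> S i" using a i x by (auto simp: S_def)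
    then have "Min ?T \<le> q i" using q by blast
    then show "x \<le> q i" using a(1) by simp
  qed
  have gt: "x < q i \<longleftrightarrow> i < N' x" if x: "0 < x" for x i
  proof
    assume lt: "x < q i"
    then have s: "q i \<in> S i" using qpos[of i] x by simp
    have "N (q i) \<le> N' x" unfolding N_def N'_def by (rule sum_mono2[OF fin'[OF x]]) (use lt in auto)
    then show "i < N' x" using s by (auto simp: S_def)
  next
    assume i: "i < N' x"
    let ?T = "{y. x < y \<and> m y \<noteq> 0}"
    have "?T \<noteq> {}" using i unfolding N'_def by (metis sum.empty not_less_zero)
    then have a: "Min ?T \<in> ?T" "\<And>y. y \<in> ?T \<Longrightarrow> Min ?T \<le> y" using fin'[OF x] Min_in by auto
    then have "{y. Min ?T \<le> y \<and> m y \<noteq> 0} = ?T" by auto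
    then have "N (Min ?T) = N' x" by (simp add: N_def N'_def)
    then have "Min ?T \<in> S i" using a i x by (auto simp: S_def)
    then have "Min ?T \<le> q i" using q by blast
    then show "x < q i" using a(1) by simp
  qed
  have "q (Suc i) \<le> q i" for i
  proof (cases "0 < q (Suc i)")
    case True
    then show ?thesis using ge[OF True, of "Suc i"] ge[OF True, of i] by simp
  next
    case False
    then show ?thesis using q0[of i] by simp
  qed
  then have dec: "decseq q" by (rule decseq_SucI)
  have lim: "q \<longlonglongrightarrow> 0"
  proof (rule LIMSEQ_I)
    fix e :: real assume e: "0 < e"
    have "norm (q n - 0) < e" if "N e \<le> n" for n
      using ge[OF e, of n] that q0[of n] by simp
    then show "\<exists>no. \<forall>n\<ge>no. norm (q n - 0) < e" by blast
  qed
  have "mult_of q x = m x" if x: "0 < x" for x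
  proof -
    have "{i. q i = x} = {i. x \<le> q i} - {i. x < q i}" by auto
    also have "\<dots> = {N' x..<N x}" using ge[OF x] gt[OF x] by auto
    finally have "mult_of q x = N x - N' x" by (simp add: mult_of_def)
    also have "N x = N' x + m x"
    proof (cases "m x = 0")
      case True
      then have "{y. x \<le> y \<and> m y \<noteq> 0} = {y. x < y \<and> m y \<noteq> 0}"
        by (auto simp: order_le_less)
      then show ?thesis using True by (simp add: N_def N'_def)
    next
      case False
      then have "{y. x \<le> y \<and> m y \<noteq> 0} = insert x {y. x < y \<and> m y \<noteq> 0}" by (auto simp: order_le_less)
      then show ?thesis using fin'[OF x] by (simp add: N_def N'_def)
    qed
    finally show ?thesis by simp
  qed
  then show thesis using that[of q] dec q0 lim by (auto simp: tail_seq_def)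
qed

lemma ennreal_suminf_mult:
  assumes q: "tail_seq q" and k: "0 < k"
  shows "(suminf (\<lambda>i. ennreal (q i ^ k))) = atom_sum (mult_of q) (\<lambda>x. ennreal (x ^ k))"
proof -
  have "(suminf (\<lambda>i. ennreal (q i ^ k))) = (suminf (\<lambda>i. if 0 < q i then ennreal (q i ^ k) else 0))"
    using q k by (intro suminf_cong) (auto simp: tail_seq_def not_less dest: antisym)
  then show ?thesis
    using q suminf_by_multiplicity[of q "\<lambda>x. ennreal (x ^ k)"] by (simp add: tail_seq_def)
qed

section \<open>Power sums and multiplicities of summable sequences\<close>

definition summable_seq :: "(nat \<Rightarrow> real) \<Rightarrow> bool" where
  "summable_seq q \<longleftrightarrow> decseq q \<and> (\<forall>i. 0 \<le> q i) \<and> summable q"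

lemma summable_seq_tail: "summable_seq q \<Longrightarrow> tail_seq q"
  by (auto simp: summable_seq_def tail_seq_def intro: summable_LIMSEQ_zero)

lemma KK_summable_seq: "(c, q) \<in> KK \<longleftrightarrow> summable_seq q \<and> 0 \<le> c \<and> suminf q \<le> c"
  by (auto simp: KK_def summable_seq_def)

lemma tail_seq_summable_iff:
  assumes "tail_seq q"
  shows "summable_seq q \<longleftrightarrow> atom_sum (mult_of q) ennreal < \<infinity>"
proof -
  have nn: "\<And>i. 0 \<le> q i" using assms by (simp add: tail_seq_def)
  have "(suminf (\<lambda>i. ennreal (q i))) = atom_sum (mult_of q) ennreal"
    using ennreal_suminf_mult[OF assms, of 1] by simp
  moreover have "summable q \<longleftrightarrow> (suminf (\<lambda>i. ennreal (q i))) \<noteq> \<infinity>"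
    using nn summable_suminf_not_top[of q] by (metis ennreal_suminf_neq_top infinity_ennreal_def)
  ultimately show ?thesis using assms by (auto simp: summable_seq_def tail_seq_def less_top)
qed

text \<open>At the first index n where the sequences differ, equal initial entries cancel and high
  powers of the tails are compared: the larger entry grows faster than the whole tail of the other
  sequence.\<close>

lemma power_sums_inj:
  assumes q: "summable_seq q" and r: "summable_seq r"
    and eq: "\<And>k. 2 \<le> k \<Longrightarrow> suminf (\<lambda>i. q i ^ k) = suminf (\<lambda>i. r i ^ k)"
  shows "q = r"
proof
  note D = q[unfolded summable_seq_def] r[unfolded summable_seq_def]
  have main: "s n \<le> t n"
    if s: "summable_seq s" and t: "summable_seq t" and IH: "\<And>i. i < n \<Longrightarrow> s i = t i"
      and eq: "\<And>k. 2 \<le> k \<Longrightarrow> suminf (\<lambda>i. s i ^ k) = suminf (\<lambda>i. t i ^ k)"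
    for s t :: "nat \<Rightarrow> real" and n
  proof (rule ccontr)
    assume "\<not> s n \<le> t n"
    then have lt: "t n < s n" by simp
    have s': "\<And>i. 0 \<le> s i" "summable s" and t': "\<And>i. 0 \<le> t i" "summable t" "decseq t"
      using s t by (auto simp: summable_seq_def)
    have sn: "0 < s n" using lt t'(1)[of n] by simp
    \<comment> \<open>Two powers are set aside to keep the tail summable; the other k are bounded by
      \<open>t n ^ k\<close>, so that \<open>B\<close> does not depend on k.\<close>
    define B where "B = suminf (\<lambda>i. t (i + n) ^ 2)"
    have bound: "s n ^ (k + 2) \<le> t n ^ k * B" for k
    proof -
      have ss: "summable (\<lambda>i. s i ^ (k + 2))" "summable (\<lambda>i. t i ^ (k + 2))" "summable (\<lambda>i. t i ^ 2)"
        by (rule summable_power[OF s'(2) s'(1)] summable_power[OF t'(2) t'(1)], simp)+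
      have tails: "suminf (\<lambda>i. s (i + n) ^ (k + 2)) = suminf (\<lambda>i. t (i + n) ^ (k + 2))"
        using suminf_split_initial_segment[OF ss(1), of n] suminf_split_initial_segment[OF ss(2), of n]
          eq[of "k + 2"] IH by simp
      have ss': "summable (\<lambda>i. s (i + n) ^ (k + 2))" "summable (\<lambda>i. t (i + n) ^ (k + 2))"
          "summable (\<lambda>i. t (i + n) ^ 2)"
        by (rule ss[THEN summable_ignore_initial_segment])+
      have "s n ^ (k + 2) = (\<Sum>i\<in>{0}. s (i + n) ^ (k + 2))" by simp
      also have "\<dots> \<le> suminf (\<lambda>i. s (i + n) ^ (k + 2))"
        by (rule sum_le_suminf[OF ss'(1)]) (use s' in auto)
      also have "\<dots> = suminf (\<lambda>i. t (i + n) ^ (k + 2))" by (rule tails)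
      also have "\<dots> \<le> suminf (\<lambda>i. t n ^ k * t (i + n) ^ 2)"
      proof (rule suminf_le[OF _ ss'(2) summable_mult[OF ss'(3)]])
        fix i
        have "t (i + n) ^ k \<le> t n ^ k"
          using t'(1) decseqD[OF t'(3), of n "i + n"] by (intro power_mono) auto
        then show "t (i + n) ^ (k + 2) \<le> t n ^ k * t (i + n) ^ 2"
          unfolding power_add by (rule mult_right_mono) simp
      qed
      also have "\<dots> = t n ^ k * B" unfolding B_def by (rule suminf_mult[OF ss'(3)])
      finally show ?thesis .
    qed
    show False
    proof (cases "t n = 0")
      case True
      then have "s n ^ (1 + 2) \<le> 0" using bound[of 1] by simp
      then show False using sn zero_less_power[OF sn, of "1 + 2"] by linarith
    next
      case False
      then have tn: "0 < t n" using t'(1)[of n] by simp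
      then have "1 < s n / t n" using lt by simp
      then obtain k where k: "B / s n ^ 2 < (s n / t n) ^ k" using real_arch_pow by blast
      have "t n ^ k * B < s n ^ (k + 2)"
        using k sn tn by (simp add: field_simps power_add power2_eq_square)
      then show False using bound[of k] by simp
    qed
  qed
  fix n
  show "q n = r n"
  proof (induction n rule: less_induct)
    case (less n)
    show ?case
      by (rule antisym; rule main) (use q r less eq in auto)
  qed
qed

lemma ennreal_power_sum:
  assumes t: "summable_seq t" and k: "0 < k"
  shows "ennreal (suminf (\<lambda>i. t i ^ k)) = atom_sum (mult_of t) (\<lambda>x. ennreal (x ^ k))"
proof -
  have "summable (\<lambda>i. t i ^ k)" "\<And>i. 0 \<le> t i ^ k"
    using t k by (auto intro!: summable_power simp: summable_seq_def)
  then have "suminf (\<lambda>i. ennreal (t i ^ k)) = ennreal (suminf (\<lambda>i. t i ^ k))"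
    by (intro suminf_ennreal2) auto
  then show ?thesis using ennreal_suminf_mult[OF summable_seq_tail[OF t] k] by simp
qed

lemma power_sum_nonneg: "summable_seq t \<Longrightarrow> 0 < k \<Longrightarrow> 0 \<le> suminf (\<lambda>i. t i ^ k)"
  by (intro suminf_nonneg summable_power) (auto simp: summable_seq_def)

text \<open>No sorting argument is made: power sums are sums over atoms weighted by multiplicities,
  and they determine the sequence.\<close>

lemma mult_inj:
  assumes q: "summable_seq q" and r: "summable_seq r" and m: "\<And>x. 0 < x \<Longrightarrow> mult_of q x = mult_of r x"
  shows "q = r"
proof (rule power_sums_inj[OF q r])
  fix k :: nat assume "2 \<le> k"
  then have k: "0 < k" by simp
  have "ennreal (suminf (\<lambda>i. q i ^ k)) = ennreal (suminf (\<lambda>i. r i ^ k))"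
    unfolding ennreal_power_sum[OF q k] ennreal_power_sum[OF r k] by (intro nn_integral_cong) (simp add: m)
  then show "suminf (\<lambda>i. q i ^ k) = suminf (\<lambda>i. r i ^ k)"
    using power_sum_nonneg[OF q k] power_sum_nonneg[OF r k] by simp
qed

lemma eta_inj:
  assumes q: "summable_seq q" and r: "summable_seq r" and eq: "eta q = eta r"
  shows "q = r"
proof (rule mult_inj[OF q r])
  fix x :: real assume x: "0 < x"
  have "of_nat (mult_of q x) = (of_nat (mult_of r x) :: ennreal)"
    using eq emeasure_eta_singleton[OF _ x] summable_seq_tail[OF q] summable_seq_tail[OF r]
    unfolding tail_seq_def by metis
  then show "mult_of q x = mult_of r x" by simp
qed

text \<open>The enumeration of the added multiplicities has the defining property of the union. For
  uniqueness, any competitor must first be shown to be summable before multiplicities can identify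
  it.\<close>

lemma mult_union:
  assumes q: "summable_seq q" and r: "summable_seq r"
  shows seq_union_summable: "summable_seq (q \<squnion>\<^sub>q r)"
    and mult_seq_union: "0 < x \<Longrightarrow> mult_of (q \<squnion>\<^sub>q r) x = mult_of q x + mult_of r x"
proof -
  have lim: "q \<longlonglongrightarrow> 0" "r \<longlonglongrightarrow> 0" using q r by (auto dest!: summable_seq_tail simp: tail_seq_def)
  have "finite {y. x \<le> y \<and> mult_of q y + mult_of r y \<noteq> 0}" if x: "0 < x" for x
  proof (rule finite_subset)
    show "{y. x \<le> y \<and> mult_of q y + mult_of r y \<noteq> 0} \<subseteq> q ` {i. x \<le> q i} \<union> r ` {i. x \<le> r i}"
    proof
      fix y assume "y \<in> {y. x \<le> y \<and> mult_of q y + mult_of r y \<noteq> 0}"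
      then have "x \<le> y" "{i. q i = y} \<noteq> {} \<or> {i. r i = y} \<noteq> {}"
        by (auto simp: mult_of_def)
      then show "y \<in> q ` {i. x \<le> q i} \<union> r ` {i. x \<le> r i}" by auto
    qed
  qed (use finite_level(1)[OF lim(1) x] finite_level(1)[OF lim(2) x] in simp)
  then obtain s where s: "tail_seq s" "\<And>x. 0 < x \<Longrightarrow> mult_of s x = mult_of q x + mult_of r x"
    using exists_enumeration[of "\<lambda>x. mult_of q x + mult_of r x"] by blast
  have "atom_sum (mult_of s) ennreal =
      (\<integral>\<^sup>+x. of_nat (mult_of q x) * ennreal x + of_nat (mult_of r x) * ennreal x \<partial>count_space {0<..})"
    by (intro nn_integral_cong) (simp add: s(2) distrib_right)
  also have "\<dots> = atom_sum (mult_of q) ennreal +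
      atom_sum (mult_of r) ennreal"
    by (rule nn_integral_add) auto
  finally have summ: "summable_seq s"
    using tail_seq_summable_iff[OF s(1)] tail_seq_summable_iff[OF summable_seq_tail[OF q]]
      tail_seq_summable_iff[OF summable_seq_tail[OF r]] q r by simp
  have "q \<squnion>\<^sub>q r = s"
    unfolding seq_union_def
  proof (rule the_equality)
    show "decseq s \<and> (\<forall>i. 0 \<le> s i) \<and> (\<forall>x>0. finite {i. s i = x} \<and>
        card {i. s i = x} = card {i. q i = x} + card {i. r i = x})"
      using s finite_level(2)[of s] by (auto simp: tail_seq_def mult_of_def)
    fix s' assume s': "decseq s' \<and> (\<forall>i. 0 \<le> s' i) \<and> (\<forall>x>0. finite {i. s' i = x} \<and>
        card {i. s' i = x} = card {i. q i = x} + card {i. r i = x})"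
    \<comment> \<open>If the competitor stayed at or above some e > 0, its values would lie among
      the finitely many entries of \<open>q\<close> and \<open>r\<close> in [e, oo), and one of them
      would be taken infinitely often, against the finite level sets.\<close>
    have lim': "s' \<longlonglongrightarrow> 0"
    proof (rule LIMSEQ_I)
      fix e :: real assume e: "0 < e"
      have "\<exists>n. s' n < e"
      proof (rule ccontr)
        assume *: "\<not> (\<exists>n. s' n < e)"
        have atoms: "s' i \<in> q ` {i. e \<le> q i} \<union> r ` {i. e \<le> r i}" for i
        proof -
          have si: "e \<le> s' i" using * by (meson not_less)
          then have "finite {j. s' j = s' i}" "card {j. s' j = s' i} = card {j. q j = s' i} + card {j. r j = s' i}"
            using s' e by auto
          moreover have "i \<in> {j. s' j = s' i}" by simp
          ultimately have "card {j. q j = s' i} + card {j. r j = s' i} \<noteq> 0"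
            by (metis card_0_eq empty_iff)
          then have "{j. q j = s' i} \<noteq> {} \<or> {j. r j = s' i} \<noteq> {}" by (metis add.right_neutral card.empty)
          then show ?thesis using si by (auto simp: image_iff) metis+
        qed
        have "finite (s' -` {s' i})" for i
        proof -
          have "e \<le> s' i" using * by (meson not_less)
          then show ?thesis using s' e by (simp add: vimage_def)
        qed
        moreover have "finite (range s')"
          by (rule finite_subset[of _ "q ` {i. e \<le> q i} \<union> r ` {i. e \<le> r i}"])
            (use atoms finite_level(1)[OF lim(1) e] finite_level(1)[OF lim(2) e] in auto)
        ultimately show False using inf_img_fin_dom[of s' UNIV] by auto
      qed
      then obtain n where "s' n < e" by blast
      then have "norm (s' k - 0) < e" if "n \<le> k" for k
        using s' decseqD[of s' n k] that by fastforce
      then show "\<exists>no. \<forall>n\<ge>no. norm (s' n - 0) < e" by blast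
    qed
    have m: "mult_of s' x = mult_of s x" if "0 < x" for x
      using s' s(2) that by (simp add: mult_of_def)
    have "tail_seq s'" using s' lim' by (simp add: tail_seq_def)
    moreover have "atom_sum (mult_of s') ennreal = atom_sum (mult_of s) ennreal"
      by (intro nn_integral_cong) (simp add: m)
    ultimately have "summable_seq s'"
      using summ tail_seq_summable_iff[OF s(1)] tail_seq_summable_iff[of s'] by simp
    then show "s' = s" by (rule mult_inj[OF _ summ m])
  qed
  then show "summable_seq (q \<squnion>\<^sub>q r)" "0 < x \<Longrightarrow> mult_of (q \<squnion>\<^sub>q r) x = mult_of q x + mult_of r x"
    using summ s(2) by auto
qed


section \<open>The monoid isomorphism and convolution roots\<close>

lemma suminf_power_union:
  assumes q: "summable_seq q" and r: "summable_seq r" and k: "0 < k"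
  shows "suminf (\<lambda>i. (q \<squnion>\<^sub>q r) i ^ k) = suminf (\<lambda>i. q i ^ k) + suminf (\<lambda>i. r i ^ k)"
proof -
  note s = seq_union_summable[OF q r]
  note nn = power_sum_nonneg[OF q k] power_sum_nonneg[OF r k]
  have "ennreal (suminf (\<lambda>i. (q \<squnion>\<^sub>q r) i ^ k)) = (\<integral>\<^sup>+x. of_nat (mult_of q x) * ennreal (x ^ k) +
      of_nat (mult_of r x) * ennreal (x ^ k) \<partial>count_space {0<..})"
    unfolding ennreal_power_sum[OF s k] by (intro nn_integral_cong) (simp add: mult_seq_union[OF q r] distrib_right)
  also have "\<dots> = ennreal (suminf (\<lambda>i. q i ^ k)) + ennreal (suminf (\<lambda>i. r i ^ k))"
    unfolding ennreal_power_sum[OF q k] ennreal_power_sum[OF r k] by (rule nn_integral_add) auto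
  also have "\<dots> = ennreal (suminf (\<lambda>i. q i ^ k) + suminf (\<lambda>i. r i ^ k))"
    using nn by (rule ennreal_plus[symmetric])
  finally show ?thesis
    using nn power_sum_nonneg[OF s k] by (subst (asm) ennreal_inj) auto
qed

lemma suminf_union:
  assumes "summable_seq q" "summable_seq r"
  shows "suminf (q \<squnion>\<^sub>q r) = suminf q + suminf r"
  using suminf_power_union[OF assms, of 1] by simp

lemma summable_seq_zero: "summable_seq (\<lambda>_. 0)"
  by (simp add: summable_seq_def decseq_def)

lemma mult_of_zero: "0 < x \<Longrightarrow> mult_of (\<lambda>_. 0) x = 0"
  by (simp add: mult_of_def)

lemma seq_union_laws:
  assumes q: "summable_seq q" and r: "summable_seq r"
  shows seq_union_commute: "q \<squnion>\<^sub>q r = r \<squnion>\<^sub>q q"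
    and seq_union_assoc: "summable_seq s \<Longrightarrow> q \<squnion>\<^sub>q r \<squnion>\<^sub>q s = q \<squnion>\<^sub>q (r \<squnion>\<^sub>q s)"
    and seq_union_zero: "(\<lambda>_. 0) \<squnion>\<^sub>q q = q"
  using q r by (auto intro!: mult_inj seq_union_summable summable_seq_zero
      simp: mult_seq_union seq_union_summable summable_seq_zero mult_of_zero)

lemma comm_monoid_KK: "comm_monoid KK_monoid"
proof (rule comm_monoidI)
  fix x y z assume "x \<in> carrier KK_monoid" "y \<in> carrier KK_monoid" "z \<in> carrier KK_monoid"
  then show "x \<otimes>\<^bsub>KK_monoid\<^esub> y \<otimes>\<^bsub>KK_monoid\<^esub> z = x \<otimes>\<^bsub>KK_monoid\<^esub> (y \<otimes>\<^bsub>KK_monoid\<^esub> z)"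
    by (cases x; cases y; cases z) (auto simp: KK_monoid_def KK_summable_seq seq_union_assoc)
qed (auto simp: KK_monoid_def KK_summable_seq summable_seq_zero seq_union_summable suminf_union
    intro: seq_union_commute seq_union_zero)

section \<open>Decreasing sequences and integrable point measures\<close>

lemma eta_eq_distr: "eta q = distr (count_space {i. 0 < q i}) pos_borel q"
proof (rule measure_eqI)
  show "sets (eta q) = sets (distr (count_space {i. 0 < q i}) pos_borel q)" by (simp add: sets_eta)
  fix A assume "A \<in> sets (eta q)"
  then have A: "A \<in> sets pos_borel" by (simp add: sets_eta)
  have m: "q \<in> count_space {i. 0 < q i} \<rightarrow>\<^sub>M pos_borel"
    by (auto simp: space_pos_borel)
  have "emeasure (distr (count_space {i. 0 < q i}) pos_borel q) A =
      (\<integral>\<^sup>+i. indicator A (q i) \<partial>count_space {i. 0 < q i})"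
    using A m by (simp add: nn_integral_distr flip: nn_integral_indicator)
  also have "\<dots> = (\<integral>\<^sup>+i. (if 0 < q i then indicator A (q i) else 0) \<partial>count_space UNIV)"
    by (subst nn_integral_count_space_indicator) (auto intro!: nn_integral_cong simp: indicator_def)
  also have "\<dots> = emeasure (eta q) A"
    unfolding emeasure_eta[OF A] by (rule nn_integral_count_space_nat)
  finally show "emeasure (eta q) A = emeasure (distr (count_space {i. 0 < q i}) pos_borel q) A" ..
qed

lemma ennreal_measurable_pos_borel: "ennreal \<in> borel_measurable pos_borel"
  unfolding pos_borel_def by (rule measurable_restrict_space1) simp

lemma nn_integral_eta:
  assumes "\<And>i. 0 \<le> q i"
  shows "(\<integral>\<^sup>+x. ennreal x \<partial>eta q) = suminf (\<lambda>i. ennreal (q i))"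
proof -
  have m: "q \<in> count_space {i. 0 < q i} \<rightarrow>\<^sub>M pos_borel"
    by (auto simp: space_pos_borel)
  have "(\<integral>\<^sup>+x. ennreal x \<partial>eta q) = (\<integral>\<^sup>+i. ennreal (q i) \<partial>count_space {i. 0 < q i})"
    unfolding eta_eq_distr by (rule nn_integral_distr[OF m]) (simp add: ennreal_measurable_pos_borel)
  also have "\<dots> = (\<integral>\<^sup>+i. ennreal (q i) \<partial>count_space UNIV)"
  proof (subst nn_integral_count_space_indicator, goal_cases)
    case 2
    have "q i = 0" if "\<not> 0 < q i" for i using assms[of i] that by simp
    then show ?case by (intro nn_integral_cong) (auto simp: indicator_def)
  qed simp
  also have "\<dots> = suminf (\<lambda>i. ennreal (q i))" by (rule nn_integral_count_space_nat)
  finally show ?thesis .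
qed

lemma eta_in_N1:
  assumes q: "summable_seq q"
  shows "eta q \<in> N1"
proof -
  have lim: "q \<longlonglongrightarrow> 0" using summable_seq_tail[OF q] by (simp add: tail_seq_def)
  have "emeasure (eta q) C < \<infinity>" if C: "compact C" "C \<subseteq> {0<..}" for C
  proof (cases "C = {}")
    case False
    \<comment> \<open>The least element is positive, so the compact set lies in a half-line [x, oo),
      which carries finitely many points.\<close>
    then obtain x where x: "x \<in> C" "\<And>y. y \<in> C \<Longrightarrow> x \<le> y" using compact_attains_inf[OF C(1)] by blast
    then have x0: "0 < x" using C by auto
    then have "{x..} \<in> sets (eta q)" by (auto simp: sets_eta sets_pos_borel)
    then have "emeasure (eta q) C \<le> emeasure (eta q) {x..}"
      by (rule emeasure_mono[rotated]) (use x in auto)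
    also have "\<dots> < \<infinity>" by (simp add: card_level_eta[OF lim x0] of_nat_less_top)
    finally show ?thesis .
  qed simp
  moreover have "(\<integral>\<^sup>+x. ennreal x \<partial>eta q) < \<infinity>"
  proof -
    have "(\<integral>\<^sup>+x. ennreal x \<partial>eta q) = ennreal (suminf q)"
      using q by (subst nn_integral_eta) (auto simp: summable_seq_def intro!: suminf_ennreal2)
    then show ?thesis by simp
  qed
  ultimately show ?thesis
    unfolding N1_def point_measures_def using emeasure_eta_mult[OF lim] by (auto simp: sets_eta)
qed

lemma N1_eta:
  assumes "\<eta> \<in> N1"
  obtains q where "summable_seq q" "\<eta> = eta q"
proof -
  obtain m :: "real \<Rightarrow> nat" where sets: "sets \<eta> = sets pos_borel"
    and m: "\<And>A. A \<in> sets pos_borel \<Longrightarrow> emeasure \<eta> A = atom_sum m (indicator A)"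
    and int: "(\<integral>\<^sup>+x. ennreal x \<partial>\<eta>) < \<infinity>"
    using assms unfolding N1_def point_measures_def by blast
  have meas: "ennreal \<in> borel_measurable \<eta>"
    using ennreal_measurable_pos_borel measurable_cong_sets[OF sets refl] by blast
  have "finite {y. x \<le> y \<and> m y \<noteq> 0}" if x: "0 < x" for x
  proof (rule ccontr)
    let ?T = "{y. x \<le> y \<and> m y \<noteq> 0}"
    assume inf: "infinite ?T"
    have X: "{x..} \<in> sets pos_borel" using x by (auto simp: sets_pos_borel)
    \<comment> \<open>Each atom has multiplicity at least 1, so infinitely many of them in [x, oo)
      give infinite mass there; the Markov inequality below then contradicts the finite
      integral.\<close>
    have "\<infinity> = emeasure (count_space {0<..}) ?T"
      using inf x by (subst emeasure_count_space_infinite) auto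
    also have "\<dots> = (\<integral>\<^sup>+y. indicator ?T y \<partial>count_space {0<..})"
      using x by (subst nn_integral_indicator) auto
    also have "\<dots> \<le> (\<integral>\<^sup>+y. of_nat (m y) * indicator {x..} y \<partial>count_space {0<..})"
    proof (rule nn_integral_mono)
      fix y
      show "indicator ?T y \<le> (of_nat (m y) * indicator {x..} y :: ennreal)"
        by (cases "m y") (auto simp: indicator_def)
    qed
    also have "\<dots> = emeasure \<eta> {x..}" using m[OF X] by simp
    finally have top: "emeasure \<eta> {x..} = \<infinity>" by (simp add: top_unique)
    have "ennreal x * emeasure \<eta> {x..} = (\<integral>\<^sup>+y. ennreal x * indicator {x..} y \<partial>\<eta>)"
      using X sets by (simp add: nn_integral_cmult_indicator)
    also have "\<dots> \<le> (\<integral>\<^sup>+y. ennreal y \<partial>\<eta>)"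
      by (rule nn_integral_mono) (auto simp: indicator_def intro: ennreal_leI)
    finally show False using int top x by (simp add: ennreal_mult_top top_unique)
  qed
  then obtain q where q: "tail_seq q" "\<And>x. 0 < x \<Longrightarrow> mult_of q x = m x"
    using exists_enumeration[of m] by blast
  have lim: "q \<longlonglongrightarrow> 0" and nn: "\<And>i. 0 \<le> q i" using q by (auto simp: tail_seq_def)
  have eta: "eta q = \<eta>" by (rule eta_eqI[OF lim sets m q(2)])
  have "suminf (\<lambda>i. ennreal (q i)) < \<infinity>"
    using int nn_integral_eta[of q, OF nn] unfolding eta by simp
  then have "summable_seq q"
    using tail_seq_summable_iff[OF q(1)] ennreal_suminf_mult[OF q(1), of 1] by simp
  then show thesis using that eta by blast
qed

lemma sets_add_measure: "sets (add_measure M N) = sets M"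
  unfolding add_measure_def by (rule sets.sets_measure_of_eq)

lemma eta_union:
  assumes q: "summable_seq q" and r: "summable_seq r"
  shows "eta (q \<squnion>\<^sub>q r) = add_measure (eta q) (eta r)"
proof (rule eta_eqI[where m = "\<lambda>x. mult_of q x + mult_of r x"])
  have lim: "q \<longlonglongrightarrow> 0" "r \<longlonglongrightarrow> 0" using q r by (auto dest!: summable_seq_tail simp: tail_seq_def)
  show "q \<squnion>\<^sub>q r \<longlonglongrightarrow> 0"
    using summable_seq_tail[OF seq_union_summable[OF q r]] by (simp add: tail_seq_def)
  show "sets (add_measure (eta q) (eta r)) = sets pos_borel" by (simp add: sets_add_measure sets_eta)
  show "mult_of (q \<squnion>\<^sub>q r) x = mult_of q x + mult_of r x" if "0 < x" for x
    by (rule mult_seq_union[OF q r that])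
  fix A assume A: "A \<in> sets pos_borel"
  have "emeasure (add_measure (eta q) (eta r)) A = emeasure (eta q) A + emeasure (eta r) A"
    using A by (intro emeasure_add_measure) (simp_all add: sets_eta)
  also have "\<dots> = (\<integral>\<^sup>+x. of_nat (mult_of q x) * indicator A x + of_nat (mult_of r x) * indicator A x
      \<partial>count_space {0<..})"
    unfolding emeasure_eta_mult[OF lim(1) A] emeasure_eta_mult[OF lim(2) A]
    by (rule nn_integral_add[symmetric]) auto
  finally show "emeasure (add_measure (eta q) (eta r)) A =
      (\<integral>\<^sup>+x. of_nat (mult_of q x + mult_of r x) * indicator A x \<partial>count_space {0<..})"
    by (simp add: distrib_right)
qed

lemma eta_zero: "eta (\<lambda>_. 0) = null_measure pos_borel"
  by (rule measure_eqI) (simp_all add: sets_eta emeasure_eta)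

lemma comm_monoid_N1: "comm_monoid N1_monoid"
proof -
  have carrier: "carrier N1_monoid = eta ` {q. summable_seq q}"
    by (auto simp: N1_monoid_def eta_in_N1 elim: N1_eta)
  show ?thesis
  proof (rule comm_monoidI)
    show "\<one>\<^bsub>N1_monoid\<^esub> \<in> carrier N1_monoid"
      unfolding carrier by (auto simp: N1_monoid_def summable_seq_zero simp flip: eta_zero)
    fix x y assume "x \<in> carrier N1_monoid" "y \<in> carrier N1_monoid"
    then obtain q r where qr: "summable_seq q" "summable_seq r" "x = eta q" "y = eta r"
      unfolding carrier by blast
    show "x \<otimes>\<^bsub>N1_monoid\<^esub> y \<in> carrier N1_monoid"
      using qr seq_union_summable unfolding carrier by (auto simp: N1_monoid_def simp flip: eta_union)
    show "x \<otimes>\<^bsub>N1_monoid\<^esub> y = y \<otimes>\<^bsub>N1_monoid\<^esub> x"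
      using qr seq_union_commute[of q r] by (simp add: N1_monoid_def flip: eta_union)
    show "\<one>\<^bsub>N1_monoid\<^esub> \<otimes>\<^bsub>N1_monoid\<^esub> x = x"
      using qr seq_union_zero[of q r] by (simp add: N1_monoid_def summable_seq_zero flip: eta_zero eta_union)
    fix z assume "z \<in> carrier N1_monoid"
    then obtain s where s: "summable_seq s" "z = eta s" unfolding carrier by blast
    show "x \<otimes>\<^bsub>N1_monoid\<^esub> y \<otimes>\<^bsub>N1_monoid\<^esub> z = x \<otimes>\<^bsub>N1_monoid\<^esub> (y \<otimes>\<^bsub>N1_monoid\<^esub> z)"
      using qr s seq_union_assoc[of q r s]
      by (simp add: N1_monoid_def seq_union_summable flip: eta_union)
  qed
qed

lemma comm_monoid_Rnonneg: "comm_monoid Rnonneg_monoid"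
  by (rule comm_monoidI) (auto simp: Rnonneg_monoid_def)

lemma comm_monoid_target: "comm_monoid (Rnonneg_monoid \<times>\<times> N1_monoid)"
proof -
  interpret R: comm_monoid Rnonneg_monoid by (rule comm_monoid_Rnonneg)
  interpret N: comm_monoid N1_monoid by (rule comm_monoid_N1)
  show ?thesis
    by (rule comm_monoidI) (auto simp: DirProd_def R.m_assoc N.m_assoc intro: R.m_comm N.m_comm)
qed

lemma dust_eta_iso: "(\<lambda>(c, q). (dust c q, eta q)) \<in> iso KK_monoid (Rnonneg_monoid \<times>\<times> N1_monoid)"
proof (rule isoI)
  show "(\<lambda>(c, q). (dust c q, eta q)) \<in> hom KK_monoid (Rnonneg_monoid \<times>\<times> N1_monoid)"
    by (rule homI) (auto simp: KK_monoid_def DirProd_def Rnonneg_monoid_def N1_monoid_def KK_summable_seq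
        dust_def eta_in_N1 eta_union suminf_union)
  show "bij_betw (\<lambda>(c, q). (dust c q, eta q)) (carrier KK_monoid) (carrier (Rnonneg_monoid \<times>\<times> N1_monoid))"
  proof (rule bij_betw_imageI)
    show "inj_on (\<lambda>(c, q). (dust c q, eta q)) (carrier KK_monoid)"
    proof (rule inj_onI, clarsimp simp: KK_monoid_def)
      fix c q c' r assume K: "(c, q) \<in> KK" "(c', r) \<in> KK" and eq: "dust c q = dust c' r" "eta q = eta r"
      then have "q = r" by (intro eta_inj) (auto simp: KK_summable_seq)
      then show "c = c' \<and> q = r" using eq by (simp add: dust_def)
    qed
    show "(\<lambda>(c, q). (dust c q, eta q)) ` carrier KK_monoid = carrier (Rnonneg_monoid \<times>\<times> N1_monoid)"
    proof (intro equalityI subsetI)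
      fix x assume "x \<in> (\<lambda>(c, q). (dust c q, eta q)) ` carrier KK_monoid"
      then show "x \<in> carrier (Rnonneg_monoid \<times>\<times> N1_monoid)"
        by (auto simp: KK_monoid_def DirProd_def Rnonneg_monoid_def N1_monoid_def KK_summable_seq dust_def eta_in_N1)
    next
      fix x assume "x \<in> carrier (Rnonneg_monoid \<times>\<times> N1_monoid)"
      then obtain d \<eta> where x: "x = (d, \<eta>)" "0 \<le> d" "\<eta> \<in> N1"
        by (auto simp: DirProd_def Rnonneg_monoid_def N1_monoid_def)
      obtain q where q: "summable_seq q" "\<eta> = eta q" using N1_eta[OF x(3)] .
      have "0 \<le> suminf q" using q(1) by (auto simp: summable_seq_def intro: suminf_nonneg)
      then have "(d + suminf q, q) \<in> KK" using x q by (simp add: KK_summable_seq)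
      then show "x \<in> (\<lambda>(c, q). (dust c q, eta q)) ` carrier KK_monoid"
        using x q by (intro image_eqI[of _ _ "(d + suminf q, q)"]) (auto simp: KK_monoid_def dust_def)
    qed
  qed
qed

lemma zero_seq_KK: "(c, \<lambda>_. 0) \<in> KK \<longleftrightarrow> 0 \<le> c"
  by (auto simp: KK_summable_seq summable_seq_zero)

lemma power_sums_zero: "0 < k \<Longrightarrow> power_sums c (\<lambda>_. 0) k = (if k = 1 then c else 0)"
  by (simp add: power_sums_def power_0_left)

lemma single_seq_sums: "0 < k \<Longrightarrow> (\<lambda>i. single_seq a i ^ k) sums a ^ k"
  using sums_finite[of "{0}" "\<lambda>i. single_seq a i ^ k"] by (simp add: single_seq_def)

lemma single_seq_KK: "0 \<le> a \<Longrightarrow> (a, single_seq a) \<in> KK"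
  using single_seq_sums[of 1 a] by (auto simp: KK_def sums_iff single_seq_def decseq_def)

lemma power_sums_single: "0 < k \<Longrightarrow> power_sums a (single_seq a) k = a ^ k"
  using single_seq_sums[of k a] by (auto simp: power_sums_def sums_iff)

text \<open>The partial products have as power values the partial sums of q_i^k, plus the dust when
  k = 1. These converge to the power sums of (c, q), and convergence of power values is pointwise
  convergence of characters.\<close>

lemma Psi_factorization:
  assumes K: "(c, q) \<in> KK"
  shows "(\<lambda>L. foldl (\<star>) (Psi (dust c q) (\<lambda>_. 0))
      (map (\<lambda>i. Psi (q i) (single_seq (q i))) [0..<L]) (gl_basis t)) \<longlonglongrightarrow> Psi c q (gl_basis t)"
proof -
  note q = KK_D[OF K]
  define \<phi> where "\<phi> L = foldl (\<star>) (Psi (dust c q) (\<lambda>_. 0)) (map (\<lambda>i. Psi (q i) (single_seq (q i))) [0..<L])" for L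
  have d: "0 \<le> dust c q" using q by (simp add: dust_def)
  have \<phi>: "ubp_character (\<phi> L) \<and>
      (\<forall>k>0. power_value (\<phi> L) k = (if k = 1 then dust c q else 0) + (\<Sum>i<L. q i ^ k))" for L
  proof (induction L)
    case 0
    then show ?case using d by (simp add: \<phi>_def Psi_ubp zero_seq_KK power_sums_zero)
  next
    case (Suc L)
    have "\<phi> (Suc L) = \<phi> L \<star> Psi (q L) (single_seq (q L))" by (simp add: \<phi>_def)
    then show ?case
      using Suc q by (simp add: ubp_convolve power_value_convolve Psi_ubp single_seq_KK power_sums_single)
  qed
  have lim: "(\<lambda>L. power_value (\<phi> L) k) \<longlonglongrightarrow> power_sums c q k" if k: "0 < k" for k
  proof -
    have "(\<lambda>L. (if k = 1 then dust c q else 0) + (\<Sum>i<L. q i ^ k)) \<longlonglongrightarrow>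
        (if k = 1 then dust c q else 0) + suminf (\<lambda>i. q i ^ k)"
      by (intro tendsto_add tendsto_const summable_LIMSEQ summable_power) (use q k in auto)
    then show ?thesis using \<phi> k by (auto simp: power_sums_def dust_def)
  qed
  obtain \<psi> where \<psi>: "ubp_character \<psi>" "\<And>t. (\<lambda>L. \<phi> L (gl_basis t)) \<longlonglongrightarrow> \<psi> (gl_basis t)"
      "\<And>k. 0 < k \<Longrightarrow> power_value \<psi> k = power_sums c q k"
    using ubp_limit[of \<phi> "power_sums c q"] \<phi> lim by blast
  have "\<psi> = Psi c q" by (rule ubp_eqI) (use \<psi> Psi_ubp[OF K] in auto)
  then show ?thesis using \<psi>(2) by (simp add: \<phi>_def)
qed

section \<open>Repetition, division of multiplicities and convolution roots\<close>

lemma repeat_seq: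
  assumes r: "summable_seq r" and n: "0 < n"
  shows summable_repeat: "summable_seq (\<lambda>i. r (i div n))"
    and mult_repeat: "mult_of (\<lambda>i. r (i div n)) x = n * mult_of r x"
    and suminf_repeat: "0 < k \<Longrightarrow> suminf (\<lambda>i. r (i div n) ^ k) = real n * suminf (\<lambda>i. r i ^ k)"
proof -
  let ?s = "\<lambda>i. r (i div n)"
  have mult: "mult_of ?s x = n * mult_of r x" for x
  proof -
    have "bij_betw (\<lambda>(j, l). j * n + l) ({j. r j = x} \<times> {..<n}) {i. r (i div n) = x}"
      by (rule bij_betwI[where g = "\<lambda>i. (i div n, i mod n)"]) (use n in auto)
    then have "card {i. r (i div n) = x} = card ({j. r j = x} \<times> {..<n})" by (metis bij_betw_same_card)
    then show ?thesis by (simp add: mult_of_def card_cartesian_product mult.commute)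
  qed
  have r': "decseq r" "\<And>i. 0 \<le> r i" "summable r" "r \<longlonglongrightarrow> 0"
    using r summable_seq_tail[OF r] by (auto simp: summable_seq_def tail_seq_def)
  have "filterlim (\<lambda>i. i div n) at_top sequentially"
    using n by (simp add: filterlim_at_top eventually_sequentially)
      (metis div_le_mono nonzero_mult_div_cancel_right not_gr_zero)
  then have "?s \<longlonglongrightarrow> 0" by (rule filterlim_compose[OF r'(4)])
  moreover have "decseq ?s"
    using r'(1) by (auto simp: decseq_def div_le_mono)
  ultimately have tail: "tail_seq ?s" using r' by (simp add: tail_seq_def)
  have int: "atom_sum (mult_of ?s) f = of_nat n * atom_sum (mult_of r) f" for f
    unfolding mult by (subst nn_integral_cmult[symmetric]) (auto simp: mult.assoc)
  show summ: "summable_seq ?s"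
    using r tail_seq_summable_iff[OF tail] tail_seq_summable_iff[OF summable_seq_tail[OF r]]
    unfolding int by (simp add: ennreal_mult_less_top of_nat_less_top)
  show "mult_of ?s x = n * mult_of r x" by (rule mult)
  assume k: "0 < k"
  have "ennreal (suminf (\<lambda>i. ?s i ^ k)) = ennreal (real n * suminf (\<lambda>i. r i ^ k))"
    using power_sum_nonneg[OF r k] unfolding ennreal_power_sum[OF summ k] int
    by (simp add: ennreal_mult ennreal_power_sum[OF r k] ennreal_of_nat_eq_real_of_nat)
  then show "suminf (\<lambda>i. ?s i ^ k) = real n * suminf (\<lambda>i. r i ^ k)"
    using power_sum_nonneg[OF summ k] power_sum_nonneg[OF r k] by simp
qed

lemma multiplicities_divisible_iff:
  assumes "q \<longlonglongrightarrow> 0"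
  shows "multiplicities_divisible n (eta q) \<longleftrightarrow> (\<forall>x>0. n dvd mult_of q x)"
  using emeasure_eta_singleton[OF assms]
  by (force simp: multiplicities_divisible_def space_eta)

lemma eta_scale_iff:
  assumes q: "q \<longlonglongrightarrow> 0" and r: "r \<longlonglongrightarrow> 0" and n: "0 < n"
  shows "eta r = scale_measure (ennreal (1 / real n)) (eta q) \<longleftrightarrow> (\<forall>x>0. mult_of q x = n * mult_of r x)"
proof
  assume eq: "eta r = scale_measure (ennreal (1 / real n)) (eta q)"
  show "\<forall>x>0. mult_of q x = n * mult_of r x"
  proof (intro allI impI)
    fix x :: real assume x: "0 < x"
    have "of_nat (mult_of r x) = ennreal (1 / real n) * of_nat (mult_of q x)"
      using arg_cong[OF eq, of "\<lambda>M. emeasure M {x}"] x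
      by (simp add: emeasure_eta_singleton q r)
    then have "ennreal (real (mult_of r x)) = ennreal (real (mult_of q x) / real n)"
      by (simp add: ennreal_of_nat_eq_real_of_nat ennreal_mult[symmetric])
    then have "real (mult_of r x) = real (mult_of q x) / real n"
      by (subst (asm) ennreal_inj) auto
    then have "real (mult_of q x) = real (n * mult_of r x)" using n by (simp add: field_simps)
    then show "mult_of q x = n * mult_of r x" by (simp only: of_nat_eq_iff)
  qed
next
  have n1: "ennreal (1 / real n) * of_nat n = 1"
    using n by (simp add: ennreal_of_nat_eq_real_of_nat ennreal_mult[symmetric])
  assume eq: "\<forall>x>0. mult_of q x = n * mult_of r x"
  show "eta r = scale_measure (ennreal (1 / real n)) (eta q)"
  proof (rule eta_eqI[OF r, where m = "mult_of r"])
    fix A assume A: "A \<in> sets pos_borel"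
    have "emeasure (scale_measure (ennreal (1 / real n)) (eta q)) A =
        (\<integral>\<^sup>+x. ennreal (1 / real n) * (of_nat (mult_of q x) * indicator A x) \<partial>count_space {0<..})"
      by (simp add: emeasure_eta_mult[OF q A] nn_integral_cmult)
    also have "\<dots> = atom_sum (mult_of r) (indicator A)"
      using eq by (intro nn_integral_cong) (simp add: n1 flip: mult.assoc)
    finally show "emeasure (scale_measure (ennreal (1 / real n)) (eta q)) A =
        atom_sum (mult_of r) (indicator A)" .
  qed (auto simp: sets_eta)
qed

text \<open>The divided multiplicities are enumerated; they are dominated by those of
  \<open>q\<close>, which yields finiteness above each x > 0 and summability.\<close>

lemma divided_seq:
  assumes q: "summable_seq q" and n: "0 < n" and dvd: "\<And>x. 0 < x \<Longrightarrow> n dvd mult_of q x"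
  obtains r where "summable_seq r" "\<And>x. 0 < x \<Longrightarrow> mult_of q x = n * mult_of r x"
proof -
  have lim: "q \<longlonglongrightarrow> 0" using summable_seq_tail[OF q] by (simp add: tail_seq_def)
  have "finite {y. x \<le> y \<and> mult_of q y div n \<noteq> 0}" if x: "0 < x" for x
  proof (rule finite_subset)
    show "{y. x \<le> y \<and> mult_of q y div n \<noteq> 0} \<subseteq> q ` {i. x \<le> q i}"
    proof
      fix y assume "y \<in> {y. x \<le> y \<and> mult_of q y div n \<noteq> 0}"
      then have y: "x \<le> y" "mult_of q y div n \<noteq> 0" by simp_all
      have "{i. q i = y} \<noteq> {}"
      proof
        assume "{i. q i = y} = {}"
        then have "mult_of q y = 0" unfolding mult_of_def by (simp only: card.empty)
        then show False using y by simp
      qed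
      then show "y \<in> q ` {i. x \<le> q i}" using y(1) by auto
    qed
  qed (use finite_level(1)[OF lim x] in simp)
  then obtain r where r: "tail_seq r" "\<And>x. 0 < x \<Longrightarrow> mult_of r x = mult_of q x div n"
    using exists_enumeration[of "\<lambda>x. mult_of q x div n"] by blast
  have "atom_sum (mult_of r) ennreal \<le>
      atom_sum (mult_of q) ennreal"
    by (intro nn_integral_mono mult_right_mono) (auto simp: r(2))
  then have "summable_seq r"
    using tail_seq_summable_iff[OF r(1)] tail_seq_summable_iff[OF summable_seq_tail[OF q]] q
    by (simp add: order.strict_trans1)
  moreover have "mult_of q x = n * mult_of r x" if "0 < x" for x
    using r(2)[OF that] dvd[OF that] by simp
  ultimately show thesis using that by blast
qed

lemma power_sums_divided:
  assumes q: "summable_seq q" and r: "summable_seq r" and n: "0 < n"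
    and m: "\<And>x. 0 < x \<Longrightarrow> mult_of q x = n * mult_of r x" and k: "0 < k"
  shows "suminf (\<lambda>i. q i ^ k) = real n * suminf (\<lambda>i. r i ^ k)"
proof -
  have "q = (\<lambda>i. r (i div n))"
    by (rule mult_inj[OF q summable_repeat[OF r n]]) (simp add: m mult_repeat[OF r n])
  then show ?thesis using suminf_repeat[OF r n k] by simp
qed

lemma conv_root_divides:
  assumes K: "(c, q) \<in> KK" and n: "0 < n" and root: "conv_root n (Psi c q) \<Xi>"
  shows "multiplicities_divisible n (eta q)"
proof -
  have \<Xi>: "ubp_character \<Xi>" "conv_power \<Xi> n = Psi c q" using root by (auto simp: conv_root_def)
  obtain c' r where r: "(c', r) \<in> KK" "\<Xi> = Psi c' r" using ubp_classify[OF \<Xi>(1)] .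
  have sq: "summable_seq q" and sr: "summable_seq r" using K r by (auto simp: KK_summable_seq)
  have "suminf (\<lambda>i. q i ^ k) = suminf (\<lambda>i. r (i div n) ^ k)" if k: "2 \<le> k" for k
  proof -
    have "power_value (Psi c q) k = real n * power_value \<Xi> k"
      using ubp_conv_power(2)[OF \<Xi>(1), of k n] \<Xi>(2) k by simp
    then have "power_sums c q k = real n * power_sums c' r k"
      using Psi_ubp(2)[OF K, of k] Psi_ubp(2)[OF r(1), of k] r(2) k by simp
    then show ?thesis using k suminf_repeat[OF sr n, of k] by (simp add: power_sums_def)
  qed
  then have "q = (\<lambda>i. r (i div n))"
    by (rule power_sums_inj[OF sq summable_repeat[OF sr n]])
  then have "mult_of q x = n * mult_of r x" for x using mult_repeat[OF sr n] by simp
  moreover have "q \<longlonglongrightarrow> 0" using summable_seq_tail[OF sq] by (simp add: tail_seq_def)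
  ultimately show ?thesis by (simp add: multiplicities_divisible_iff)
qed

lemma root_parameters:
  assumes K: "(c, q) \<in> KK" and n: "0 < n" and div: "multiplicities_divisible n (eta q)"
  shows "\<exists>!r. (c / real n, r) \<in> KK \<and> eta r = scale_measure (ennreal (1 / real n)) (eta q)"
proof -
  have sq: "summable_seq q" using K by (simp add: KK_summable_seq)
  have lim: "s \<longlonglongrightarrow> 0" if "summable_seq s" for s using summable_seq_tail[OF that] by (simp add: tail_seq_def)
  have "n dvd mult_of q x" if "0 < x" for x
    using div that by (simp add: multiplicities_divisible_iff lim[OF sq])
  then obtain r where r: "summable_seq r" "\<And>x. 0 < x \<Longrightarrow> mult_of q x = n * mult_of r x"
    using divided_seq[OF sq n] by blast
  have "suminf q = real n * suminf r" using power_sums_divided[OF sq r(1) n r(2), of 1] by simp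
  then have "(c / real n, r) \<in> KK" using K r(1) n by (auto simp: KK_summable_seq field_simps)
  moreover have "eta r = scale_measure (ennreal (1 / real n)) (eta q)"
    using r(2) by (simp add: eta_scale_iff[OF lim[OF sq] lim[OF r(1)] n])
  moreover have "s = r" if "(c / real n, s) \<in> KK" "eta s = scale_measure (ennreal (1 / real n)) (eta q)" for s
    using that r calculation(2)
    by (intro eta_inj) (auto simp: KK_summable_seq)
  ultimately show ?thesis by blast
qed

text \<open>An n-fold convolution multiplies every power value by n. At k = 1 this fixes c / n, for
  k >= 2 it is the division of multiplicities; since power values determine a character, both
  directions follow.\<close>

lemma conv_root_iff:
  assumes K: "(c, q) \<in> KK" and n: "0 < n" and r: "(c / real n, r) \<in> KK"
    and eta: "eta r = scale_measure (ennreal (1 / real n)) (eta q)"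
  shows "conv_root n (Psi c q) \<Xi> \<longleftrightarrow> \<Xi> = Psi (c / real n) r"
proof -
  have sq: "summable_seq q" and sr: "summable_seq r" using K r by (auto simp: KK_summable_seq)
  have "q \<longlonglongrightarrow> 0" "r \<longlonglongrightarrow> 0" using summable_seq_tail[OF sq] summable_seq_tail[OF sr] by (auto simp: tail_seq_def)
  then have m: "mult_of q x = n * mult_of r x" if "0 < x" for x
    using eta that eta_scale_iff n by blast
  have p: "power_sums c q k = real n * power_sums (c / real n) r k" if "0 < k" for k
    using power_sums_divided[OF sq sr n m that] n by (simp add: power_sums_def)
  show ?thesis
  proof
    assume "conv_root n (Psi c q) \<Xi>"
    then have \<Xi>: "ubp_character \<Xi>" "conv_power \<Xi> n = Psi c q" by (auto simp: conv_root_def)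
    show "\<Xi> = Psi (c / real n) r"
    proof (rule ubp_eqI[OF \<Xi>(1) Psi_ubp(1)[OF r]])
      fix k :: nat assume k: "0 < k"
      have "real n * power_value \<Xi> k = power_value (Psi c q) k"
        using ubp_conv_power(2)[OF \<Xi>(1) k, of n] \<Xi>(2) by simp
      then show "power_value \<Xi> k = power_value (Psi (c / real n) r) k"
        using p[OF k] n by (simp add: Psi_ubp(2)[OF K k] Psi_ubp(2)[OF r k])
    qed
  next
    assume \<Xi>: "\<Xi> = Psi (c / real n) r"
    have "conv_power \<Xi> n = Psi c q"
    proof (rule ubp_eqI[OF _ Psi_ubp(1)[OF K]])
      show "ubp_character (conv_power \<Xi> n)" unfolding \<Xi> by (rule ubp_conv_power(1)[OF Psi_ubp(1)[OF r]])
      show "power_value (conv_power \<Xi> n) k = power_value (Psi c q) k" if k: "0 < k" for k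
        unfolding \<Xi> ubp_conv_power(2)[OF Psi_ubp(1)[OF r] k] Psi_ubp(2)[OF r k] Psi_ubp(2)[OF K k]
        using p[OF k] by simp
    qed
    then show "conv_root n (Psi c q) \<Xi>" using Psi_ubp(1)[OF r] \<Xi> by (simp add: conv_root_def)
  qed
qed

lemma conv_root_exists_iff:
  assumes K: "(c, q) \<in> KK" and n: "0 < n"
  shows "(\<exists>\<Xi>. conv_root n (Psi c q) \<Xi>) \<longleftrightarrow> multiplicities_divisible n (eta q)"
  using conv_root_divides[OF K n] root_parameters[OF K n] conv_root_iff[OF K n] by metis

section \<open>Infinite divisibility and convolution semigroups\<close>

lemma infinitely_divisible_iff:
  "infinitely_divisible \<Psi> \<longleftrightarrow> (\<exists>c\<ge>0. \<Psi> = Psi c (\<lambda>_. 0))"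
proof
  assume inf: "infinitely_divisible \<Psi>"
  then obtain c q where K: "(c, q) \<in> KK" and \<Psi>: "\<Psi> = Psi c q"
    using ubp_classify unfolding infinitely_divisible_def by metis
  have sq: "summable_seq q" using K by (simp add: KK_summable_seq)
  then have lim: "q \<longlonglongrightarrow> 0" using summable_seq_tail[OF sq] by (simp add: tail_seq_def)
  have "mult_of q x = mult_of (\<lambda>_. 0) x" if x: "0 < x" for x
  proof -
    \<comment> \<open>The summand 2 makes this an admissible order of a root, and it exceeds the
      multiplicity, so divisibility leaves only multiplicity 0.\<close>
    let ?n = "mult_of q x + 2"
    have "multiplicities_divisible ?n (eta q)"
      using inf conv_root_exists_iff[OF K, of ?n] unfolding infinitely_divisible_def \<Psi> by simp
    then have "?n dvd mult_of q x" using x by (simp add: multiplicities_divisible_iff[OF lim])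
    then show ?thesis using x by (auto simp: mult_of_zero dest: dvd_imp_le)
  qed
  then have "q = (\<lambda>_. 0)" by (rule mult_inj[OF sq summable_seq_zero])
  then show "\<exists>c\<ge>0. \<Psi> = Psi c (\<lambda>_. 0)" using KK_D(1)[OF K] \<Psi> by blast
next
  assume "\<exists>c\<ge>0. \<Psi> = Psi c (\<lambda>_. 0)"
  then obtain c where c: "0 \<le> c" "\<Psi> = Psi c (\<lambda>_. 0)" by blast
  then have K: "(c, \<lambda>_. 0) \<in> KK" by (simp add: zero_seq_KK)
  have "multiplicities_divisible n (eta (\<lambda>_. 0))" for n
    by (simp add: multiplicities_divisible_iff mult_of_zero)
  then show "infinitely_divisible \<Psi>"
    using conv_root_exists_iff[OF K] Psi_ubp(1)[OF K] c unfolding infinitely_divisible_def by auto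
qed

text \<open>The Cauchy equation on the half-line: nonnegativity makes additive functions monotone,
  and monotone ones are squeezed between their values at integers.\<close>

lemma nonneg_additive_linear:
  fixes a :: "real \<Rightarrow> real"
  assumes nn: "\<And>t. 0 \<le> t \<Longrightarrow> 0 \<le> a t" and add: "\<And>s t. 0 \<le> s \<Longrightarrow> 0 \<le> t \<Longrightarrow> a (s + t) = a s + a t"
    and t: "0 \<le> t"
  shows "a t = a 1 * t"
proof -
  have mono: "a s \<le> a u" if "0 \<le> s" "s \<le> u" for s u
    using add[of s "u - s"] nn[of "u - s"] that by simp
  have zero: "a 0 = 0" using add[of 0 0] by simp
  have nat: "a (real n * s) = real n * a s" if "0 \<le> s" for n s
  proof (induction n)
    case (Suc n)
    then show ?case using add[of "real n * s" s] that by (simp add: algebra_simps)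
  qed (simp add: zero)
  have "\<bar>a t - a 1 * t\<bar> \<le> a 1 / real (Suc n)" for n
  proof -
    \<comment> \<open>\<open>?m\<close> is the integer part of \<open>?n * t\<close>. Both
      \<open>?n * a t\<close> and \<open>?n * t * a 1\<close> lie between \<open>?m\<close> and
      \<open>?m + 1\<close> times \<open>a 1\<close>, so they differ by at most
      \<open>a 1\<close>.\<close>
    let ?n = "Suc n" and ?m = "nat \<lfloor>real (Suc n) * t\<rfloor>"
    have m: "real ?m \<le> real ?n * t" "real ?n * t \<le> real ?m + 1"
      using t by (auto simp: of_nat_nat) 
    have "real ?m * a 1 \<le> real ?n * a t"
      using mono[of "real ?m * 1" "real ?n * t"] m nat[of 1 ?m] nat[OF t, of ?n] by simp
    moreover have "real ?n * a t \<le> (real ?m + 1) * a 1"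
      using mono[of "real ?n * t" "real (Suc ?m) * 1"] m t nat[of 1 "Suc ?m"] nat[OF t, of ?n]
      by (simp add: add.commute)
    moreover have "real ?m * a 1 \<le> real ?n * t * a 1" "real ?n * t * a 1 \<le> (real ?m + 1) * a 1"
      using m nn[of 1] by (auto intro: mult_right_mono)
    ultimately have "\<bar>real ?n * a t - real ?n * t * a 1\<bar> \<le> a 1"
      by (simp add: abs_le_iff algebra_simps)
    then have "\<bar>real ?n * (a t - a 1 * t)\<bar> \<le> a 1" by (simp add: algebra_simps)
    then have "real ?n * \<bar>a t - a 1 * t\<bar> \<le> a 1" by (simp add: abs_mult)
    then show ?thesis by (simp add: field_simps)
  qed
  moreover have "(\<lambda>n. a 1 / real (Suc n)) \<longlonglongrightarrow> 0"
    by (rule LIMSEQ_Suc) (rule lim_const_over_n)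
  ultimately have "\<bar>a t - a 1 * t\<bar> \<le> 0" by (intro LIMSEQ_le_const) auto
  then show ?thesis by simp
qed

lemma conv_semigroup_power:
  assumes S: "conv_semigroup S" and t: "0 \<le> t"
  shows "conv_power (S t) n = S (real n * t)"
proof (induction n)
  case 0
  then show ?case using S by (simp add: conv_power_def conv_semigroup_def)
next
  case (Suc n)
  have "S (t + real n * t) = S t \<star> S (real n * t)" using S t by (simp add: conv_semigroup_def)
  moreover have "conv_power (S t) (Suc n) = S t \<star> conv_power (S t) n" by (simp add: conv_power_def)
  ultimately show ?case using Suc by (simp add: algebra_simps)
qed

lemma dust_power_value_1: "0 \<le> c \<Longrightarrow> power_value (Psi c (\<lambda>_. 0)) 1 = c"
  by (simp add: Psi_ubp(2) zero_seq_KK power_sums_zero)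

text \<open>\<open>S (t / n)\<close> is an n-th root of \<open>S t\<close>, so every
  \<open>S t\<close> is pure dust. Its parameter is the power value at k = 1, hence additive and
  nonnegative in t, hence linear without any continuity assumption.\<close>

lemma conv_semigroup_dust:
  assumes S: "conv_semigroup S"
  shows "\<exists>a\<ge>0. \<forall>t\<ge>0. S t = Psi (a * t) (\<lambda>_. 0)"
proof -
  have "\<exists>c\<ge>0. S t = Psi c (\<lambda>_. 0)" if t: "0 \<le> t" for t
  proof -
    have "conv_root n (S t) (S (t / real n))" if "2 \<le> n" for n
      using S t that conv_semigroup_power[OF S, of "t / real n" n]
      by (simp add: conv_root_def conv_semigroup_def)
    then have "infinitely_divisible (S t)"
      using S t unfolding infinitely_divisible_def conv_semigroup_def by blast
    then show ?thesis by (simp add: infinitely_divisible_iff)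
  qed
  then obtain a where a: "\<And>t. 0 \<le> t \<Longrightarrow> 0 \<le> a t" "\<And>t. 0 \<le> t \<Longrightarrow> S t = Psi (a t) (\<lambda>_. 0)" by metis
  have add: "a (s + t) = a s + a t" if "0 \<le> s" "0 \<le> t" for s t
  proof -
    have "S (s + t) = S s \<star> S t" and "ubp_character (S s)" "ubp_character (S t)"
      using S that by (auto simp: conv_semigroup_def)
    then have "power_value (S (s + t)) 1 = power_value (S s) 1 + power_value (S t) 1"
      by (simp add: power_value_convolve)
    then show ?thesis using that a by (simp add: dust_power_value_1 del: One_nat_def)
  qed
  have lin: "a t = a 1 * t" if "0 \<le> t" for t
    using a(1) add that by (rule nonneg_additive_linear)
  show ?thesis
  proof (intro exI[of _ "a 1"] conjI allI impI)
    fix t :: real assume t: "0 \<le> t"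
    show "S t = Psi (a 1 * t) (\<lambda>_. 0)" using a(2)[OF t] unfolding lin[OF t] .
  qed (simp add: a(1))
qed

text \<open>For pure dust the only power value that varies is the one at k = 1, which equals a t.
  Its convergence along a sequence forces convergence at every tree.\<close>

lemma continuous_dust:
  assumes "0 \<le> a"
  shows "continuous_on {0..} (\<lambda>t. Psi (a * t) (\<lambda>_. 0) (gl_basis \<tau>))"
proof (rule continuous_on_sequentiallyI)
  fix u :: "nat \<Rightarrow> real" and t assume u: "\<forall>n. u n \<in> {0..}" and t: "t \<in> {0..}" and lim: "u \<longlonglongrightarrow> t"
  have K: "(a * u n, \<lambda>_. 0) \<in> KK" "(a * t, \<lambda>_. 0) \<in> KK" for n
    using u t assms by (auto simp: zero_seq_KK)
  have "(\<lambda>n. power_value (Psi (a * u n) (\<lambda>_. 0)) k) \<longlonglongrightarrow> power_sums (a * t) (\<lambda>_. 0) k" if "0 < k" for k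
    using tendsto_mult[OF tendsto_const lim, of a] that
    by (simp add: Psi_ubp(2)[OF K(1)] power_sums_zero)
  then obtain \<psi> where \<psi>: "ubp_character \<psi>" "\<And>s. (\<lambda>n. Psi (a * u n) (\<lambda>_. 0) (gl_basis s)) \<longlonglongrightarrow> \<psi> (gl_basis s)"
      "\<And>k. 0 < k \<Longrightarrow> power_value \<psi> k = power_sums (a * t) (\<lambda>_. 0) k"
    using ubp_limit[of "\<lambda>n. Psi (a * u n) (\<lambda>_. 0)" "power_sums (a * t) (\<lambda>_. 0)"] Psi_ubp(1)[OF K(1)] by blast
  have "\<psi> = Psi (a * t) (\<lambda>_. 0)" by (rule ubp_eqI) (use \<psi> Psi_ubp[OF K(2)] in auto)
  then show "(\<lambda>n. Psi (a * u n) (\<lambda>_. 0) (gl_basis \<tau>)) \<longlonglongrightarrow> Psi (a * t) (\<lambda>_. 0) (gl_basis \<tau>)"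
    using \<psi>(2) by simp
qed

theorem theorem7p3:
  shows
    "(comm_monoid KK_monoid \<and> comm_monoid (Rnonneg_monoid \<times>\<times> N1_monoid) \<and>
      (\<lambda>(c, q). (dust c q, eta q)) \<in> iso KK_monoid (Rnonneg_monoid \<times>\<times> N1_monoid) \<and>
      (\<lambda>(c, q). (dust c q, eta q)) \<one>\<^bsub>KK_monoid\<^esub> = \<one>\<^bsub>Rnonneg_monoid \<times>\<times> N1_monoid\<^esub> \<and>
      (\<forall>(c, q)\<in>KK. \<forall>t.
         (\<lambda>L. foldl (\<star>) (Psi (dust c q) (\<lambda>_. 0))
                (map (\<lambda>i. Psi (q i) (single_seq (q i))) [0..<L]) (gl_basis t))
         \<longlonglongrightarrow> Psi c q (gl_basis t)))
   \<and>
     (\<forall>(c, q)\<in>KK. \<forall>n::nat. 2 \<le> n \<longrightarrow>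
        ((\<exists>\<Xi>. conv_root n (Psi c q) \<Xi>) \<longleftrightarrow> multiplicities_divisible n (eta q)) \<and>
        (multiplicities_divisible n (eta q) \<longrightarrow>
           (\<exists>!r. (c / real n, r) \<in> KK \<and> eta r = scale_measure (ennreal (1 / real n)) (eta q)) \<and>
           (\<forall>r. (c / real n, r) \<in> KK \<and> eta r = scale_measure (ennreal (1 / real n)) (eta q) \<longrightarrow>
              (\<forall>\<Xi>. conv_root n (Psi c q) \<Xi> \<longleftrightarrow> \<Xi> = Psi (c / real n) r))))
   \<and>
     ({\<Psi>. infinitely_divisible \<Psi>} = {Psi c (\<lambda>_. 0) | c. 0 \<le> c} \<and>
      (\<forall>S. conv_semigroup S \<longrightarrow>
         (\<exists>!a. 0 \<le> a \<and> (\<forall>t\<ge>0. S t = Psi (a * t) (\<lambda>_. 0))) \<and>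
         (\<forall>\<tau>. continuous_on {0..} (\<lambda>t. S t (gl_basis \<tau>)))))"
  (is "(_ \<and> _ \<and> _ \<and> ?one \<and> ?fact) \<and> (\<forall>(c, q)\<in>KK. \<forall>n. 2 \<le> n \<longrightarrow> ?roots c q n) \<and> (?inf \<and> ?semi)")
proof (intro conjI)
  show ?one
    by (simp add: KK_monoid_def DirProd_def Rnonneg_monoid_def N1_monoid_def dust_def eta_zero)
  show ?fact using Psi_factorization by blast
  have "?roots c q n" if K: "(c, q) \<in> KK" and "2 \<le> n" for c q n
  proof -
    have n: "0 < n" using that by simp
    show ?thesis
      using conv_root_exists_iff[OF K n] root_parameters[OF K n] conv_root_iff[OF K n] by blast
  qed
  then show "\<forall>(c, q)\<in>KK. \<forall>n. 2 \<le> n \<longrightarrow> ?roots c q n" by blast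
  show ?inf by (auto simp: infinitely_divisible_iff)
  show ?semi
  proof (intro allI impI conjI)
    fix S assume S: "conv_semigroup S"
    obtain a where a: "0 \<le> a" "\<And>t. 0 \<le> t \<Longrightarrow> S t = Psi (a * t) (\<lambda>_. 0)"
      using conv_semigroup_dust[OF S] by blast
    show "\<exists>!a. 0 \<le> a \<and> (\<forall>t\<ge>0. S t = Psi (a * t) (\<lambda>_. 0))"
    proof (intro ex1I[of _ a] conjI allI impI)
      fix b assume b: "0 \<le> b \<and> (\<forall>t\<ge>0. S t = Psi (b * t) (\<lambda>_. 0))"
      then have "Psi b (\<lambda>_. 0) = Psi a (\<lambda>_. 0)" using a(2)[of 1] by simp
      then show "b = a" using dust_power_value_1 a(1) b by metis
    qed (use a in auto)
    show "continuous_on {0..} (\<lambda>t. S t (gl_basis \<tau>))" for \<tau>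
    proof -
      have "continuous_on {0..} (\<lambda>t. S t (gl_basis \<tau>)) \<longleftrightarrow>
          continuous_on {0..} (\<lambda>t. Psi (a * t) (\<lambda>_. 0) (gl_basis \<tau>))"
        by (rule continuous_on_cong) (auto simp: a(2))
      then show ?thesis using continuous_dust[OF a(1)] by blast
    qed
  qed
qed (rule comm_monoid_KK comm_monoid_target dust_eta_iso)+

end
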